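(* There is an absolute constant $K>0$ such that the following holds. Let $n\ge1$, $\epsilon\ge0$, and let $f\colon S_n\to\mathbb{R}$ be linear with $\mathbb{E}[\operatorname{dist}(f,\{0,1\})^2]\le\epsilon$ and $\mathbb{E}[f]\le1/2$. Then there is a set $\mathcal{C}\subseteq[n]^2$ of cosets with $|\mathcal{C}|\le Kn$ and at most $K\epsilon n^2$ unordered pairs of non-disjoint cosets in $\mathcal{C}$, such that $g=\sum_{(i,j)\in\mathcal{C}}x_{i,j}$ satisfies $\mathbb{E}[(f-g)^2]\le K\epsilon$. Conversely, for every $A>0$ there is $B>0$ such that for all $n\ge1$, $\epsilon\ge0$ and every $\mathcal{C}\subseteq[n]^2$ with $|\mathcal{C}|\le An$ and at most $A\epsilon n^2$ unordered pairs of non-disjoint cosets, $g=\sum_{(i,j)\in\mathcal{C}}x_{i,j}$ satisfies $\mathbb{E}[\operatorname{dist}(g,\{0,1\})^2]\le B\epsilon$.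
   Context: $S_n$ is the symmetric group on $[n]$; expectations and probabilities are over a uniformly random $\pi\in S_n$. $x_{i,j}(\pi)=1$ if $\pi(i)=j$ and $0$ otherwise. A function $S_n\to\mathbb{R}$ is linear if it equals $\sum_{i,j}c_{i,j}x_{i,j}$ for some reals $c_{i,j}$. $\operatorname{dist}(y,\{0,1\})=\min(|y|,|y-1|)$. The coset $(i,j)$ is $\{\pi:\pi(i)=j\}$; two distinct cosets $(i,j),(k,\ell)$ are non-disjoint iff $i\neq k$ and $j\neq\ell$. *)

theory Defs
  imports "HOL-Probability.Probability" "HOL-Combinatorics.Permutations"
begin

definition Sym :: "nat \<Rightarrow> (nat \<Rightarrow> nat) set" where
  "Sym n = {\<pi>. \<pi> permutes {1..n}}"

definition expect :: "nat \<Rightarrow> ((nat \<Rightarrow> nat) \<Rightarrow> real) \<Rightarrow> real" where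
  "expect n f = measure_pmf.expectation (pmf_of_set (Sym n)) f"

definition x_ind :: "nat \<Rightarrow> nat \<Rightarrow> (nat \<Rightarrow> nat) \<Rightarrow> real" where
  "x_ind i j \<pi> = (if \<pi> i = j then 1 else 0)"

text \<open>A function on the symmetric group is represented by a total function on
  \<^typ>\<open>nat \<Rightarrow> nat\<close>, of which only the values on \<^term>\<open>Sym n\<close> matter.\<close>

definition linear_on_Sym :: "nat \<Rightarrow> ((nat \<Rightarrow> nat) \<Rightarrow> real) \<Rightarrow> bool" where
  "linear_on_Sym n f \<longleftrightarrow>
     (\<exists>c :: nat \<Rightarrow> nat \<Rightarrow> real. \<forall>\<pi>\<in>Sym n. f \<pi> = (\<Sum>i\<in>{1..n}. \<Sum>j\<in>{1..n}. c i j * x_ind i j \<pi>))"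

definition dist01 :: "real \<Rightarrow> real" where
  "dist01 y = min \<bar>y\<bar> \<bar>y - 1\<bar>"

definition coset :: "nat \<Rightarrow> nat \<times> nat \<Rightarrow> (nat \<Rightarrow> nat) set" where
  "coset n = (\<lambda>(i, j). {\<pi> \<in> Sym n. \<pi> i = j})"

text \<open>Cosets are identified with their index pairs, so distinctness is that of the
  indices: for \<open>n = 2\<close> the pairs \<open>(1,1)\<close> and \<open>(2,2)\<close> are distinct although both
  denote the same set of permutations.\<close>

definition nondisjoint_pairs :: "nat \<Rightarrow> (nat \<times> nat) set \<Rightarrow> (nat \<times> nat) set set" where
  "nondisjoint_pairs n C =
     {{a, b} | a b. a \<in> C \<and> b \<in> C \<and> a \<noteq> b \<and> coset n a \<inter> coset n b \<noteq> {}}"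

definition coset_sum :: "(nat \<times> nat) set \<Rightarrow> (nat \<Rightarrow> nat) \<Rightarrow> real" where
  "coset_sum C \<pi> = (\<Sum>(i, j)\<in>C. x_ind i j \<pi>)"

lemma coset_nondisjoint_iff:
  assumes "i \<in> {1..n}" "j \<in> {1..n}" "k \<in> {1..n}" "l \<in> {1..n}" and ne: "(i, j) \<noteq> (k, l)"
  shows "coset n (i, j) \<inter> coset n (k, l) \<noteq> {} \<longleftrightarrow> i \<noteq> k \<and> j \<noteq> l"
proof
  assume "coset n (i, j) \<inter> coset n (k, l) \<noteq> {}"
  then obtain \<pi> where p: "\<pi> permutes {1..n}" "\<pi> i = j" "\<pi> k = l"
    by (auto simp: coset_def Sym_def)
  then show "i \<noteq> k \<and> j \<noteq> l"
    using ne permutes_inj[OF p(1)] by (auto dest: injD)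
next
  assume d: "i \<noteq> k \<and> j \<noteq> l"
  define \<sigma> where "\<sigma> = Transposition.transpose i j"
  define \<pi> where "\<pi> = Transposition.transpose (\<sigma> k) l \<circ> \<sigma>"
  have s: "\<sigma> permutes {1..n}"
    unfolding \<sigma>_def using assms by (intro permutes_swap_id) auto
  have "\<sigma> k \<in> {1..n}"
    using permutes_in_image[OF s] assms(3) by blast
  then have "Transposition.transpose (\<sigma> k) l permutes {1..n}"
    using assms(4) by (intro permutes_swap_id)
  with s have "\<pi> permutes {1..n}"
    unfolding \<pi>_def by (rule permutes_compose)
  moreover have "\<sigma> i = j" "\<sigma> k \<noteq> j"
    using d by (auto simp: \<sigma>_def Transposition.transpose_def)
  then have "\<pi> i = j" "\<pi> k = l"
    using d by (auto simp: \<pi>_def Transposition.transpose_def)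
  ultimately show "coset n (i, j) \<inter> coset n (k, l) \<noteq> {}"
    by (auto simp: coset_def Sym_def)
qed

end

theory Submission
  imports Defs
begin

text \<open>Write \<open>f = \<Sum>i. c i (\<pi> i)\<close>. Composing \<open>\<pi>\<close> with disjoint transpositions turns \<open>f\<close> into an affine
  function on a cube, whose coefficients are the double differences of \<open>c\<close>. A Friedgut-Kalai-Naor
  theorem for affine functions bounds the sum of the squared distances of these coefficients from
  \<open>{-1, 0, 1}\<close>. Averaged over \<open>\<pi>\<close> and over the matchings of a round-robin schedule, this shows that
  the double differences relative to a suitable base cell can be rounded, so that \<open>f\<close> is \<open>O(\<epsilon>)\<close>-close
  to an integer-valued linear function \<open>h = m + \<Sum>i. r i (\<pi> i)\<close> with \<open>O(n)\<close> nonzero coefficients.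

  For bounded \<open>n\<close> and small \<open>\<epsilon>\<close>, \<open>h\<close> is exactly Boolean, and a potential on the rows and columns
  makes its coefficients nonnegative integers. For large \<open>n\<close> take the representation of \<open>h\<close> with
  minimal support. Since \<open>h\<close> is mostly Boolean, no cell lies in both a heavy row and a heavy
  column, so by switching a constant proportion of the permutations avoids the support; this
  forces \<open>m \<in> {0, 1}\<close>. Planting a single cell in such a permutation shows that the coefficients
  different from \<open>1 - 2 * m\<close> contribute only \<open>O(\<epsilon>)\<close>. If \<open>m = 1\<close>, the condition \<open>E f \<le> 1/2\<close>
  concentrates the remaining cells on one line, and the complement within that line is the answer.

  Pairs of non-disjoint cosets are counted by \<open>E (g\<^sup>2 - g)\<close>, which for a sum of cosets \<open>g\<close> lies between
  one and two times the mean of the squared distance of \<open>g\<close> from \<open>{0, 1}\<close>.\<close>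

subsection \<open>Averages over permutations\<close>

text \<open>Adding row or column functions to \<open>c\<close> changes \<open>lin n c\<close> on
  \<open>Sym n\<close> only by a constant, so coefficients have a meaning only through double
  differences, and every statement about them needs a choice of representation. Rounding relative to
  a base cell provides one, but says nothing about \<open>m\<close>. In a representation with
  minimal support, zero is the most frequent entry of each line; hence a line with many nonzero
  entries has many pairs of different entries, which swaps detect. The obstacle here is a line
  filled by the support: every permutation would hit it. The proportion of avoiding permutations is
  a tiny absolute constant, which enters the later constants and the threshold for \<open>n\<close>.
  Below the threshold the argument gives nothing, but there the bound on \<epsilon> may depend on
  \<open>n\<close>, so that the error is smaller than the weight of a single permutation. The
  condition on the mean breaks the symmetry between \<open>f\<close> and \<open>1 - f\<close>; the
  complement of a sum of cosets is again one if they share a line.\<close>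

abbreviation swp :: "'a \<Rightarrow> 'a \<Rightarrow> 'a \<Rightarrow> 'a" where
  "swp \<equiv> Transposition.transpose"

definition lin :: "nat \<Rightarrow> (nat \<Rightarrow> nat \<Rightarrow> 'a::comm_monoid_add) \<Rightarrow> (nat \<Rightarrow> nat) \<Rightarrow> 'a" where
  "lin n c \<pi> = (\<Sum>i\<in>{1..n}. c i (\<pi> i))"

lemma finite_Sym [simp, intro]: "finite (Sym n)"
  unfolding Sym_def by (rule finite_permutations) simp

lemma card_Sym [simp]: "card (Sym n) = fact n"
  unfolding Sym_def by (rule card_permutations) auto

lemma id_in_Sym [simp]: "id \<in> Sym n"
  by (simp add: Sym_def permutes_id)

lemma Sym_compose: "\<pi> \<in> Sym n \<Longrightarrow> \<sigma> \<in> Sym n \<Longrightarrow> \<pi> \<circ> \<sigma> \<in> Sym n"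
  by (simp add: Sym_def permutes_compose)

lemma Sym_inv: "\<pi> \<in> Sym n \<Longrightarrow> inv \<pi> \<in> Sym n"
  by (simp add: Sym_def permutes_inv)

lemma transpose_in_Sym: "a \<in> {1..n} \<Longrightarrow> b \<in> {1..n} \<Longrightarrow> swp a b \<in> Sym n"
  by (simp add: Sym_def permutes_swap_id)

lemma Sym_in: "\<pi> \<in> Sym n \<Longrightarrow> \<pi> i \<in> {1..n} \<longleftrightarrow> i \<in> {1..n}"
  unfolding Sym_def mem_Collect_eq by (rule permutes_in_image)

lemma Sym_bij: "\<pi> \<in> Sym n \<Longrightarrow> bij \<pi>"
  by (simp add: Sym_def permutes_bij)

lemma Sym_inj: "\<pi> \<in> Sym n \<Longrightarrow> \<pi> i = \<pi> j \<longleftrightarrow> i = j"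
  using Sym_bij[of \<pi> n] by (simp add: bij_is_inj inj_eq)

lemma Sym_inv_eq: "\<pi> \<in> Sym n \<Longrightarrow> inv \<pi> j = i \<longleftrightarrow> \<pi> i = j"
  using bij_inv_eq_iff[OF Sym_bij, of \<pi> n i j] by auto

lemma Sym_bij_betw: "\<pi> \<in> Sym n \<Longrightarrow> bij_betw \<pi> {1..n} {1..n}"
  by (simp add: Sym_def permutes_imp_bij)

lemma sum_Sym_compose_right: "\<sigma> \<in> Sym n \<Longrightarrow> (\<Sum>\<pi>\<in>Sym n. F (\<pi> \<circ> \<sigma>)) = (\<Sum>\<pi>\<in>Sym n. F \<pi>)"
  unfolding Sym_def using sum_permutations_compose_right[of \<sigma> "{1..n}" F] by (simp add: Sym_def)

section \<open>Expectation as a finite average, and permutations with prescribed values\<close>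

lemma expect_eq: "expect n F = (\<Sum>\<pi>\<in>Sym n. F \<pi>) / fact n"
proof -
  have "Sym n \<noteq> {}" using id_in_Sym[of n] by blast
  then show ?thesis unfolding expect_def
    by (subst integral_pmf_of_set) auto
qed

lemma expect_mono: "(\<And>\<pi>. \<pi> \<in> Sym n \<Longrightarrow> F \<pi> \<le> G \<pi>) \<Longrightarrow> expect n F \<le> expect n G"
  unfolding expect_eq by (intro divide_right_mono sum_mono) auto

lemma expect_cong: "(\<And>\<pi>. \<pi> \<in> Sym n \<Longrightarrow> F \<pi> = G \<pi>) \<Longrightarrow> expect n F = expect n G"
  unfolding expect_eq by (simp cong: sum.cong)

lemma expect_add: "expect n (\<lambda>\<pi>. F \<pi> + G \<pi>) = expect n F + expect n G"
  unfolding expect_eq by (simp add: sum.distrib add_divide_distrib)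

lemma expect_cmult: "expect n (\<lambda>\<pi>. c * F \<pi>) = c * expect n F"
  unfolding expect_eq by (simp add: sum_distrib_left)

lemma expect_sum: "expect n (\<lambda>\<pi>. \<Sum>a\<in>A. F a \<pi>) = (\<Sum>a\<in>A. expect n (F a))"
  unfolding expect_eq sum_divide_distrib by (rule sum.swap)

lemma expect_const [simp]: "expect n (\<lambda>\<pi>. c) = c"
  unfolding expect_eq by simp

lemma expect_nonneg: "(\<And>\<pi>. \<pi> \<in> Sym n \<Longrightarrow> 0 \<le> F \<pi>) \<Longrightarrow> 0 \<le> expect n F"
  unfolding expect_eq by (intro divide_nonneg_nonneg sum_nonneg) auto

text \<open>Induction on the lists: the fibres over the possible values \<open>y'\<close> of the new
  point are exchanged by composing with \<open>swp y y'\<close> on the left, so all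
  \<open>n - length xs\<close> of them have the same size.\<close>

lemma card_Sym_map:
  assumes "length xs = length ys" "distinct xs" "distinct ys" "set xs \<subseteq> {1..n}" "set ys \<subseteq> {1..n}"
  shows "card {\<pi> \<in> Sym n. map \<pi> xs = ys} = fact (n - length xs)"
  using assms
proof (induction xs ys rule: list_induct2)
  case Nil
  then show ?case by simp
next
  case (Cons x xs y ys)
  let ?A = "\<lambda>y'. {\<pi> \<in> Sym n. map \<pi> (x # xs) = y' # ys}"
  let ?Y = "{1..n} - set ys"
  have IH: "card {\<pi> \<in> Sym n. map \<pi> xs = ys} = fact (n - length xs)"
    using Cons by auto
  have cY: "card ?Y = n - length xs"
    using Cons.prems Cons.hyps by (simp add: card_Diff_subset distinct_card)
  have lt: "length xs < n"
  proof -
    have "card (set (x # xs)) \<le> card {1..n}" using Cons.prems by (intro card_mono) auto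
    then show ?thesis using Cons.prems(1) distinct_card[OF Cons.prems(1)] by simp
  qed
  have eq: "{\<pi> \<in> Sym n. map \<pi> xs = ys} = (\<Union>y'\<in>?Y. ?A y')"
  proof (intro equalityI subsetI)
    fix \<pi> assume p: "\<pi> \<in> {\<pi> \<in> Sym n. map \<pi> xs = ys}"
    then have "\<pi> x \<in> {1..n}" using Sym_in Cons.prems by auto
    moreover have "\<pi> x \<notin> set ys"
      using p Cons.prems(1) Sym_inj by (fastforce)
    ultimately show "\<pi> \<in> (\<Union>y'\<in>?Y. ?A y')" using p by auto
  qed auto
  have same: "card (?A y') = card (?A y)" if y': "y' \<in> ?Y" for y'
  proof (rule bij_betw_same_card)
    let ?t = "\<lambda>\<pi>. swp y y' \<circ> \<pi>"
    have ty: "swp y y' \<in> Sym n" using y' Cons.prems by (intro transpose_in_Sym) auto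
    have fix_ys: "map (swp y y') ys = ys"
      using y' Cons.prems by (auto intro!: map_idI simp: Transposition.transpose_def)
    have inv: "?t (?t \<pi>) = \<pi>" for \<pi> by (simp add: fun_eq_iff)
    have f: "?t \<pi> \<in> Sym n" "map (?t \<pi>) xs = ys" if "\<pi> \<in> Sym n" "map \<pi> xs = ys" for \<pi>
      using that ty fix_ys by (auto intro: Sym_compose simp flip: map_map simp del: comp_apply)
    show "bij_betw ?t (?A y') (?A y)"
      by (rule bij_betw_byWitness[where f' = ?t]) (use inv f in \<open>auto simp del: comp_apply simp: comp_apply[of _ _ x]\<close>)
  qed
  have "fact (n - length xs) = (\<Sum>y'\<in>?Y. card (?A y'))"
    unfolding IH[symmetric] eq by (intro card_UN_disjoint) auto
  also have "\<dots> = (n - length xs) * card (?A y)"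
    using same cY by simp
  finally have "(n - length xs) * card (?A y) = fact (n - length xs)" by simp
  also have "\<dots> = (n - length xs) * fact (n - length (x # xs))"
    using lt by (simp add: fact_reduce)
  finally show ?case using lt by simp
qed

lemma card_Sym_1:
  assumes "i \<in> {1..n}" "j \<in> {1..n}"
  shows "card {\<pi> \<in> Sym n. \<pi> i = j} = fact (n - 1)"
  using card_Sym_map[of "[i]" "[j]" n] assms by simp

lemma card_Sym_2:
  assumes "i \<in> {1..n}" "k \<in> {1..n}" "i \<noteq> k" "j \<in> {1..n}" "l \<in> {1..n}" "j \<noteq> l"
  shows "card {\<pi> \<in> Sym n. \<pi> i = j \<and> \<pi> k = l} = fact (n - 2)"
  using card_Sym_map[of "[i, k]" "[j, l]" n] assms by (simp add: numeral_2_eq_2)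

lemma card_Sym_4:
  assumes "distinct [i, k, s, t]" "distinct [p, q, j, l]" "{i, k, s, t, p, q, j, l} \<subseteq> {1..n}"
  shows "card {\<pi> \<in> Sym n. \<pi> i = p \<and> \<pi> k = q \<and> \<pi> s = j \<and> \<pi> t = l} = fact (n - 4)"
  using card_Sym_map[of "[i, k, s, t]" "[p, q, j, l]" n] assms by (simp add: eval_nat_numeral)

lemma sum_Sym_1:
  fixes F :: "nat \<Rightarrow> real"
  assumes "i \<in> {1..n}"
  shows "(\<Sum>\<pi>\<in>Sym n. F (\<pi> i)) = fact (n - 1) * (\<Sum>j\<in>{1..n}. F j)"
proof -
  have "(\<Sum>\<pi>\<in>Sym n. F (\<pi> i)) = (\<Sum>j\<in>{1..n}. \<Sum>\<pi>\<in>{\<pi> \<in> Sym n. \<pi> i = j}. F (\<pi> i))"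
    using assms Sym_in by (intro sum.group[symmetric]) auto
  also have "\<dots> = (\<Sum>j\<in>{1..n}. fact (n - 1) * F j)"
    using card_Sym_1[OF assms] by (intro sum.cong) auto
  finally show ?thesis by (simp add: sum_distrib_left)
qed

lemma sum_Sym_2:
  fixes F :: "nat \<Rightarrow> nat \<Rightarrow> real"
  assumes "i \<in> {1..n}" "k \<in> {1..n}" "i \<noteq> k"
  shows "(\<Sum>\<pi>\<in>Sym n. F (\<pi> i) (\<pi> k)) = fact (n - 2) * (\<Sum>j\<in>{1..n}. \<Sum>l\<in>{1..n} - {j}. F j l)"
proof -
  have "(\<Sum>\<pi>\<in>Sym n. F (\<pi> i) (\<pi> k)) =
      (\<Sum>jl\<in>(SIGMA j:{1..n}. {1..n} - {j}). \<Sum>\<pi>\<in>{\<pi> \<in> Sym n. (\<pi> i, \<pi> k) = jl}. F (\<pi> i) (\<pi> k))"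
    using assms Sym_in Sym_inj by (intro sum.group[symmetric]) auto
  also have "\<dots> = (\<Sum>jl\<in>(SIGMA j:{1..n}. {1..n} - {j}). fact (n - 2) * F (fst jl) (snd jl))"
  proof (intro sum.cong refl)
    fix jl assume "jl \<in> (SIGMA j:{1..n}. {1..n} - {j})"
    then obtain j l where jl: "jl = (j, l)" "j \<in> {1..n}" "l \<in> {1..n}" "j \<noteq> l" by blast
    have "(\<Sum>\<pi>\<in>{\<pi> \<in> Sym n. (\<pi> i, \<pi> k) = jl}. F (\<pi> i) (\<pi> k)) =
        (\<Sum>\<pi>\<in>{\<pi> \<in> Sym n. \<pi> i = j \<and> \<pi> k = l}. F j l)"
      unfolding jl by (intro sum.cong) auto
    then show "(\<Sum>\<pi>\<in>{\<pi> \<in> Sym n. (\<pi> i, \<pi> k) = jl}. F (\<pi> i) (\<pi> k)) = fact (n - 2) * F (fst jl) (snd jl)"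
      using card_Sym_2[OF assms jl(2-4)] jl(1) by simp
  qed
  also have "\<dots> = (\<Sum>j\<in>{1..n}. \<Sum>l\<in>{1..n} - {j}. fact (n - 2) * F j l)"
    by (subst sum.Sigma) (auto simp: case_prod_beta)
  finally show ?thesis by (simp add: sum_distrib_left)
qed

lemma expect_1:
  fixes F :: "nat \<Rightarrow> real"
  assumes "i \<in> {1..n}"
  shows "expect n (\<lambda>\<pi>. F (\<pi> i)) = (\<Sum>j\<in>{1..n}. F j) / n"
proof -
  have "n \<ge> 1" using assms by simp
  then have "fact n = n * (fact (n - 1) :: real)" by (simp add: fact_reduce)
  then show ?thesis unfolding expect_eq sum_Sym_1[OF assms] by simp
qed

lemma fact_reduce_2: "n \<ge> 2 \<Longrightarrow> fact n = real n * (real n - 1) * fact (n - 2)"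
  by (cases n; cases "n - 1") (auto simp: of_nat_diff algebra_simps)

lemma expect_2:
  fixes F :: "nat \<Rightarrow> nat \<Rightarrow> real"
  assumes "i \<in> {1..n}" "k \<in> {1..n}" "i \<noteq> k"
  shows "expect n (\<lambda>\<pi>. F (\<pi> i) (\<pi> k)) = (\<Sum>j\<in>{1..n}. \<Sum>l\<in>{1..n} - {j}. F j l) / (real n * (real n - 1))"
proof -
  have n: "n \<ge> 2" using assms by auto
  show ?thesis unfolding expect_eq sum_Sym_2[OF assms] fact_reduce_2[OF n] by simp
qed

section \<open>First and second moments of linear functions\<close>

lemma expect_lin:
  fixes e :: "nat \<Rightarrow> nat \<Rightarrow> real"
  shows "expect n (lin n e) = (\<Sum>i\<in>{1..n}. \<Sum>j\<in>{1..n}. e i j) / n"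
proof -
  have "expect n (lin n e) = (\<Sum>i\<in>{1..n}. expect n (\<lambda>\<pi>. e i (\<pi> i)))"
    unfolding lin_def expect_sum ..
  also have "\<dots> = (\<Sum>i\<in>{1..n}. (\<Sum>j\<in>{1..n}. e i j) / n)"
    by (intro sum.cong refl expect_1)
  finally show ?thesis by (simp add: sum_divide_distrib)
qed

text \<open>Expand the square. The diagonal terms are averages over one value; a term with
  \<open>i \<noteq> k\<close> is an average over pairs of distinct values, and the missing pairs
  \<open>j = l\<close> produce the column sums and one more copy of the sum of squares.\<close>

lemma expect_lin_sq:
  fixes e :: "nat \<Rightarrow> nat \<Rightarrow> real"
  assumes n: "n \<ge> 2"
  shows "expect n (\<lambda>\<pi>. (lin n e \<pi>)\<^sup>2) =
    (\<Sum>i\<in>{1..n}. \<Sum>j\<in>{1..n}. (e i j)\<^sup>2) / (real n - 1)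
    + ((\<Sum>i\<in>{1..n}. \<Sum>j\<in>{1..n}. e i j)\<^sup>2 - (\<Sum>i\<in>{1..n}. (\<Sum>j\<in>{1..n}. e i j)\<^sup>2)
       - (\<Sum>j\<in>{1..n}. (\<Sum>i\<in>{1..n}. e i j)\<^sup>2)) / (real n * (real n - 1))"
proof -
  let ?I = "{1..n}"
  define R where "R i = (\<Sum>j\<in>?I. e i j)" for i
  define Q where "Q = (\<Sum>i\<in>?I. \<Sum>j\<in>?I. (e i j)\<^sup>2)"
  have "expect n (\<lambda>\<pi>. (lin n e \<pi>)\<^sup>2) = (\<Sum>i\<in>?I. \<Sum>k\<in>?I. expect n (\<lambda>\<pi>. e i (\<pi> i) * e k (\<pi> k)))"
    unfolding lin_def power2_eq_square sum_product expect_sum ..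
  also have "\<dots> = (\<Sum>i\<in>?I. (\<Sum>j\<in>?I. (e i j)\<^sup>2) / n + (\<Sum>k\<in>?I - {i}. (R i * R k - (\<Sum>j\<in>?I. e i j * e k j)) / (real n * (real n - 1))))"
  proof (intro sum.cong refl)
    fix i assume i: "i \<in> ?I"
    have "expect n (\<lambda>\<pi>. e i (\<pi> i) * e i (\<pi> i)) = (\<Sum>j\<in>?I. (e i j)\<^sup>2) / n"
      using expect_1[OF i, of "\<lambda>j. e i j * e i j"] by (simp add: power2_eq_square)
    moreover have "expect n (\<lambda>\<pi>. e i (\<pi> i) * e k (\<pi> k)) = (R i * R k - (\<Sum>j\<in>?I. e i j * e k j)) / (real n * (real n - 1))"
      if k: "k \<in> ?I - {i}" for k
    proof -
      have "expect n (\<lambda>\<pi>. e i (\<pi> i) * e k (\<pi> k)) = (\<Sum>j\<in>?I. \<Sum>l\<in>?I - {j}. e i j * e k l) / (real n * (real n - 1))"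
        by (rule expect_2) (use i k in auto)
      also have "(\<Sum>j\<in>?I. \<Sum>l\<in>?I - {j}. e i j * e k l) = (\<Sum>j\<in>?I. (\<Sum>l\<in>?I. e i j * e k l) - e i j * e k j)"
        by (intro sum.cong refl) (simp add: sum_diff1)
      also have "\<dots> = R i * R k - (\<Sum>j\<in>?I. e i j * e k j)"
        by (simp add: sum_subtractf R_def sum_product)
      finally show ?thesis .
    qed
    ultimately show "(\<Sum>k\<in>?I. expect n (\<lambda>\<pi>. e i (\<pi> i) * e k (\<pi> k))) = (\<Sum>j\<in>?I. (e i j)\<^sup>2) / n + (\<Sum>k\<in>?I - {i}. (R i * R k - (\<Sum>j\<in>?I. e i j * e k j)) / (real n * (real n - 1)))"
      using i by (subst sum.remove[of ?I i]) auto
  qed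
  also have "\<dots> = Q / n + (\<Sum>i\<in>?I. (\<Sum>k\<in>?I - {i}. R i * R k - (\<Sum>j\<in>?I. e i j * e k j))) / (real n * (real n - 1))"
    by (simp add: sum.distrib Q_def sum_divide_distrib)
  also have "(\<Sum>i\<in>?I. (\<Sum>k\<in>?I - {i}. R i * R k - (\<Sum>j\<in>?I. e i j * e k j))) =
     (\<Sum>i\<in>?I. (\<Sum>k\<in>?I. R i * R k - (\<Sum>j\<in>?I. e i j * e k j)) - (R i * R i - (\<Sum>j\<in>?I. e i j * e i j)))"
    by (intro sum.cong refl) (simp add: sum_diff1)
  also have "\<dots> = (\<Sum>i\<in>?I. R i)\<^sup>2 - (\<Sum>j\<in>?I. (\<Sum>i\<in>?I. e i j)\<^sup>2) - (\<Sum>i\<in>?I. (R i)\<^sup>2) + Q"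
  proof -
    have "(\<Sum>i\<in>?I. \<Sum>k\<in>?I. \<Sum>j\<in>?I. e i j * e k j) = (\<Sum>i\<in>?I. \<Sum>j\<in>?I. \<Sum>k\<in>?I. e i j * e k j)"
      by (intro sum.cong refl sum.swap)
    also have "\<dots> = (\<Sum>j\<in>?I. \<Sum>i\<in>?I. \<Sum>k\<in>?I. e i j * e k j)"
      by (rule sum.swap)
    also have "\<dots> = (\<Sum>j\<in>?I. (\<Sum>i\<in>?I. e i j)\<^sup>2)"
      by (simp add: power2_eq_square sum_product)
    finally show ?thesis
      by (simp add: sum_subtractf Q_def sum_product power2_eq_square)
  qed
  finally have *: "expect n (\<lambda>\<pi>. (lin n e \<pi>)\<^sup>2) = Q / n + ((\<Sum>i\<in>?I. R i)\<^sup>2 - (\<Sum>j\<in>?I. (\<Sum>i\<in>?I. e i j)\<^sup>2) - (\<Sum>i\<in>?I. (R i)\<^sup>2) + Q) / (real n * (real n - 1))" .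
  have "Q / n + (X + Q) / (real n * (real n - 1)) = Q / (real n - 1) + X / (real n * (real n - 1))" for X
  proof -
    define x where "x = real n - 1"
    have "real n = x + 1" "x > 0" using n by (auto simp: x_def)
    then show ?thesis by (simp add: divide_simps) (simp add: algebra_simps)
  qed
  from this[of "(\<Sum>i\<in>?I. R i)\<^sup>2 - (\<Sum>j\<in>?I. (\<Sum>i\<in>?I. e i j)\<^sup>2) - (\<Sum>i\<in>?I. (R i)\<^sup>2)"] show ?thesis
    unfolding * Q_def R_def by (simp add: algebra_simps)
qed

lemma sum_sq_le_card_sum_sq:
  fixes x :: "nat \<Rightarrow> real"
  shows "(\<Sum>i\<in>{1..n}. x i)\<^sup>2 \<le> n * (\<Sum>i\<in>{1..n}. (x i)\<^sup>2)"
  using sum_squared_le_sum_of_squares[of x "{1..n}"] by (simp add: mult.commute)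

text \<open>By Cauchy-Schwarz, \<open>R\<close> and \<open>C\<close> are each at least
  \<open>T\<^sup>2 / n\<close>, so the part of the second moment that comes from line sums is at
  most the squared mean. The factor 2 compares \<open>n - 1\<close> with \<open>n\<close>.\<close>

lemma variance_lin_le:
  fixes e :: "nat \<Rightarrow> nat \<Rightarrow> real"
  assumes n: "n \<ge> 2"
  shows "expect n (\<lambda>\<pi>. (lin n e \<pi> - expect n (lin n e))\<^sup>2) \<le> 2 * (\<Sum>i\<in>{1..n}. \<Sum>j\<in>{1..n}. (e i j)\<^sup>2) / n"
proof -
  let ?I = "{1..n}"
  define T where "T = (\<Sum>i\<in>?I. \<Sum>j\<in>?I. e i j)"
  define R where "R = (\<Sum>i\<in>?I. (\<Sum>j\<in>?I. e i j)\<^sup>2)"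
  define C where "C = (\<Sum>j\<in>?I. (\<Sum>i\<in>?I. e i j)\<^sup>2)"
  define Q where "Q = (\<Sum>i\<in>?I. \<Sum>j\<in>?I. (e i j)\<^sup>2)"
  have Q0: "Q \<ge> 0" unfolding Q_def by (intro sum_nonneg) auto
  have TR: "T\<^sup>2 \<le> n * R" unfolding T_def R_def by (rule sum_sq_le_card_sum_sq)
  have T': "T = (\<Sum>j\<in>?I. \<Sum>i\<in>?I. e i j)" unfolding T_def by (rule sum.swap)
  have TC: "T\<^sup>2 \<le> n * C" unfolding T' C_def by (rule sum_sq_le_card_sum_sq)
  have mean: "expect n (lin n e) = T / n" unfolding expect_lin T_def ..
  have "expect n (\<lambda>\<pi>. (lin n e \<pi> - T / n)\<^sup>2) =
      expect n (\<lambda>\<pi>. (lin n e \<pi>)\<^sup>2 + ((- 2 * (T / n)) * lin n e \<pi> + (T / n)\<^sup>2))"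
    by (rule expect_cong) (simp add: power2_diff)
  also have "\<dots> = expect n (\<lambda>\<pi>. (lin n e \<pi>)\<^sup>2) - (T / n)\<^sup>2"
    unfolding expect_add expect_cmult mean by (simp add: power2_eq_square)
  also have "expect n (\<lambda>\<pi>. (lin n e \<pi>)\<^sup>2) = Q / (real n - 1) + (T\<^sup>2 - R - C) / (real n * (real n - 1))"
    unfolding expect_lin_sq[OF n] T_def R_def C_def Q_def ..
  also have "\<dots> - (T / n)\<^sup>2 \<le> Q / (real n - 1)"
  proof -
    have "T\<^sup>2 - R - C \<le> T\<^sup>2 * (real n - 1) / n"
    proof -
      have "n * (T\<^sup>2 - R - C) \<le> n * T\<^sup>2 - T\<^sup>2 - T\<^sup>2" using TR TC by (simp add: algebra_simps)
      also have "\<dots> \<le> T\<^sup>2 * (real n - 1)" by (simp add: algebra_simps)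
      finally show ?thesis using n by (simp add: field_simps)
    qed
    then have "(T\<^sup>2 - R - C) / (real n * (real n - 1)) \<le> T\<^sup>2 * (real n - 1) / n / (real n * (real n - 1))"
      using n by (intro divide_right_mono) auto
    also have "\<dots> = (T / n)\<^sup>2" using n by (simp add: power2_eq_square)
    finally show ?thesis by simp
  qed
  also have "\<dots> \<le> 2 * Q / n"
    using n Q0 mult_right_mono[of 2 "real n" Q] by (simp add: field_simps)
  finally show ?thesis unfolding mean Q_def .
qed

lemma expect_lin_sq_le:
  fixes e :: "nat \<Rightarrow> nat \<Rightarrow> real"
  assumes n: "n \<ge> 2"
  shows "expect n (\<lambda>\<pi>. (lin n e \<pi>)\<^sup>2) \<le> 2 * (\<Sum>i\<in>{1..n}. \<Sum>j\<in>{1..n}. (e i j)\<^sup>2) / n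
     + ((\<Sum>i\<in>{1..n}. \<Sum>j\<in>{1..n}. e i j) / n)\<^sup>2"
proof -
  let ?m = "expect n (lin n e)"
  have "expect n (\<lambda>\<pi>. (lin n e \<pi>)\<^sup>2) = expect n (\<lambda>\<pi>. (lin n e \<pi> - ?m)\<^sup>2 + (2 * ?m * lin n e \<pi> + - (?m\<^sup>2)))"
    by (rule expect_cong) (simp add: power2_diff)
  also have "\<dots> = expect n (\<lambda>\<pi>. (lin n e \<pi> - ?m)\<^sup>2) + ?m\<^sup>2"
    unfolding expect_add expect_cmult by (simp add: power2_eq_square)
  finally show ?thesis using variance_lin_le[OF n, of e] by (simp add: expect_lin)
qed

subsection \<open>Affine functions on the cube\<close>

definition dist3 :: "real \<Rightarrow> real" where
  "dist3 y = min \<bar>y\<bar> (min \<bar>y - 1\<bar> \<bar>y + 1\<bar>)"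

lemma dist01_sq_le_add: "(dist01 (x + y))\<^sup>2 \<le> 2 * (dist01 x)\<^sup>2 + 2 * y\<^sup>2"
proof -
  have "dist01 (x + y) \<le> dist01 x + \<bar>y\<bar>" "0 \<le> dist01 (x + y)" unfolding dist01_def by auto
  then have "(dist01 (x + y))\<^sup>2 \<le> (dist01 x + \<bar>y\<bar>)\<^sup>2" by (intro power_mono)
  also have "\<dots> \<le> 2 * (dist01 x)\<^sup>2 + 2 * \<bar>y\<bar>\<^sup>2" using zero_le_power2[of "dist01 x - \<bar>y\<bar>"]
    by (simp only: power2_sum power2_diff)
  finally show ?thesis by simp
qed

text \<open>Let \<open>w\<close> be positive, the minimum of the two absolute values, and let all
  four corners lie closer than \<open>w\<close> to 0 or 1. The ends of a side are at least
  \<open>2 * w\<close> apart, so the larger end must be near 1 and the smaller near 0. A corner that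
  is the larger end of one side and the smaller end of the other gives a contradiction.\<close>

lemma dist01_square:
  fixes \<mu> u v :: real
  shows "min (u\<^sup>2) (v\<^sup>2) \<le> (dist01 (\<mu> + u + v))\<^sup>2 + (dist01 (\<mu> + u - v))\<^sup>2
     + (dist01 (\<mu> - u + v))\<^sup>2 + (dist01 (\<mu> - u - v))\<^sup>2"
proof -
  define w where "w = min \<bar>u\<bar> \<bar>v\<bar>"
  have "w \<le> dist01 (\<mu> + u + v) \<or> w \<le> dist01 (\<mu> + u - v) \<or> w \<le> dist01 (\<mu> - u + v) \<or> w \<le> dist01 (\<mu> - u - v)"
    unfolding w_def dist01_def by (smt (verit))
  moreover have "0 \<le> w" unfolding w_def by simp
  moreover have "min (u\<^sup>2) (v\<^sup>2) = w\<^sup>2"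
    unfolding w_def by (auto simp: min_def abs_le_square_iff)
  ultimately show ?thesis
    using power_mono[of w _ 2] zero_le_power2 by (smt (verit))
qed

text \<open>\<open>rad a M T\<close> is the Rademacher sum \<open>\<Sum>i\<in>M. \<plusminus> a i\<close> whose positive signs are at \<open>T\<close>.\<close>

definition rad :: "('a \<Rightarrow> real) \<Rightarrow> 'a set \<Rightarrow> 'a set \<Rightarrow> real" where
  "rad a M T = (\<Sum>i\<in>M. if i \<in> T then a i else - a i)"

lemma sum_Pow_insert:
  fixes F :: "'a set \<Rightarrow> real"
  assumes "finite M" "x \<notin> M"
  shows "(\<Sum>T\<in>Pow (insert x M). F T) = (\<Sum>T\<in>Pow M. F T + F (insert x T))"
proof -
  have "inj_on (insert x) (Pow M)" using assms(2) by (auto simp: inj_on_def)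
  then have "(\<Sum>T\<in>insert x ` Pow M. F T) = (\<Sum>T\<in>Pow M. F (insert x T))"
    by (simp add: sum.reindex)
  moreover have "(\<Sum>T\<in>Pow (insert x M). F T) = (\<Sum>T\<in>Pow M. F T) + (\<Sum>T\<in>insert x ` Pow M. F T)"
    unfolding Pow_insert using assms by (intro sum.union_disjoint) auto
  ultimately show ?thesis by (simp add: sum.distrib)
qed

lemma rad_insert:
  assumes "finite M" "x \<notin> M" "T \<subseteq> M"
  shows "rad a (insert x M) T = rad a M T - a x" "rad a (insert x M) (insert x T) = rad a M T + a x"
proof -
  have "x \<notin> T" using assms by auto
  then show "rad a (insert x M) T = rad a M T - a x" using assms by (simp add: rad_def)
  have "(\<Sum>i\<in>M. if i = x \<or> i \<in> T then a i else - a i) = (\<Sum>i\<in>M. if i \<in> T then a i else - a i)"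
    using assms by (intro sum.cong) auto
  then show "rad a (insert x M) (insert x T) = rad a M T + a x" using assms by (simp add: rad_def)
qed

lemma sum_rad_sq:
  assumes "finite M"
  shows "(\<Sum>T\<in>Pow M. (rad a M T)\<^sup>2) = 2 ^ card M * (\<Sum>i\<in>M. (a i)\<^sup>2)"
  using assms
proof (induction M)
  case empty
  then show ?case by (simp add: rad_def)
next
  case (insert x M)
  have "(\<Sum>T\<in>Pow (insert x M). (rad a (insert x M) T)\<^sup>2) = (\<Sum>T\<in>Pow M. 2 * (rad a M T)\<^sup>2 + 2 * (a x)\<^sup>2)"
    unfolding sum_Pow_insert[OF insert(1,2)]
    by (intro sum.cong refl) (use insert in \<open>simp add: rad_insert power2_sum power2_diff\<close>)
  then show ?case using insert by (simp add: sum.distrib sum_distrib_left[symmetric] card_Pow algebra_simps)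
qed

text \<open>The Khintchine inequality for the fourth moment. In the induction step, raising the
  coefficient of \<open>a x ^ 4\<close> from 2 to 6 completes the square.\<close>

lemma sum_rad_pow4_le:
  assumes "finite M"
  shows "(\<Sum>T\<in>Pow M. (rad a M T) ^ 4) \<le> 3 * 2 ^ card M * (\<Sum>i\<in>M. (a i)\<^sup>2)\<^sup>2"
  using assms
proof (induction M)
  case empty
  then show ?case by (simp add: rad_def)
next
  case (insert x M)
  let ?S = "\<Sum>i\<in>M. (a i)\<^sup>2"
  have id: "(r - y) ^ 4 + (r + y) ^ 4 = 2 * r ^ 4 + 12 * y\<^sup>2 * r\<^sup>2 + 2 * y ^ 4" for r y :: real
    by (simp add: power4_eq_xxxx power2_eq_square algebra_simps)
  have "(\<Sum>T\<in>Pow (insert x M). (rad a (insert x M) T) ^ 4)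
      = (\<Sum>T\<in>Pow M. 2 * (rad a M T) ^ 4 + 12 * (a x)\<^sup>2 * (rad a M T)\<^sup>2 + 2 * (a x) ^ 4)"
    unfolding sum_Pow_insert[OF insert(1,2)]
    by (intro sum.cong refl) (use insert id in \<open>simp add: rad_insert\<close>)
  also have "\<dots> = 2 * (\<Sum>T\<in>Pow M. (rad a M T) ^ 4) + 12 * (a x)\<^sup>2 * (2 ^ card M * ?S) + 2 ^ card M * (2 * (a x) ^ 4)"
    using insert(1) by (simp add: sum.distrib sum_distrib_left[symmetric] card_Pow sum_rad_sq)
  also have "\<dots> \<le> 2 * (3 * 2 ^ card M * ?S\<^sup>2) + 12 * (a x)\<^sup>2 * (2 ^ card M * ?S) + 2 ^ card M * (6 * (a x) ^ 4)"
    using insert by (intro add_mono mult_left_mono) auto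
  also have "\<dots> = 3 * 2 ^ Suc (card M) * (?S + (a x)\<^sup>2)\<^sup>2"
    by (simp add: power4_eq_xxxx power2_eq_square algebra_simps)
  finally show ?case using insert by (simp add: add.commute)
qed

text \<open>Anticoncentration without a case distinction: \<open>x\<^sup>2 - x ^ 4 / (4 * \<sigma>)\<close> is a lower bound of
  \<open>min (x\<^sup>2) \<sigma>\<close> with mean at least \<open>\<sigma> / 4\<close>.\<close>

lemma sum_min_rad_ge:
  assumes "finite M" "0 \<le> s" "s \<le> (\<Sum>i\<in>M. (a i)\<^sup>2)"
  shows "2 ^ card M * s / 4 \<le> (\<Sum>T\<in>Pow M. min ((rad a M T)\<^sup>2) s)"
proof (cases "s = 0")
  case False
  define \<sigma> where "\<sigma> = (\<Sum>i\<in>M. (a i)\<^sup>2)"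
  have pos: "0 < s" "s \<le> \<sigma>" "0 < \<sigma>" using assms False unfolding \<sigma>_def by auto
  \<comment> \<open>The factor \<open>s / \<sigma>\<close>, which is at most 1, turns the bound by
    \<open>\<sigma>\<close> into a bound by \<open>s\<close>.\<close>
  have pt: "s / \<sigma> * (x\<^sup>2 - x ^ 4 / (4 * \<sigma>)) \<le> min (x\<^sup>2) s" for x :: real
  proof -
    have "x\<^sup>2 - x ^ 4 / (4 * \<sigma>) \<le> \<sigma>"
    proof -
      have "0 \<le> (x\<^sup>2 - 2 * \<sigma>)\<^sup>2" by simp
      then have "4 * \<sigma> * x\<^sup>2 - x ^ 4 \<le> 4 * \<sigma>\<^sup>2" by (simp add: power2_diff algebra_simps)
      then show ?thesis using pos by (simp add: field_simps power2_eq_square)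
    qed
    then have 1: "s / \<sigma> * (x\<^sup>2 - x ^ 4 / (4 * \<sigma>)) \<le> s / \<sigma> * \<sigma>"
      using pos by (intro mult_left_mono) auto
    have "s / \<sigma> * (x\<^sup>2 - x ^ 4 / (4 * \<sigma>)) \<le> s / \<sigma> * x\<^sup>2"
      using pos by (intro mult_left_mono) auto
    also have "\<dots> \<le> 1 * x\<^sup>2" using pos by (intro mult_right_mono) auto
    finally show ?thesis using 1 pos by simp
  qed
  have "2 ^ card M * s / 4 = s / \<sigma> * (2 ^ card M * \<sigma> - 3 * 2 ^ card M * \<sigma>\<^sup>2 / (4 * \<sigma>))"
    using pos by (simp add: field_simps power2_eq_square)
  also have "\<dots> \<le> s / \<sigma> * ((\<Sum>T\<in>Pow M. (rad a M T)\<^sup>2) - (\<Sum>T\<in>Pow M. (rad a M T) ^ 4) / (4 * \<sigma>))"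
    using sum_rad_pow4_le[OF assms(1), of a] sum_rad_sq[OF assms(1), of a] pos unfolding \<sigma>_def[symmetric]
    by (intro mult_left_mono diff_mono divide_right_mono) auto
  also have "\<dots> = (\<Sum>T\<in>Pow M. s / \<sigma> * ((rad a M T)\<^sup>2 - (rad a M T) ^ 4 / (4 * \<sigma>)))"
    by (simp only: sum_distrib_left[symmetric] sum_subtractf sum_divide_distrib)
  also have "\<dots> \<le> (\<Sum>T\<in>Pow M. min ((rad a M T)\<^sup>2) s)"
    by (intro sum_mono pt)
  finally show ?thesis .
qed simp

lemma sum_Pow_Un:
  fixes F :: "'a set \<Rightarrow> real"
  assumes "finite M" "finite N" "M \<inter> N = {}"
  shows "(\<Sum>T\<in>Pow (M \<union> N). F T) = (\<Sum>T\<in>Pow M. \<Sum>U\<in>Pow N. F (T \<union> U))"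
  using assms(2,3)
proof (induction N arbitrary: F)
  case (insert x N)
  have "(\<Sum>T\<in>Pow (M \<union> insert x N). F T) = (\<Sum>T\<in>Pow (M \<union> N). F T + F (insert x T))"
    using insert assms(1) sum_Pow_insert[of "M \<union> N" x F] by simp
  also have "\<dots> = (\<Sum>T\<in>Pow M. \<Sum>U\<in>Pow N. F (T \<union> U) + F (insert x (T \<union> U)))"
    using insert by (subst insert.IH) auto
  also have "\<dots> = (\<Sum>T\<in>Pow M. \<Sum>U\<in>Pow (insert x N). F (T \<union> U))"
    using insert sum_Pow_insert[OF insert(1,2)] by simp
  finally show ?case .
qed simp

lemma rad_Un:
  assumes "finite M" "finite N" "M \<inter> N = {}" "T \<subseteq> M" "U \<subseteq> N"
  shows "rad a (M \<union> N) (T \<union> U) = rad a M T + rad a N U"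
proof -
  have "rad a (M \<union> N) (T \<union> U) = rad a M (T \<union> U) + rad a N (T \<union> U)"
    unfolding rad_def using assms by (intro sum.union_disjoint) auto
  moreover have "rad a M (T \<union> U) = rad a M T" "rad a N (T \<union> U) = rad a N U"
    unfolding rad_def using assms by (auto intro!: sum.cong)
  ultimately show ?thesis by simp
qed

lemma rad_Diff:
  assumes "finite M"
  shows "rad a M (M - T) = - rad a M T"
  unfolding rad_def sum_negf[symmetric] by (intro sum.cong) auto

lemma sum_Pow_Diff: "(\<Sum>T\<in>Pow M. F (M - T)) = (\<Sum>T\<in>Pow M. (F T :: real))"
  by (rule sum.reindex_bij_witness[where i = "\<lambda>T. M - T" and j = "\<lambda>T. M - T"]) auto

text \<open>The signs on \<open>M\<close> and on \<open>N\<close> can be reversed independently, so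
  the sum equals each of its four sign variants. This produces the four corners that
  \<open>dist01_square\<close> compares.\<close>

lemma sum_rad_split:
  fixes F :: "real \<Rightarrow> real"
  assumes "finite M" "finite N" "M \<inter> N = {}"
  shows "4 * (\<Sum>T\<in>Pow (M \<union> N). F (rad a (M \<union> N) T)) =
    (\<Sum>T\<in>Pow M. \<Sum>U\<in>Pow N. F (rad a M T + rad a N U) + F (rad a M T - rad a N U)
       + F (- rad a M T + rad a N U) + F (- rad a M T - rad a N U))"
proof -
  define G where "G u v = F (u + v)" for u v
  have 0: "(\<Sum>T\<in>Pow (M \<union> N). F (rad a (M \<union> N) T)) = (\<Sum>T\<in>Pow M. \<Sum>U\<in>Pow N. G (rad a M T) (rad a N U))" (is "?L = _")
    unfolding sum_Pow_Un[OF assms] G_def using rad_Un[OF assms] by (intro sum.cong refl) auto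
  have N: "(\<Sum>U\<in>Pow N. G u (- rad a N U)) = (\<Sum>U\<in>Pow N. G u (rad a N U))" for u
    using sum_Pow_Diff[of "\<lambda>U. G u (rad a N U)" N] rad_Diff[OF assms(2)] by simp
  have M: "(\<Sum>T\<in>Pow M. H (- rad a M T)) = (\<Sum>T\<in>Pow M. (H (rad a M T) :: real))" for H
    using sum_Pow_Diff[of "\<lambda>T. H (rad a M T)" M] rad_Diff[OF assms(1)] by simp
  have 1: "?L = (\<Sum>T\<in>Pow M. \<Sum>U\<in>Pow N. G (rad a M T) (- rad a N U))" unfolding 0 N ..
  have 2: "?L = (\<Sum>T\<in>Pow M. \<Sum>U\<in>Pow N. G (- rad a M T) (rad a N U))"
    unfolding 0 using M[of "\<lambda>u. \<Sum>U\<in>Pow N. G u (rad a N U)"] by simp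
  have 3: "?L = (\<Sum>T\<in>Pow M. \<Sum>U\<in>Pow N. G (- rad a M T) (- rad a N U))"
    unfolding 1 using M[of "\<lambda>u. \<Sum>U\<in>Pow N. G u (- rad a N U)"] by simp
  have "4 * ?L = ?L + ?L + ?L + ?L" by simp
  also have "\<dots> = (\<Sum>T\<in>Pow M. \<Sum>U\<in>Pow N. G (rad a M T) (rad a N U)) + (\<Sum>T\<in>Pow M. \<Sum>U\<in>Pow N. G (rad a M T) (- rad a N U))
     + (\<Sum>T\<in>Pow M. \<Sum>U\<in>Pow N. G (- rad a M T) (rad a N U)) + (\<Sum>T\<in>Pow M. \<Sum>U\<in>Pow N. G (- rad a M T) (- rad a N U))"
    using 0 1 2 3 by linarith
  finally show ?thesis by (simp add: G_def sum.distrib)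
qed

text \<open>A function that is affine on a two-dimensional subcube and takes values near \<open>{0, 1}\<close> there
  has a negligible coefficient; applied to the two halves of a split of the coordinates,
  this makes one of the halves negligible.\<close>

lemma cube_split:
  fixes a :: "'a \<Rightarrow> real"
  assumes fin: "finite M" "finite N" and disj: "M \<inter> N = {}"
    and \<delta>: "(\<Sum>T\<in>Pow (M \<union> N). (dist01 (\<mu> + rad a (M \<union> N) T / 2))\<^sup>2) \<le> \<delta> * 2 ^ card (M \<union> N)"
  shows "min (\<Sum>i\<in>M. (a i)\<^sup>2) (\<Sum>i\<in>N. (a i)\<^sup>2) \<le> 256 * \<delta>"
proof -
  define s where "s = min (\<Sum>i\<in>M. (a i)\<^sup>2) (\<Sum>i\<in>N. (a i)\<^sup>2)"
  have s0: "0 \<le> s" unfolding s_def by (simp add: sum_nonneg)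
  show ?thesis
  proof (cases "s = 0")
    case True
    have "0 \<le> \<delta> * 2 ^ card (M \<union> N)" using order_trans[OF _ \<delta>] by (simp add: sum_nonneg)
    then have "0 \<le> \<delta>" using zero_less_power[of "2 :: real" "card (M \<union> N)"] by (smt (verit) mult_neg_pos)
    then show ?thesis using True unfolding s_def by simp
  next
    case False
    then have s: "s > 0" using s0 by simp
    let ?m = "\<lambda>T. min ((rad a M T)\<^sup>2) s" and ?n = "\<lambda>U. min ((rad a N U)\<^sup>2) s"
    \<comment> \<open>Truncating at \<open>s\<close> makes the product of the two truncated squares,
      divided by \<open>s\<close>, a lower bound of the minimum; unlike the minimum, the product
      separates over the two halves.\<close>
    have pt: "?m T * ?n U / s \<le> min ((rad a M T)\<^sup>2) ((rad a N U)\<^sup>2)" for T U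
    proof -
      have "?m T * ?n U \<le> ?m T * s" "?n U * ?m T \<le> ?n U * s"
        using s by (auto intro!: mult_left_mono)
      then have "?m T * ?n U / s \<le> ?m T" "?m T * ?n U / s \<le> ?n U"
        by (simp_all only: pos_divide_le_eq[OF s] mult.commute)
      then show ?thesis by linarith
    qed
    have "2 ^ card (M \<union> N) * (s / 16) = (2 ^ card M * s / 4) * (2 ^ card N * s / 4) / s"
      using s card_Un_disjoint[OF fin disj] by (simp add: field_simps power_add)
    also have "\<dots> \<le> (\<Sum>T\<in>Pow M. ?m T) * (\<Sum>U\<in>Pow N. ?n U) / s"
      using s unfolding s_def by (intro divide_right_mono mult_mono sum_min_rad_ge fin) (auto intro: sum_nonneg)
    also have "\<dots> = (\<Sum>T\<in>Pow M. \<Sum>U\<in>Pow N. ?m T * ?n U / s)"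
      by (simp add: sum_product sum_divide_distrib)
    also have "\<dots> \<le> (\<Sum>T\<in>Pow M. \<Sum>U\<in>Pow N. min ((rad a M T)\<^sup>2) ((rad a N U)\<^sup>2))"
      by (intro sum_mono pt)
    \<comment> \<open>One factor 4 comes from applying \<open>dist01_square\<close> to half of each
      sum, another from counting every sign pattern four times. With the two factors 1/4 of
      anticoncentration this makes 256.\<close>
    also have "\<dots> \<le> (\<Sum>T\<in>Pow M. \<Sum>U\<in>Pow N. 4 * ((dist01 (\<mu> + (rad a M T + rad a N U) / 2))\<^sup>2
       + (dist01 (\<mu> + (rad a M T - rad a N U) / 2))\<^sup>2 + (dist01 (\<mu> + (- rad a M T + rad a N U) / 2))\<^sup>2
       + (dist01 (\<mu> + (- rad a M T - rad a N U) / 2))\<^sup>2))"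
    proof (intro sum_mono)
      fix T U
      let ?u = "rad a M T" and ?v = "rad a N U"
      have "min (?u\<^sup>2) (?v\<^sup>2) = 4 * min ((?u / 2)\<^sup>2) ((?v / 2)\<^sup>2)"
        by (auto simp: min_def field_simps)
      then show "min (?u\<^sup>2) (?v\<^sup>2) \<le> 4 * ((dist01 (\<mu> + (?u + ?v) / 2))\<^sup>2
       + (dist01 (\<mu> + (?u - ?v) / 2))\<^sup>2 + (dist01 (\<mu> + (- ?u + ?v) / 2))\<^sup>2
       + (dist01 (\<mu> + (- ?u - ?v) / 2))\<^sup>2)"
        using dist01_square[of "?u / 2" "?v / 2" \<mu>] by (simp add: add_divide_distrib diff_divide_distrib algebra_simps)
    qed
    also have "\<dots> = 4 * (4 * (\<Sum>T\<in>Pow (M \<union> N). (dist01 (\<mu> + rad a (M \<union> N) T / 2))\<^sup>2))"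
      unfolding sum_rad_split[OF fin disj, of "\<lambda>x. (dist01 (\<mu> + x / 2))\<^sup>2"]
      by (simp add: sum_distrib_left)
    also have "\<dots> \<le> 2 ^ card (M \<union> N) * (16 * \<delta>)" using \<delta> by (simp add: mult.commute)
    finally show ?thesis unfolding s_def by simp
  qed
qed

lemma sum_eq_rad:
  assumes "finite M" "T \<subseteq> M"
  shows "a0 + (\<Sum>i\<in>T. a i) = (a0 + (\<Sum>i\<in>M. a i) / 2) + rad a M T / 2"
proof -
  have "(\<Sum>i\<in>M. if i \<in> T then a i else 0) = (\<Sum>i\<in>T. a i)"
    using assms by (simp add: sum.inter_restrict[symmetric] Int_absorb1)
  moreover have "rad a M T = (\<Sum>i\<in>M. 2 * (if i \<in> T then a i else 0) - a i)"
    unfolding rad_def by (intro sum.cong) auto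
  ultimately show ?thesis by (simp add: sum_subtractf sum_distrib_left[symmetric] field_simps)
qed

lemma dist3_le_abs: "(dist3 y)\<^sup>2 \<le> y\<^sup>2"
  by (subst abs_le_square_iff[symmetric]) (auto simp: dist3_def)

text \<open>Take a maximal set \<open>A\<close> of coordinates with small weight. If a coordinate
  \<open>x\<close> is left, adding it makes the weight large, so by \<open>split\<close> everything
  outside \<open>insert x A\<close> has small weight as well. Only \<open>x\<close> itself can be
  large, and it is close to an integer. Hence 516 = 256 + 256 + 4.\<close>

theorem affine_cube_FKN:
  fixes a :: "'a \<Rightarrow> real"
  assumes fin: "finite M"
  shows "(\<Sum>i\<in>M. (dist3 (a i))\<^sup>2) \<le> 516 * ((\<Sum>T\<in>Pow M. (dist01 (a0 + (\<Sum>i\<in>T. a i)))\<^sup>2) / 2 ^ card M)"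
proof -
  define d where "d T = (dist01 (a0 + (\<Sum>i\<in>T. a i)))\<^sup>2" for T
  define \<mu> where "\<mu> = a0 + (\<Sum>i\<in>M. a i) / 2"
  define \<delta> where "\<delta> = (\<Sum>T\<in>Pow M. d T) / 2 ^ card M"
  define W where "W A = (\<Sum>i\<in>A. (a i)\<^sup>2)" for A
  have \<delta>0: "0 \<le> \<delta>" unfolding \<delta>_def d_def by (simp add: sum_nonneg)
  have split: "min (W A) (W (M - A)) \<le> 256 * \<delta>" if "A \<subseteq> M" for A
  proof -
    have [simp]: "A \<union> M = M" using that by auto
    have "(\<Sum>T\<in>Pow M. (dist01 (\<mu> + rad a M T / 2))\<^sup>2) = (\<Sum>T\<in>Pow M. d T)"
      unfolding d_def \<mu>_def
      by (intro sum.cong refl arg_cong[where f = "\<lambda>x. (dist01 x)\<^sup>2"] sum_eq_rad[OF fin, symmetric]) blast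
    then show ?thesis unfolding W_def
      using fin finite_subset[OF that fin] by (intro cube_split[where \<mu> = \<mu>]) (auto simp: \<delta>_def)
  qed
  \<comment> \<open>Toggling \<open>x\<close> changes the value by \<open>a x\<close>; if both
    values are near \<open>{0, 1}\<close>, their difference is near
    \<open>{- 1, 0, 1}\<close>.\<close>
  have single: "(dist3 (a x))\<^sup>2 \<le> 4 * \<delta>" if x: "x \<in> M" for x
  proof -
    have pt: "(dist3 y)\<^sup>2 \<le> 2 * (dist01 z)\<^sup>2 + 2 * (dist01 (z + y))\<^sup>2" for y z
    proof -
      have "dist3 y \<le> dist01 z + dist01 (z + y)" unfolding dist3_def dist01_def by (smt (verit))
      moreover have "0 \<le> dist3 y" by (auto simp: dist3_def)
      ultimately have "(dist3 y)\<^sup>2 \<le> (dist01 z + dist01 (z + y))\<^sup>2" by (intro power_mono)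
      also have "\<dots> \<le> 2 * (dist01 z)\<^sup>2 + 2 * (dist01 (z + y))\<^sup>2"
        using zero_le_power2[of "dist01 z - dist01 (z + y)"] by (simp only: power2_sum power2_diff)
      finally show ?thesis .
    qed
    define N where "N = M - {x}"
    have N: "M = insert x N" "x \<notin> N" "finite N" using x fin by (auto simp: N_def)
    have "2 ^ card N * (dist3 (a x))\<^sup>2 = (\<Sum>T\<in>Pow N. (dist3 (a x))\<^sup>2)"
      using N by (simp add: card_Pow)
    also have "\<dots> \<le> (\<Sum>T\<in>Pow N. 2 * d T + 2 * d (insert x T))"
    proof (rule sum_mono)
      fix T assume "T \<in> Pow N"
      then have "x \<notin> T" "finite T" using N finite_subset by auto
      then show "(dist3 (a x))\<^sup>2 \<le> 2 * d T + 2 * d (insert x T)"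
        using pt[of "a x" "a0 + (\<Sum>i\<in>T. a i)"] unfolding d_def by (simp add: algebra_simps)
    qed
    also have "\<dots> = 2 * (\<Sum>T\<in>Pow M. d T)"
      unfolding N(1) sum_Pow_insert[OF N(3,2)] by (simp add: sum_distrib_left algebra_simps)
    also have "\<dots> = 2 ^ card N * (4 * \<delta>)" unfolding \<delta>_def using N by simp
    finally show ?thesis by simp
  qed
  define \<A> where "\<A> = {A. A \<subseteq> M \<and> W A \<le> 256 * \<delta>}"
  have fA: "finite \<A>" "{} \<in> \<A>" using fin \<delta>0 by (auto simp: \<A>_def W_def)
  then obtain A where A: "A \<in> \<A>" and max: "\<And>B. B \<in> \<A> \<Longrightarrow> A \<subseteq> B \<Longrightarrow> A = B"
    using finite_has_maximal[of \<A>] by blast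
  have AM: "A \<subseteq> M" "W A \<le> 256 * \<delta>" "finite A" using A fin finite_subset by (auto simp: \<A>_def)
  have dW: "(\<Sum>i\<in>B. (dist3 (a i))\<^sup>2) \<le> W B" for B unfolding W_def by (intro sum_mono dist3_le_abs)
  have "(\<Sum>i\<in>M. (dist3 (a i))\<^sup>2) \<le> 516 * \<delta>"
  proof (cases "A = M")
    case True
    then show ?thesis using dW[of A] AM \<delta>0 by simp
  next
    case False
    then obtain x where x: "x \<in> M" "x \<notin> A" using AM by auto
    let ?B = "M - insert x A"
    have "insert x A \<notin> \<A>" using max[of "insert x A"] x by auto
    then have "W ?B \<le> 256 * \<delta>" using split[of "insert x A"] x AM by (auto simp: \<A>_def)
    moreover have "(\<Sum>i\<in>M. (dist3 (a i))\<^sup>2) = (\<Sum>i\<in>A. (dist3 (a i))\<^sup>2) + (dist3 (a x))\<^sup>2 + (\<Sum>i\<in>?B. (dist3 (a i))\<^sup>2)"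
      using sum.subset_diff[of "insert x A" M "\<lambda>i. (dist3 (a i))\<^sup>2"] x AM fin by simp
    ultimately show ?thesis using dW[of A] dW[of ?B] AM single[OF x(1)] by linarith
  qed
  then show ?thesis unfolding \<delta>_def d_def .
qed

text \<open>Averaging over \<open>T\<close> and its complement removes the cross term with the mean,
  and the square of the mean is dropped. What remains is a quarter of the sum of squares.\<close>

theorem affine_cube_variance:
  fixes a :: "'a \<Rightarrow> real"
  assumes fin: "finite M"
  shows "(\<Sum>i\<in>M. (a i)\<^sup>2) \<le> 4 * ((\<Sum>T\<in>Pow M. (a0 + (\<Sum>i\<in>T. a i) - 1 / 2)\<^sup>2) / 2 ^ card M)"
proof -
  define \<mu> where "\<mu> = a0 + (\<Sum>i\<in>M. a i) / 2 - 1 / 2"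
  have "2 * (\<Sum>T\<in>Pow M. (a0 + (\<Sum>i\<in>T. a i) - 1 / 2)\<^sup>2) = 2 * (\<Sum>T\<in>Pow M. (\<mu> + rad a M T / 2)\<^sup>2)"
  proof -
    have "a0 + (\<Sum>i\<in>T. a i) - 1 / 2 = \<mu> + rad a M T / 2" if "T \<in> Pow M" for T
      using sum_eq_rad[OF fin, of T a0 a] that unfolding \<mu>_def by simp
    then show ?thesis by simp
  qed
  also have "\<dots> = (\<Sum>T\<in>Pow M. (\<mu> + rad a M T / 2)\<^sup>2) + (\<Sum>T\<in>Pow M. (\<mu> - rad a M T / 2)\<^sup>2)"
    using sum_Pow_Diff[of "\<lambda>T. (\<mu> + rad a M T / 2)\<^sup>2" M] rad_Diff[OF fin, of a] by simp
  also have "\<dots> = (\<Sum>T\<in>Pow M. 2 * \<mu>\<^sup>2 + (rad a M T)\<^sup>2 / 2)"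
    unfolding sum.distrib[symmetric] by (intro sum.cong refl) (simp add: power2_sum power2_diff power_divide)
  also have "\<dots> \<ge> (\<Sum>T\<in>Pow M. (rad a M T)\<^sup>2 / 2)" by (intro sum_mono) simp
  also have "(\<Sum>T\<in>Pow M. (rad a M T)\<^sup>2 / 2) = 2 ^ card M * (\<Sum>i\<in>M. (a i)\<^sup>2) / 2"
    using sum_rad_sq[OF fin, of a] by (simp add: sum_divide_distrib[symmetric])
  finally show ?thesis by (simp add: field_simps)
qed

subsection \<open>Matchings of positions\<close>

text \<open>Invariant under adding row or column functions to \<open>c\<close>, and up to sign the
  change of \<open>lin n c\<close> when the values at \<open>i\<close> and \<open>k\<close> are
  exchanged.\<close>

definition dd :: "(nat \<Rightarrow> nat \<Rightarrow> 'a::ab_group_add) \<Rightarrow> nat \<Rightarrow> nat \<Rightarrow> nat \<Rightarrow> nat \<Rightarrow> 'a" where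
  "dd c i k j l = c i j + c k l - c i l - c k j"

text \<open>For an involution \<open>p\<close>, the product of the transpositions of
  \<open>i\<close> and \<open>p i\<close> over \<open>i \<in> T\<close>; \<open>T\<close> contains
  one end of each pair.\<close>

definition twist :: "(nat \<Rightarrow> nat) \<Rightarrow> nat set \<Rightarrow> nat \<Rightarrow> nat" where
  "twist p T i = (if i \<in> T \<union> p ` T then p i else i)"

lemma twist_in_Sym:
  assumes p: "\<And>i. i \<in> {1..n} \<Longrightarrow> p i \<in> {1..n}" "\<And>i. i \<in> {1..n} \<Longrightarrow> p (p i) = i" and T: "T \<subseteq> {1..n}"
  shows "twist p T \<in> Sym n"
proof -
  have inv: "twist p T (twist p T i) = i" for i
    using p T unfolding twist_def by (auto simp: subset_iff image_iff)
  have "bij (twist p T)" by (rule o_bij[of "twist p T"]) (auto simp: fun_eq_iff inv)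
  moreover have "twist p T i = i" if "i \<notin> {1..n}" for i
    using p T that unfolding twist_def by auto
  ultimately show ?thesis by (simp add: Sym_def permutes_def bij_iff)
qed

text \<open>Since \<open>T\<close> contains only smaller ends, the transpositions are disjoint and
  their effects add up. This is what makes the function affine on the cube of subsets
  \<open>T\<close>.\<close>

lemma lin_twist:
  fixes c :: "nat \<Rightarrow> nat \<Rightarrow> real"
  assumes p: "\<And>i. i \<in> {1..n} \<Longrightarrow> p i \<in> {1..n}" "\<And>i. i \<in> {1..n} \<Longrightarrow> p (p i) = i"
    and T: "T \<subseteq> {i\<in>{1..n}. i < p i}"
  shows "lin n c (\<pi> \<circ> twist p T) = lin n c \<pi> + (\<Sum>i\<in>T. - dd c i (p i) (\<pi> i) (\<pi> (p i)))"
proof -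
  let ?I = "{1..n}" and ?g = "\<lambda>i. c i (\<pi> (p i)) - c i (\<pi> i)"
  have fT: "finite T" using T finite_subset by fastforce
  have UI: "T \<union> p ` T \<subseteq> ?I" using T p(1) by blast
  have disj: "T \<inter> p ` T = {}"
  proof (rule ccontr)
    assume "T \<inter> p ` T \<noteq> {}"
    then obtain t t' where t: "t \<in> T" "t' \<in> T" "t = p t'" by auto
    then have "t < p t" "t' < p t'" "p t = t'" using T p(2) by auto
    then show False using t by simp
  qed
  have inj: "inj_on p T" using T p(2) by (metis (mono_tags, lifting) inj_on_def mem_Collect_eq subset_iff)
  have "lin n c (\<pi> \<circ> twist p T) - lin n c \<pi> = (\<Sum>i\<in>?I. c i (\<pi> (twist p T i)) - c i (\<pi> i))"
    by (simp add: lin_def sum_subtractf)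
  also have "\<dots> = (\<Sum>i\<in>T \<union> p ` T. c i (\<pi> (twist p T i)) - c i (\<pi> i))"
    using UI by (intro sum.mono_neutral_right) (auto simp: twist_def)
  also have "\<dots> = (\<Sum>i\<in>T \<union> p ` T. ?g i)"
    by (intro sum.cong) (auto simp: twist_def)
  also have "\<dots> = (\<Sum>i\<in>T. ?g i) + (\<Sum>i\<in>T. ?g (p i))"
    using fT disj inj by (simp add: sum.union_disjoint sum.reindex)
  also have "\<dots> = (\<Sum>i\<in>T. ?g i + ?g (p i))" by (simp add: sum.distrib)
  also have "\<dots> = (\<Sum>i\<in>T. - dd c i (p i) (\<pi> i) (\<pi> (p i)))"
    using T p(2) by (intro sum.cong) (auto simp: dd_def)
  finally show ?thesis by simp
qed

text \<open>Composition with a fixed \<open>twist p T\<close> preserves the uniform distribution, so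
  the cube inequality at each \<pi> may be averaged. The functions \<open>\<phi>\<close> and
  \<open>\<psi>\<close> are left open because both cube theorems are applied; evenness absorbs the
  sign of the double differences.\<close>

lemma matching_bound:
  fixes c :: "nat \<Rightarrow> nat \<Rightarrow> real"
  assumes p: "\<And>i. i \<in> {1..n} \<Longrightarrow> p i \<in> {1..n}" "\<And>i. i \<in> {1..n} \<Longrightarrow> p (p i) = i"
    and cube: "\<And>(M :: nat set) a a0. finite M \<Longrightarrow> (\<Sum>i\<in>M. \<phi> (a i)) \<le> (\<Sum>T\<in>Pow M. \<psi> (a0 + (\<Sum>i\<in>T. a i))) / 2 ^ card M"
    and even: "\<And>x :: real. \<phi> (- x) = (\<phi> x :: real)"
  shows "(\<Sum>i\<in>{i\<in>{1..n}. i < p i}. expect n (\<lambda>\<pi>. \<phi> (dd c i (p i) (\<pi> i) (\<pi> (p i))))) \<le> expect n (\<lambda>\<pi>. \<psi> (lin n c \<pi>))"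
proof -
  define M where "M = {i\<in>{1..n}. i < p i}"
  have fM: "finite M" by (simp add: M_def)
  have "(\<Sum>i\<in>M. expect n (\<lambda>\<pi>. \<phi> (dd c i (p i) (\<pi> i) (\<pi> (p i)))))
      = expect n (\<lambda>\<pi>. \<Sum>i\<in>M. \<phi> (dd c i (p i) (\<pi> i) (\<pi> (p i))))" by (rule expect_sum[symmetric])
  also have "\<dots> \<le> expect n (\<lambda>\<pi>. (\<Sum>T\<in>Pow M. (1 / 2 ^ card M) * \<psi> (lin n c (\<pi> \<circ> twist p T))))"
  proof (rule expect_mono)
    fix \<pi>
    let ?a = "\<lambda>i. - dd c i (p i) (\<pi> i) (\<pi> (p i))"
    have "(\<Sum>i\<in>M. \<phi> (dd c i (p i) (\<pi> i) (\<pi> (p i)))) = (\<Sum>i\<in>M. \<phi> (?a i))"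
      using even by simp
    also have "\<dots> \<le> (\<Sum>T\<in>Pow M. \<psi> (lin n c \<pi> + (\<Sum>i\<in>T. ?a i))) / 2 ^ card M"
      by (rule cube[OF fM])
    also have "(\<Sum>T\<in>Pow M. \<psi> (lin n c \<pi> + (\<Sum>i\<in>T. ?a i))) = (\<Sum>T\<in>Pow M. \<psi> (lin n c (\<pi> \<circ> twist p T)))"
      by (intro sum.cong refl arg_cong[where f = \<psi>] lin_twist[symmetric]) (use p in \<open>auto simp: M_def\<close>)
    finally show "(\<Sum>i\<in>M. \<phi> (dd c i (p i) (\<pi> i) (\<pi> (p i)))) \<le> (\<Sum>T\<in>Pow M. (1 / 2 ^ card M) * \<psi> (lin n c (\<pi> \<circ> twist p T)))"
      by (simp add: sum_divide_distrib)
  qed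
  also have "\<dots> = (\<Sum>T\<in>Pow M. (1 / 2 ^ card M) * expect n (\<lambda>\<pi>. \<psi> (lin n c (\<pi> \<circ> twist p T))))"
    unfolding expect_sum expect_cmult ..
  also have "\<dots> = (\<Sum>T\<in>Pow M. (1 / 2 ^ card M) * expect n (\<lambda>\<pi>. \<psi> (lin n c \<pi>)))"
  proof (intro sum.cong refl arg_cong[where f = "(*) _"])
    fix T assume "T \<in> Pow M"
    then have "twist p T \<in> Sym n" using p by (intro twist_in_Sym) (auto simp: M_def)
    then show "expect n (\<lambda>\<pi>. \<psi> (lin n c (\<pi> \<circ> twist p T))) = expect n (\<lambda>\<pi>. \<psi> (lin n c \<pi>))"
      unfolding expect_eq using sum_Sym_compose_right[of "twist p T" n "\<lambda>\<pi>. \<psi> (lin n c \<pi>)"] by simp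
  qed
  also have "\<dots> = expect n (\<lambda>\<pi>. \<psi> (lin n c \<pi>))" using fM by (simp add: card_Pow)
  finally show ?thesis unfolding M_def .
qed

text \<open>The \<open>n\<close> reflections \<open>i \<mapsto> s - i\<close> modulo \<open>n\<close> split the pairs of positions into matchings
  (the round-robin schedule).\<close>

definition reflect :: "nat \<Rightarrow> nat \<Rightarrow> nat \<Rightarrow> nat" where
  "reflect n s i = Suc ((s + 2 * n - i - 1) mod n)"

lemma reflect_props:
  assumes "i \<in> {1..n}" "s < n"
  shows "reflect n s i \<in> {1..n}" "(i + reflect n s i) mod n = s"
proof -
  show "reflect n s i \<in> {1..n}" using assms by (auto simp: reflect_def Suc_le_eq)
  have "(i + reflect n s i) mod n = (i + 1 + (s + 2 * n - i - 1)) mod n"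
    unfolding reflect_def by (metis Suc_eq_plus1_left add.assoc mod_add_right_eq)
  also have "i + 1 + (s + 2 * n - i - 1) = s + 2 * n" using assms by auto
  finally show "(i + reflect n s i) mod n = s" using assms by simp
qed

lemma reflect_unique:
  assumes "i \<in> {1..n}" "k \<in> {1..n}"
  shows "reflect n ((i + k) mod n) i = k"
proof -
  have n: "0 < n" using assms by auto
  have eq: "(i + k) mod n = (i + k') mod n \<Longrightarrow> k' \<in> {1..n} \<Longrightarrow> k' = k" for k'
  proof -
    assume a: "(i + k) mod n = (i + k') mod n" "k' \<in> {1..n}"
    then obtain q q' where "i + k + n * q = i + k' + n * q'" by (auto simp: nat_mod_eq_iff)
    then have "(k - 1) + n * q = (k' - 1) + n * q'" using a assms by auto
    then have "(k - 1) mod n = (k' - 1) mod n" by (auto simp: nat_mod_eq_iff)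
    then show "k' = k" using a assms by auto
  qed
  show ?thesis using reflect_props[of i n "(i + k) mod n"] n assms by (intro eq) auto
qed

lemma reflect_reflect:
  assumes "i \<in> {1..n}" "s < n"
  shows "reflect n s (reflect n s i) = i"
  using reflect_props[OF assms] reflect_unique[of "reflect n s i" n i] assms by (simp add: add.commute)

lemma sum_reflect:
  fixes G :: "nat \<Rightarrow> nat \<Rightarrow> real"
  shows "(\<Sum>s<n. \<Sum>i\<in>{i\<in>{1..n}. i < reflect n s i}. G i (reflect n s i)) = (\<Sum>(i, k)\<in>{(i, k)\<in>{1..n} \<times> {1..n}. i < k}. G i k)"
proof -
  have "(\<Sum>s<n. \<Sum>i\<in>{i\<in>{1..n}. i < reflect n s i}. G i (reflect n s i))
     = (\<Sum>(s, i)\<in>(SIGMA s:{..<n}. {i\<in>{1..n}. i < reflect n s i}). G i (reflect n s i))"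
    by (subst sum.Sigma) auto
  also have "\<dots> = (\<Sum>(i, k)\<in>{(i, k)\<in>{1..n} \<times> {1..n}. i < k}. G i k)"
    by (rule sum.reindex_bij_witness[where j = "\<lambda>(s, i). (i, reflect n s i)" and i = "\<lambda>(i, k). ((i + k) mod n, i)"])
      (auto simp: reflect_props[unfolded atLeastAtMost_iff] reflect_unique[unfolded atLeastAtMost_iff])
  finally show ?thesis .
qed

text \<open>Every pair of positions lies in exactly one of the \<open>n\<close> matchings, and each
  matching costs at most one expectation. The other two factors \<open>n\<close> undo the average
  over pairs of values, and 2 passes to ordered pairs. Degenerate double differences vanish, hence
  the condition on \<open>\<phi> 0\<close>.\<close>

lemma sum_dd_le:
  fixes c :: "nat \<Rightarrow> nat \<Rightarrow> real"
  assumes n: "n \<ge> 2"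
    and cube: "\<And>(M :: nat set) a a0. finite M \<Longrightarrow> (\<Sum>i\<in>M. \<phi> (a i)) \<le> (\<Sum>T\<in>Pow M. \<psi> (a0 + (\<Sum>i\<in>T. a i))) / 2 ^ card M"
    and even: "\<And>x :: real. \<phi> (- x) = (\<phi> x :: real)" and zero: "\<phi> 0 = 0" and psi: "\<And>x. 0 \<le> \<psi> x"
  shows "(\<Sum>i\<in>{1..n}. \<Sum>k\<in>{1..n}. \<Sum>j\<in>{1..n}. \<Sum>l\<in>{1..n}. \<phi> (dd c i k j l)) \<le> 2 * real n ^ 3 * expect n (\<lambda>\<pi>. \<psi> (lin n c \<pi>))"
proof -
  let ?I = "{1..n}"
  define H where "H i k = (\<Sum>j\<in>?I. \<Sum>l\<in>?I. \<phi> (dd c i k j l))" for i k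
  define P where "P = {(i, k)\<in>?I \<times> ?I. i < k}"
  define E where "E = expect n (\<lambda>\<pi>. \<psi> (lin n c \<pi>))"
  have E0: "0 \<le> E" unfolding E_def by (intro expect_nonneg psi)
  have fP: "finite P" by (rule finite_subset[of _ "?I \<times> ?I"]) (auto simp: P_def)
  have Hsym: "H i k = H k i" for i k
  proof -
    have "dd c k i j l = - dd c i k j l" for j l by (simp add: dd_def)
    then show ?thesis unfolding H_def using even by simp
  qed
  have Hdiag: "H i i = 0" for i unfolding H_def by (simp add: dd_def zero)
  have HE: "H i k = real n * (real n - 1) * expect n (\<lambda>\<pi>. \<phi> (dd c i k (\<pi> i) (\<pi> k)))"
    if "(i, k) \<in> P" for i k
  proof -
    have "expect n (\<lambda>\<pi>. \<phi> (dd c i k (\<pi> i) (\<pi> k))) = (\<Sum>j\<in>?I. \<Sum>l\<in>?I - {j}. \<phi> (dd c i k j l)) / (real n * (real n - 1))"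
      by (rule expect_2[where F = "\<lambda>j l. \<phi> (dd c i k j l)"]) (use that in \<open>auto simp: P_def\<close>)
    also have "(\<Sum>j\<in>?I. \<Sum>l\<in>?I - {j}. \<phi> (dd c i k j l)) = H i k"
      unfolding H_def
    proof (rule sum.cong[OF refl])
      fix j assume "j \<in> ?I"
      have "\<phi> (dd c i k j j) = 0" by (simp add: dd_def zero)
      then show "(\<Sum>l\<in>?I - {j}. \<phi> (dd c i k j l)) = (\<Sum>l\<in>?I. \<phi> (dd c i k j l))"
        by (simp add: sum_diff1)
    qed
    finally show ?thesis using n by simp
  qed
  have "(\<Sum>i\<in>?I. \<Sum>k\<in>?I. H i k) = (\<Sum>(i, k)\<in>?I \<times> ?I. H i k)" by (rule sum.cartesian_product)
  also have "\<dots> = (\<Sum>(i, k)\<in>P \<union> prod.swap ` P. H i k)"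
    by (rule sum.mono_neutral_right) (auto simp: P_def Hdiag image_iff, metis Hdiag nat_neq_iff)
  also have "\<dots> = (\<Sum>(i, k)\<in>P. H i k) + (\<Sum>(i, k)\<in>prod.swap ` P. H i k)"
    using fP by (intro sum.union_disjoint) (auto simp: P_def)
  also have "(\<Sum>(i, k)\<in>prod.swap ` P. H i k) = (\<Sum>(i, k)\<in>P. H i k)"
    by (subst sum.reindex) (auto intro!: sum.cong simp: Hsym)
  also have "(\<Sum>(i, k)\<in>P. H i k) = real n * (real n - 1) * (\<Sum>(i, k)\<in>P. expect n (\<lambda>\<pi>. \<phi> (dd c i k (\<pi> i) (\<pi> k))))"
    unfolding sum_distrib_left by (intro sum.cong) (auto simp: HE)
  also have "(\<Sum>(i, k)\<in>P. expect n (\<lambda>\<pi>. \<phi> (dd c i k (\<pi> i) (\<pi> k))))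
     = (\<Sum>s<n. \<Sum>i\<in>{i\<in>{1..n}. i < reflect n s i}. expect n (\<lambda>\<pi>. \<phi> (dd c i (reflect n s i) (\<pi> i) (\<pi> (reflect n s i)))))"
    unfolding P_def by (rule sum_reflect[symmetric])
  finally have eq: "(\<Sum>i\<in>?I. \<Sum>k\<in>?I. H i k) = 2 * (real n * (real n - 1) *
      (\<Sum>s<n. \<Sum>i\<in>{i\<in>{1..n}. i < reflect n s i}. expect n (\<lambda>\<pi>. \<phi> (dd c i (reflect n s i) (\<pi> i) (\<pi> (reflect n s i))))))"
    by simp
  have "(\<Sum>s<n. \<Sum>i\<in>{i\<in>{1..n}. i < reflect n s i}. expect n (\<lambda>\<pi>. \<phi> (dd c i (reflect n s i) (\<pi> i) (\<pi> (reflect n s i))))) \<le> (\<Sum>s<n. E)"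
    unfolding E_def by (intro sum_mono matching_bound cube even) (auto intro: reflect_props reflect_reflect simp del: atLeastAtMost_iff One_nat_def)
  then have "(\<Sum>i\<in>?I. \<Sum>k\<in>?I. H i k) \<le> 2 * (real n * (real n - 1) * (\<Sum>s<n. E))"
    unfolding eq using n by (intro mult_left_mono) auto
  also have "\<dots> \<le> 2 * (real n * real n * (\<Sum>s<n. E))"
    using E0 n by (intro mult_left_mono mult_right_mono) auto
  also have "\<dots> = 2 * real n ^ 3 * E" by (simp add: power3_eq_cube)
  finally show ?thesis unfolding H_def E_def .
qed

subsection \<open>Rounding the coefficients to integers\<close>

text \<open>If every \<open>x\<close> violates one bound, then \<open>b * g x + a * h x\<close>
  exceeds \<open>2 * a * b\<close> everywhere, which is too much on average. For
  \<open>a = 0\<close>, which occurs when \<epsilon> is 0, the weights degenerate; then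
  \<open>g\<close> vanishes on \<open>B\<close> and only \<open>h\<close> remains.\<close>

lemma exists_both_le_twice_average:
  fixes g h :: "'a \<Rightarrow> real" and a b :: real
  assumes B: "finite B" "B \<noteq> {}" and nonneg: "\<And>x. 0 \<le> g x" "\<And>x. 0 \<le> h x"
    and g: "(\<Sum>x\<in>B. g x) \<le> card B * a" and h: "(\<Sum>x\<in>B. h x) \<le> card B * b" and b: "0 < b"
  shows "\<exists>x\<in>B. g x \<le> 2 * a \<and> h x \<le> 2 * b"
proof (rule ccontr)
  assume "\<not> ?thesis"
  then have no: "g x > 2 * a \<or> h x > 2 * b" if "x \<in> B" for x using that by force
  have N: "0 < card B" using B by (simp add: card_gt_0_iff)
  have "0 \<le> card B * a" using order_trans[OF sum_nonneg g] nonneg by auto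
  then have a: "0 \<le> a" using N by (simp add: zero_le_mult_iff)
  show False
  proof (cases "a = 0")
    case True
    then have "(\<Sum>x\<in>B. g x) = 0" using g sum_nonneg[of B g] nonneg by simp
    then have "\<forall>x\<in>B. g x = 0" using sum_nonneg_eq_0_iff[of B g] B nonneg by simp
    then have "h x > 2 * b" if "x \<in> B" for x using no[OF that] that True by auto
    then have "(\<Sum>x\<in>B. 2 * b) < (\<Sum>x\<in>B. h x)" using B by (intro sum_strict_mono) auto
    from order.strict_trans2[OF this h] have "card B * (2 * b) < card B * b" by simp
    moreover have "0 < card B * b" using N b by simp
    ultimately show False by (simp add: mult.commute)
  next
    case False
    then have a: "0 < a" using a by simp
    have "2 * a * b < b * g x + a * h x" if x: "x \<in> B" for x
      using no[OF x]
    proof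
      assume "g x > 2 * a"
      then have "b * g x > b * (2 * a)" using b by (intro mult_strict_left_mono)
      moreover have "0 \<le> a * h x" using a nonneg by simp
      ultimately show ?thesis by (simp add: algebra_simps)
    next
      assume "h x > 2 * b"
      then have "a * h x > a * (2 * b)" using a by (intro mult_strict_left_mono)
      moreover have "0 \<le> b * g x" using b nonneg by simp
      ultimately show ?thesis by (simp add: algebra_simps)
    qed
    then have "(\<Sum>x\<in>B. 2 * a * b) < (\<Sum>x\<in>B. b * g x + a * h x)" using B by (intro sum_strict_mono)
    also have "\<dots> = b * (\<Sum>x\<in>B. g x) + a * (\<Sum>x\<in>B. h x)" by (simp add: sum.distrib sum_distrib_left)
    also have "\<dots> \<le> b * (card B * a) + a * (card B * b)" using a b g h by (intro add_mono mult_left_mono) auto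
    finally show False by simp
  qed
qed

definition rnd3 :: "real \<Rightarrow> int" where
  "rnd3 x = (if \<bar>x\<bar> < 1 / 2 then 0 else if x > 0 then 1 else - 1)"

lemma rnd3: "\<bar>x - rnd3 x\<bar> = dist3 x"
  unfolding rnd3_def dist3_def by (auto simp: min_def abs_if)

lemma lin_base_change:
  fixes c :: "nat \<Rightarrow> nat \<Rightarrow> real"
  assumes "\<pi> \<in> Sym n"
  shows "lin n c \<pi> = lin n (\<lambda>i j. dd c i k j l) \<pi> + ((\<Sum>i\<in>{1..n}. c i l) + (\<Sum>j\<in>{1..n}. c k j) - n * c k l)"
proof -
  have "(\<Sum>i\<in>{1..n}. c k (\<pi> i)) = (\<Sum>j\<in>{1..n}. c k j)"
    by (rule sum.reindex_bij_betw[OF Sym_bij_betw[OF assms]])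
  then show ?thesis unfolding lin_def dd_def by (simp add: sum.distrib sum_subtractf)
qed

lemma of_int_lin: "of_int (lin n r \<pi>) = lin n (\<lambda>i j. real_of_int (r i j)) \<pi>"
  by (simp add: lin_def)

lemma expect_dist01_sq_le:
  assumes "expect n (\<lambda>\<pi>. (dist01 (F \<pi>))\<^sup>2) \<le> a" "expect n (\<lambda>\<pi>. (F \<pi> - G \<pi>)\<^sup>2) \<le> b"
  shows "expect n (\<lambda>\<pi>. (dist01 (G \<pi>))\<^sup>2) \<le> 2 * a + 2 * b"
proof -
  have "expect n (\<lambda>\<pi>. (dist01 (G \<pi>))\<^sup>2) \<le> expect n (\<lambda>\<pi>. 2 * (dist01 (F \<pi>))\<^sup>2 + 2 * (F \<pi> - G \<pi>)\<^sup>2)"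
  proof (rule expect_mono)
    fix \<pi> show "(dist01 (G \<pi>))\<^sup>2 \<le> 2 * (dist01 (F \<pi>))\<^sup>2 + 2 * (F \<pi> - G \<pi>)\<^sup>2"
      using dist01_sq_le_add[of "F \<pi>" "G \<pi> - F \<pi>"] by (simp add: power2_commute)
  qed
  also have "\<dots> \<le> 2 * a + 2 * b" unfolding expect_add expect_cmult using assms by simp
  finally show ?thesis .
qed

lemma expect_sq_add_le:
  assumes "expect n (\<lambda>\<pi>. (F \<pi>)\<^sup>2) \<le> a" "expect n (\<lambda>\<pi>. (G \<pi>)\<^sup>2) \<le> b"
  shows "expect n (\<lambda>\<pi>. (F \<pi> + G \<pi>)\<^sup>2) \<le> 2 * a + 2 * b"
proof -
  have "expect n (\<lambda>\<pi>. (F \<pi> + G \<pi>)\<^sup>2) \<le> expect n (\<lambda>\<pi>. 2 * (F \<pi>)\<^sup>2 + 2 * (G \<pi>)\<^sup>2)"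
    by (intro expect_mono) (use zero_le_power2 in \<open>simp add: power2_sum, smt (verit) power2_diff\<close>)
  also have "\<dots> \<le> 2 * a + 2 * b" unfolding expect_add expect_cmult using assms by simp
  finally show ?thesis .
qed

text \<open>A base cell is chosen that is good for two averages at once: the distances of its double
  differences from \<open>{- 1, 0, 1}\<close> make rounding cheap, and their squares bound the
  number of nonzero rounded values. Relative to that cell, \<open>c\<close> may be replaced by its
  double differences at the price of a constant.\<close>

lemma integer_approximation:
  fixes c :: "nat \<Rightarrow> nat \<Rightarrow> real"
  assumes n: "n \<ge> 2" and \<epsilon>: "\<epsilon> \<le> 1 / 4" and f: "expect n (\<lambda>\<pi>. (dist01 (lin n c \<pi>))\<^sup>2) \<le> \<epsilon>"
  shows "\<exists>(m :: int) (r :: nat \<Rightarrow> nat \<Rightarrow> int). card {(i, j)\<in>{1..n} \<times> {1..n}. r i j \<noteq> 0} \<le> 64 * n \<and>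
    expect n (\<lambda>\<pi>. (lin n c \<pi> - of_int (m + lin n r \<pi>))\<^sup>2) \<le> 25000 * \<epsilon>"
proof -
  let ?I = "{1..n}"
  have \<epsilon>0: "0 \<le> \<epsilon>" using order_trans[OF expect_nonneg f] by simp
  define g where "g = (\<lambda>(k, l). \<Sum>i\<in>?I. \<Sum>j\<in>?I. (dist3 (dd c i k j l))\<^sup>2)"
  define h where "h = (\<lambda>(k, l). \<Sum>i\<in>?I. \<Sum>j\<in>?I. (dd c i k j l)\<^sup>2)"
  have reorder: "(\<Sum>x\<in>?I \<times> ?I. case x of (k, l) \<Rightarrow> \<Sum>i\<in>?I. \<Sum>j\<in>?I. \<phi> (dd c i k j l)) = (\<Sum>i\<in>?I. \<Sum>k\<in>?I. \<Sum>j\<in>?I. \<Sum>l\<in>?I. (\<phi> (dd c i k j l) :: real))" for \<phi>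
  proof -
    have "(\<Sum>i\<in>?I. \<Sum>k\<in>?I. \<Sum>j\<in>?I. \<Sum>l\<in>?I. \<phi> (dd c i k j l)) = (\<Sum>k\<in>?I. \<Sum>i\<in>?I. \<Sum>j\<in>?I. \<Sum>l\<in>?I. \<phi> (dd c i k j l))"
      by (rule sum.swap)
    also have "\<dots> = (\<Sum>k\<in>?I. \<Sum>i\<in>?I. \<Sum>l\<in>?I. \<Sum>j\<in>?I. \<phi> (dd c i k j l))"
      by (rule sum.cong[OF refl], rule sum.cong[OF refl], rule sum.swap)
    also have "\<dots> = (\<Sum>k\<in>?I. \<Sum>l\<in>?I. \<Sum>i\<in>?I. \<Sum>j\<in>?I. \<phi> (dd c i k j l))"
      by (rule sum.cong[OF refl], rule sum.swap)
    finally show ?thesis by (simp only: sum.cartesian_product[symmetric])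
  qed
  have "\<exists>x\<in>?I \<times> ?I. g x \<le> 2 * (1032 * n * \<epsilon>) \<and> h x \<le> 2 * (8 * real n)"
  proof (rule exists_both_le_twice_average)
    show "finite (?I \<times> ?I)" "?I \<times> ?I \<noteq> {}" "0 < 8 * real n" using n by auto
    show "0 \<le> g x" "0 \<le> h x" for x unfolding g_def h_def by (auto split: prod.split intro!: sum_nonneg)
    have "(\<Sum>x\<in>?I \<times> ?I. g x) \<le> 2 * real n ^ 3 * expect n (\<lambda>\<pi>. 516 * (dist01 (lin n c \<pi>))\<^sup>2)"
      unfolding g_def reorder[of "\<lambda>x. (dist3 x)\<^sup>2"]
    proof (rule sum_dd_le[OF n, where \<phi> = "\<lambda>x. (dist3 x)\<^sup>2" and \<psi> = "\<lambda>x. 516 * (dist01 x)\<^sup>2"])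
      fix M :: "nat set" and a :: "nat \<Rightarrow> real" and a0 :: real assume "finite M"
      from affine_cube_FKN[OF this, of a a0]
      show "(\<Sum>i\<in>M. (dist3 (a i))\<^sup>2) \<le> (\<Sum>T\<in>Pow M. 516 * (dist01 (a0 + (\<Sum>i\<in>T. a i)))\<^sup>2) / 2 ^ card M"
        by (simp add: sum_distrib_left)
    qed (auto simp: dist3_def abs_if min_def)
    also have "\<dots> \<le> 2 * real n ^ 3 * (516 * \<epsilon>)" unfolding expect_cmult using f by (intro mult_left_mono) auto
    also have "\<dots> = card (?I \<times> ?I) * (1032 * n * \<epsilon>)" by (simp add: card_cartesian_product power3_eq_cube)
    finally show "(\<Sum>x\<in>?I \<times> ?I. g x) \<le> card (?I \<times> ?I) * (1032 * n * \<epsilon>)" .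
    have "expect n (\<lambda>\<pi>. 4 * (lin n c \<pi> - 1 / 2)\<^sup>2) \<le> expect n (\<lambda>\<pi>. 2 + 8 * (dist01 (lin n c \<pi>))\<^sup>2)"
    proof (rule expect_mono)
      fix \<pi>
      define d where "d = dist01 (lin n c \<pi>)"
      have "\<bar>lin n c \<pi> - 1 / 2\<bar> \<le> 1 / 2 + d" unfolding d_def dist01_def by (auto simp: min_def abs_if)
      then have "(lin n c \<pi> - 1 / 2)\<^sup>2 \<le> (1 / 2 + d)\<^sup>2" using abs_le_square_iff[of "lin n c \<pi> - 1 / 2" "1 / 2 + d"] by linarith
      also have "\<dots> \<le> 1 / 2 + 2 * d\<^sup>2" using zero_le_power2[of "1 / 2 - d"] by (simp add: power2_sum power2_diff power_divide)
      finally show "4 * (lin n c \<pi> - 1 / 2)\<^sup>2 \<le> 2 + 8 * (dist01 (lin n c \<pi>))\<^sup>2" unfolding d_def by simp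
    qed
    also have "\<dots> \<le> 4" unfolding expect_add expect_cmult using f \<epsilon> by simp
    finally have E4: "expect n (\<lambda>\<pi>. 4 * (lin n c \<pi> - 1 / 2)\<^sup>2) \<le> 4" .
    have "(\<Sum>x\<in>?I \<times> ?I. h x) \<le> 2 * real n ^ 3 * expect n (\<lambda>\<pi>. 4 * (lin n c \<pi> - 1 / 2)\<^sup>2)"
      unfolding h_def reorder[of power2]
    proof (rule sum_dd_le[OF n, where \<phi> = power2 and \<psi> = "\<lambda>x. 4 * (x - 1 / 2)\<^sup>2"])
      fix M :: "nat set" and a :: "nat \<Rightarrow> real" and a0 :: real assume "finite M"
      from affine_cube_variance[OF this, of a a0]
      show "(\<Sum>i\<in>M. (a i)\<^sup>2) \<le> (\<Sum>T\<in>Pow M. 4 * (a0 + (\<Sum>i\<in>T. a i) - 1 / 2)\<^sup>2) / 2 ^ card M"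
        by (simp add: sum_distrib_left)
    qed auto
    also have "\<dots> \<le> 2 * real n ^ 3 * 4" by (intro mult_left_mono E4) simp
    finally show "(\<Sum>x\<in>?I \<times> ?I. h x) \<le> card (?I \<times> ?I) * (8 * real n)"
      by (simp add: card_cartesian_product power3_eq_cube)
  qed
  then obtain k l where kl: "(\<Sum>i\<in>?I. \<Sum>j\<in>?I. (dist3 (dd c i k j l))\<^sup>2) \<le> 2064 * n * \<epsilon>"
     "(\<Sum>i\<in>?I. \<Sum>j\<in>?I. (dd c i k j l)\<^sup>2) \<le> 16 * real n" unfolding g_def h_def by (auto simp: mult.assoc)
  define b where "b i j = dd c i k j l" for i j
  define r where "r i j = rnd3 (b i j)" for i j
  define e where "e i j = b i j - r i j" for i j
  define S where "S = {(i, j)\<in>?I \<times> ?I. r i j \<noteq> 0}"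
  have fS: "finite S" by (rule finite_subset[of _ "?I \<times> ?I"]) (auto simp: S_def)
  \<comment> \<open>An entry that is not rounded to 0 is at least 1/2 in absolute value, so it
    contributes at least 1/4 to a sum bounded by \<open>16 * n\<close>.\<close>
  have "real (card S) / 4 = (\<Sum>(i, j)\<in>S. 1 / 4)" by simp
  also have "\<dots> \<le> (\<Sum>(i, j)\<in>S. (b i j)\<^sup>2)"
  proof (rule sum_mono)
    fix x assume "x \<in> S"
    then obtain i j where x: "x = (i, j)" "r i j \<noteq> 0" by (auto simp: S_def)
    then have "\<bar>1 / 2\<bar> \<le> \<bar>b i j\<bar>" by (auto simp: r_def rnd3_def split: if_splits)
    then have "(1 / 2)\<^sup>2 \<le> (b i j)\<^sup>2" by (subst (asm) abs_le_square_iff)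
    then show "(case x of (i, j) \<Rightarrow> 1 / 4) \<le> (case x of (i, j) \<Rightarrow> (b i j)\<^sup>2)" using x by (simp add: power_divide)
  qed
  also have "\<dots> \<le> (\<Sum>(i, j)\<in>?I \<times> ?I. (b i j)\<^sup>2)" by (rule sum_mono2) (auto simp: S_def)
  also have "\<dots> \<le> 16 * real n" using kl(2) by (simp add: sum.cartesian_product b_def)
  finally have cS: "card S \<le> 64 * n" by linarith
  have e: "(\<Sum>i\<in>?I. \<Sum>j\<in>?I. (e i j)\<^sup>2) \<le> 2064 * n * \<epsilon>"
  proof -
    have "(e i j)\<^sup>2 = (dist3 (dd c i k j l))\<^sup>2" for i j
      unfolding e_def r_def b_def rnd3[symmetric] by simp
    then show ?thesis using kl(1) by simp
  qed
  \<comment> \<open>The mean of the rounding error is moved into the constant, so that only the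
    variance of the error counts.\<close>
  define \<kappa> where "\<kappa> = (\<Sum>i\<in>?I. c i l) + (\<Sum>j\<in>?I. c k j) - n * c k l + expect n (lin n e)"
  have diff: "lin n c \<pi> - (\<kappa> + of_int (lin n r \<pi>)) = lin n e \<pi> - expect n (lin n e)" if "\<pi> \<in> Sym n" for \<pi>
    using lin_base_change[OF that, of c k l] unfolding \<kappa>_def of_int_lin
    by (simp add: lin_def e_def b_def sum_subtractf)
  have "expect n (\<lambda>\<pi>. (lin n c \<pi> - (\<kappa> + of_int (lin n r \<pi>)))\<^sup>2) = expect n (\<lambda>\<pi>. (lin n e \<pi> - expect n (lin n e))\<^sup>2)"
    by (rule expect_cong) (simp add: diff)
  also have "\<dots> \<le> 2 * (\<Sum>i\<in>?I. \<Sum>j\<in>?I. (e i j)\<^sup>2) / n" by (rule variance_lin_le[OF n])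
  also have "\<dots> \<le> 4128 * \<epsilon>" using e n by (simp add: field_simps)
  finally have h0: "expect n (\<lambda>\<pi>. (lin n c \<pi> - (\<kappa> + of_int (lin n r \<pi>)))\<^sup>2) \<le> 4128 * \<epsilon>" .
  define m where "m = round \<kappa>"
  \<comment> \<open>As \<open>lin n r\<close> is integer-valued, the distance of
    \<open>\<kappa>\<close> from the nearest integer is at most the distance of the whole function
    from \<open>{0, 1}\<close>, at every permutation.\<close>
  have "expect n (\<lambda>\<pi>. (\<kappa> - m)\<^sup>2) \<le> expect n (\<lambda>\<pi>. (dist01 (\<kappa> + of_int (lin n r \<pi>)))\<^sup>2)"
  proof (rule expect_mono)
    fix \<pi>
    have "\<bar>\<kappa> - m\<bar> \<le> \<bar>\<kappa> - of_int (- lin n r \<pi>)\<bar>" "\<bar>\<kappa> - m\<bar> \<le> \<bar>\<kappa> - of_int (1 - lin n r \<pi>)\<bar>"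
      unfolding m_def by (rule round_diff_minimal)+
    then have "\<bar>\<kappa> - m\<bar> \<le> \<bar>dist01 (\<kappa> + of_int (lin n r \<pi>))\<bar>" by (simp add: dist01_def algebra_simps)
    then show "(\<kappa> - m)\<^sup>2 \<le> (dist01 (\<kappa> + of_int (lin n r \<pi>)))\<^sup>2" by (subst (asm) abs_le_square_iff)
  qed
  also have "\<dots> \<le> 2 * \<epsilon> + 2 * (4128 * \<epsilon>)" by (rule expect_dist01_sq_le[OF f h0])
  finally have km: "expect n (\<lambda>\<pi>. (\<kappa> - m)\<^sup>2) \<le> 8258 * \<epsilon>" by simp
  have "expect n (\<lambda>\<pi>. (lin n c \<pi> - of_int (m + lin n r \<pi>))\<^sup>2)
     = expect n (\<lambda>\<pi>. ((lin n c \<pi> - (\<kappa> + of_int (lin n r \<pi>))) + (\<kappa> - m))\<^sup>2)"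
    by (rule expect_cong) (simp add: algebra_simps)
  also have "\<dots> \<le> 2 * (4128 * \<epsilon>) + 2 * (8258 * \<epsilon>)" by (rule expect_sq_add_le[OF h0 km])
  also have "\<dots> \<le> 25000 * \<epsilon>" using \<epsilon>0 by simp
  finally show ?thesis using cS unfolding S_def by blast
qed

subsection \<open>Representations with minimal support\<close>

definition supp :: "nat \<Rightarrow> (nat \<Rightarrow> nat \<Rightarrow> int) \<Rightarrow> (nat \<times> nat) set" where
  "supp n r = {(i, j)\<in>{1..n} \<times> {1..n}. r i j \<noteq> 0}"

lemma finite_supp [simp, intro]: "finite (supp n r)"
  by (rule finite_subset[of _ "{1..n} \<times> {1..n}"]) (auto simp: supp_def)

lemma card_supp: "card (supp n r) = (\<Sum>i\<in>{1..n}. card {j\<in>{1..n}. r i j \<noteq> 0})"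
proof -
  have "supp n r = (SIGMA i:{1..n}. {j\<in>{1..n}. r i j \<noteq> 0})" by (auto simp: supp_def)
  then show ?thesis by simp
qed

lemma card_supp_transpose: "card (supp n (\<lambda>i j. r j i)) = card (supp n r)"
proof -
  have "supp n (\<lambda>i j. r j i) = prod.swap ` supp n r" by (auto simp: supp_def image_iff)
  then show ?thesis by (simp add: card_image)
qed

lemma lin_transpose:
  assumes "\<pi> \<in> Sym n"
  shows "lin n (\<lambda>i j. r j i) (inv \<pi>) = lin n r \<pi>"
proof -
  have "lin n r \<pi> = (\<Sum>i\<in>{1..n}. r (inv \<pi> (\<pi> i)) (\<pi> i))"
    unfolding lin_def using Sym_inv_eq[OF assms] by (intro sum.cong refl) metis
  also have "\<dots> = (\<Sum>j\<in>{1..n}. r (inv \<pi> j) j)"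
    by (rule sum.reindex_bij_betw[OF Sym_bij_betw[OF assms]])
  finally show ?thesis by (simp add: lin_def)
qed

lemma lin_swap:
  fixes r :: "nat \<Rightarrow> nat \<Rightarrow> int"
  assumes "i \<in> {1..n}" "k \<in> {1..n}" "i \<noteq> k"
  shows "lin n r (\<pi> \<circ> swp i k) = lin n r \<pi> - dd r i k (\<pi> i) (\<pi> k)"
proof -
  have "lin n r (\<pi> \<circ> swp i k) - lin n r \<pi> = (\<Sum>x\<in>{1..n}. r x (\<pi> (swp i k x)) - r x (\<pi> x))"
    by (simp add: lin_def sum_subtractf)
  also have "\<dots> = (\<Sum>x\<in>{i, k}. r x (\<pi> (swp i k x)) - r x (\<pi> x))"
    using assms by (intro sum.mono_neutral_right) (auto simp: Transposition.transpose_def)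
  also have "\<dots> = - dd r i k (\<pi> i) (\<pi> k)" using assms by (simp add: dd_def)
  finally show ?thesis by simp
qed

lemma card_Sym_pairs:
  assumes "i \<in> {1..n}" "k \<in> {1..n}" "i \<noteq> k" and W: "W \<subseteq> {(p, q)\<in>{1..n} \<times> {1..n}. p \<noteq> q}"
  shows "card {\<pi> \<in> Sym n. (\<pi> i, \<pi> k) \<in> W} = card W * fact (n - 2)"
proof -
  have fW: "finite W" by (rule finite_subset[of _ "{1..n} \<times> {1..n}"]) (use W in auto)
  have "{\<pi> \<in> Sym n. (\<pi> i, \<pi> k) \<in> W} = (\<Union>(p, q)\<in>W. {\<pi> \<in> Sym n. \<pi> i = p \<and> \<pi> k = q})" by auto
  also have "card \<dots> = (\<Sum>(p, q)\<in>W. card {\<pi> \<in> Sym n. \<pi> i = p \<and> \<pi> k = q})"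
    by (subst card_UN_disjoint) (use fW in \<open>auto simp: case_prod_beta\<close>)
  also have "\<dots> = (\<Sum>(p, q)\<in>W. fact (n - 2))"
    using W assms by (intro sum.cong refl) (auto intro!: card_Sym_2)
  finally show ?thesis by simp
qed

text \<open>Turns a positive density of \<open>k\<close>-tuples of values into a positive proportion
  of all permutations.\<close>

lemma fact_le_power_fact: "k \<le> n \<Longrightarrow> (fact n :: nat) \<le> n ^ k * fact (n - k)"
proof (induction k)
  case (Suc k)
  then have "fact (n - k) = (n - k) * (fact (n - Suc k) :: nat)" by (subst fact_reduce) auto
  also have "\<dots> \<le> n * fact (n - Suc k)" by simp
  finally have *: "n ^ k * fact (n - k) \<le> n ^ k * (n * fact (n - Suc k))" by (rule mult_left_mono) simp
  have "fact n \<le> n ^ k * fact (n - k)" using Suc by simp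
  also note *
  finally show ?case by (simp add: mult.assoc mult.left_commute)
qed simp

lemma fact_real_le: "k \<le> n \<Longrightarrow> (fact n :: real) \<le> real (n ^ k * fact (n - k))"
  using of_nat_mono[OF fact_le_power_fact[of k n], where ?'a = real] by (simp only: of_nat_fact)

lemma card_le_of_inj_Sym:
  assumes "A \<subseteq> Sym n" "finite B" "inj_on T (Sym n)" "\<And>\<pi>. \<pi> \<in> A \<Longrightarrow> T \<pi> \<in> B"
  shows "card A \<le> card B"
  using assms by (intro card_inj_on_le[of T]) (auto intro: inj_on_subset)

lemma inj_on_compose_right: "\<sigma> \<in> Sym n \<Longrightarrow> inj_on (\<lambda>\<pi>. \<pi> \<circ> \<sigma>) A"
  by (rule inj_on_inverseI[of _ "\<lambda>\<pi>. \<pi> \<circ> inv \<sigma>"]) (simp add: comp_assoc Sym_def permutes_inv_o)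

lemma inj_on_compose_left: "\<sigma> \<in> Sym n \<Longrightarrow> inj_on (\<lambda>\<pi>. \<sigma> \<circ> \<pi>) A"
  by (rule inj_on_inverseI[of _ "\<lambda>\<pi>. inv \<sigma> \<circ> \<pi>"]) (simp add: comp_assoc[symmetric] Sym_def permutes_inv_o)

text \<open>The situation for large \<open>n\<close>: a sparse integer representation with few
  non-Boolean permutations. The two mode conditions are what minimality of the support is used for.
  The bound on \<open>\<eta>\<close> is dictated by \<open>not_both_heavy\<close>; the bound on
  \<open>n\<close> lets linear terms be absorbed by quadratic ones.\<close>

locale near_boolean =
  fixes n :: nat and m :: int and r :: "nat \<Rightarrow> nat \<Rightarrow> int" and \<eta> :: real
  assumes card_supp_le: "card (supp n r) \<le> 64 * n"
    and card_bad_le: "real (card {\<pi> \<in> Sym n. m + lin n r \<pi> \<notin> {0, 1}}) \<le> \<eta> * fact n"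
    and row_mode: "\<And>i v. i \<in> {1..n} \<Longrightarrow> card {j\<in>{1..n}. r i j = v} \<le> card {j\<in>{1..n}. r i j = 0}"
    and col_mode: "\<And>j v. j \<in> {1..n} \<Longrightarrow> card {i\<in>{1..n}. r i j = v} \<le> card {i\<in>{1..n}. r i j = 0}"
    and n_large: "n \<ge> 50000" and eta: "\<eta> \<le> 1 / 10000"
begin

abbreviation "I \<equiv> {1..n}"

definition "bad = {\<pi> \<in> Sym n. m + lin n r \<pi> \<notin> {0, 1}}"
definition "Z i = {j\<in>I. r i j \<noteq> 0}"
definition "Y j = {i\<in>I. r i j \<noteq> 0}"

lemma finite_bad [simp]: "finite bad" unfolding bad_def by simp
lemma finite_Z [simp]: "finite (Z i)" unfolding Z_def by simp
lemma finite_Y [simp]: "finite (Y i)" unfolding Y_def by simp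

text \<open>Inversion of permutations exchanges rows and columns, so everything proved for rows
  holds for columns.\<close>

lemma transposed: "near_boolean n m (\<lambda>i j. r j i) \<eta>"
proof
  show "card (supp n (\<lambda>i j. r j i)) \<le> 64 * n" using card_supp_le card_supp_transpose[of n r] by (simp only:)
  have "card {\<pi> \<in> Sym n. m + lin n (\<lambda>i j. r j i) \<pi> \<notin> {0, 1}} \<le> card {\<pi> \<in> Sym n. m + lin n r \<pi> \<notin> {0, 1}}"
  proof (rule card_inj_on_le[of inv])
    show "inj_on inv {\<pi> \<in> Sym n. m + lin n (\<lambda>i j. r j i) \<pi> \<notin> {0, 1}}"
      by (rule inj_onI) (metis (lifting) Sym_bij inv_inv_eq mem_Collect_eq)
    have "lin n r (inv \<pi>) = lin n (\<lambda>i j. r j i) \<pi>" if "\<pi> \<in> Sym n" for \<pi>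
      using lin_transpose[OF that, of "\<lambda>i j. r j i"] by simp
    then show "inv ` {\<pi> \<in> Sym n. m + lin n (\<lambda>i j. r j i) \<pi> \<notin> {0, 1}} \<subseteq> {\<pi> \<in> Sym n. m + lin n r \<pi> \<notin> {0, 1}}"
      by (auto simp: Sym_inv)
  qed simp
  then show "real (card {\<pi> \<in> Sym n. m + lin n (\<lambda>i j. r j i) \<pi> \<notin> {0, 1}}) \<le> \<eta> * fact n"
    using card_bad_le by linarith
qed (use row_mode col_mode n_large eta in auto)

lemma card_Z: "card {j\<in>I. r i j = 0} + card (Z i) = n"
proof -
  have "card ({j\<in>I. r i j = 0} \<union> Z i) = card {j\<in>I. r i j = 0} + card (Z i)"
    by (rule card_Un_disjoint) (auto simp: Z_def)
  moreover have "{j\<in>I. r i j = 0} \<union> Z i = I" by (auto simp: Z_def)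
  ultimately show ?thesis by simp
qed

lemma row_mode_le: "i \<in> I \<Longrightarrow> card {j\<in>I. r i j = v} \<le> n - card (Z i)"
  using row_mode[of i v] card_Z[of i] by linarith

text \<open>Rows have at most 64 nonzero entries on average, so they cannot all but one have more
  than twice as many. Swapping with such a row \<open>k\<close> isolates the effect of row
  \<open>i\<close>.\<close>

lemma light_row: "\<exists>k\<in>I. k \<noteq> i \<and> card (Z k) \<le> 128"
proof (rule ccontr)
  assume "\<not> ?thesis"
  then have a: "129 \<le> card (Z k)" if "k \<in> I - {i}" for k using that by force
  have "(n - 1) * 129 \<le> card (I - {i}) * 129" by (simp add: card_Diff_singleton_if)
  also have "\<dots> = (\<Sum>k\<in>I - {i}. 129)" by simp
  also have "\<dots> \<le> (\<Sum>k\<in>I - {i}. card (Z k))" by (intro sum_mono a)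
  also have "\<dots> \<le> (\<Sum>k\<in>I. card (Z k))" by (intro sum_mono2) auto
  also have "\<dots> = card (supp n r)" by (simp add: card_supp Z_def)
  also have "\<dots> \<le> 64 * n" by (rule card_supp_le)
  finally show False using n_large by auto
qed

text \<open>If zero, the most frequent value, filled less than a sixth of the row, then any three
  consecutive values would fill less than half of it, and about half of the pairs of entries would
  differ by at least 2. Swapping such a pair against a light row changes the function by at least 2,
  so one of the two permutations is bad.\<close>

lemma row_nonzero_le:
  assumes i: "i \<in> I"
  shows "6 * card (Z i) \<le> 5 * n"
proof (rule ccontr)
  assume "\<not> ?thesis"
  then have z: "6 * card {j\<in>I. r i j = 0} < n" using card_Z[of i] by linarith
  obtain k where k: "k \<in> I" "k \<noteq> i" "card (Z k) \<le> 128" using light_row by blast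
  define W where "W = {(p, q)\<in>I \<times> I. 2 \<le> \<bar>r i p - r i q\<bar> \<and> p \<notin> Z k \<and> q \<notin> Z k}"
  let ?N = "SIGMA p:I. {q\<in>I. \<bar>r i p - r i q\<bar> < 2}"
  have "card ?N \<le> (\<Sum>p\<in>I. 3 * card {j\<in>I. r i j = 0})"
  proof (subst card_SigmaI)
    show "(\<Sum>p\<in>I. card {q\<in>I. \<bar>r i p - r i q\<bar> < 2}) \<le> (\<Sum>p\<in>I. 3 * card {j\<in>I. r i j = 0})"
    proof (rule sum_mono)
      fix p
      let ?L = "\<lambda>v. {q\<in>I. r i q = v}"
      have "{q\<in>I. \<bar>r i p - r i q\<bar> < 2} \<subseteq> ?L (r i p - 1) \<union> ?L (r i p) \<union> ?L (r i p + 1)" by auto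
      then have "card {q\<in>I. \<bar>r i p - r i q\<bar> < 2} \<le> card (?L (r i p - 1) \<union> ?L (r i p) \<union> ?L (r i p + 1))"
        by (rule card_mono[rotated]) auto
      also have "\<dots> \<le> card (?L (r i p - 1)) + card (?L (r i p)) + card (?L (r i p + 1))"
        by (meson add_le_mono card_Un_le le_refl order_trans)
      also have "\<dots> \<le> 3 * card {j\<in>I. r i j = 0}"
        using row_mode[OF i, of "r i p - 1"] row_mode[OF i, of "r i p"] row_mode[OF i, of "r i p + 1"] by linarith
      finally show "card {q\<in>I. \<bar>r i p - r i q\<bar> < 2} \<le> 3 * card {j\<in>I. r i j = 0}" .
    qed
  qed auto
  also have "\<dots> = n * (3 * card {j\<in>I. r i j = 0})" by simp
  finally have "2 * card ?N \<le> n * (6 * card {j\<in>I. r i j = 0})" by linarith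
  also have "\<dots> \<le> n * n" using z by (intro mult_le_mono2) simp
  finally have N: "2 * card ?N \<le> n * n" .
  have "I \<times> I \<subseteq> W \<union> ?N \<union> Z k \<times> I \<union> I \<times> Z k" by (auto simp: W_def)
  then have "card (I \<times> I) \<le> card (W \<union> ?N \<union> Z k \<times> I \<union> I \<times> Z k)"
    by (rule card_mono[rotated]) (auto simp: W_def intro: finite_subset[of _ "I \<times> I"])
  also have "\<dots> \<le> card W + card ?N + card (Z k \<times> I) + card (I \<times> Z k)"
    by (meson add_le_mono card_Un_le le_refl order_trans)
  finally have "n * n \<le> card W + card ?N + 2 * (n * card (Z k))" by (simp add: card_cartesian_product mult.commute)
  moreover have "n * card (Z k) \<le> n * 128" using k by simp
  moreover have "1024 * n \<le> n * n" using n_large by simp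
  ultimately have W: "n * n \<le> 4 * card W" using N by linarith
  have "card {\<pi> \<in> Sym n. (\<pi> i, \<pi> k) \<in> W} \<le> card ({\<pi> \<in> Sym n. \<pi> \<in> bad} \<union> {\<pi> \<in> Sym n. \<pi> \<circ> swp i k \<in> bad})"
  proof (rule card_mono)
    show "{\<pi> \<in> Sym n. (\<pi> i, \<pi> k) \<in> W} \<subseteq> {\<pi> \<in> Sym n. \<pi> \<in> bad} \<union> {\<pi> \<in> Sym n. \<pi> \<circ> swp i k \<in> bad}"
    proof
      fix \<pi> assume p: "\<pi> \<in> {\<pi> \<in> Sym n. (\<pi> i, \<pi> k) \<in> W}"
      have s: "\<pi> \<circ> swp i k \<in> Sym n" using p i k by (intro Sym_compose transpose_in_Sym) auto
      have "r k (\<pi> i) = 0" "r k (\<pi> k) = 0" using p by (auto simp: W_def Z_def)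
      then have "2 \<le> \<bar>dd r i k (\<pi> i) (\<pi> k)\<bar>" using p by (simp add: dd_def W_def)
      then have "m + lin n r \<pi> \<notin> {0, 1} \<or> m + lin n r (\<pi> \<circ> swp i k) \<notin> {0, 1}"
        using lin_swap[OF i k(1), of r \<pi>] k(2) by auto
      then show "\<pi> \<in> {\<pi> \<in> Sym n. \<pi> \<in> bad} \<union> {\<pi> \<in> Sym n. \<pi> \<circ> swp i k \<in> bad}"
        using p s unfolding bad_def by auto
    qed
  qed auto
  also have "\<dots> \<le> card {\<pi> \<in> Sym n. \<pi> \<in> bad} + card {\<pi> \<in> Sym n. \<pi> \<circ> swp i k \<in> bad}" by (rule card_Un_le)
  also have "\<dots> \<le> card bad + card bad"
    using i k by (intro add_mono card_le_of_inj_Sym[of _ n bad "\<lambda>\<pi>. \<pi>"] card_le_of_inj_Sym[of _ n bad "\<lambda>\<pi>. \<pi> \<circ> swp i k"]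
        inj_on_compose_right[where n = n] transpose_in_Sym) auto
  also have "card {\<pi> \<in> Sym n. (\<pi> i, \<pi> k) \<in> W} = card W * fact (n - 2)"
    using i k by (intro card_Sym_pairs) (auto simp: W_def)
  finally have "real (card W * fact (n - 2)) \<le> real (2 * card bad)" by (simp only: of_nat_le_iff mult_2)
  also have "\<dots> \<le> 2 * (\<eta> * fact n)" using card_bad_le by (simp add: bad_def)
  also have "\<dots> \<le> 1 / 5000 * fact n" using eta by simp
  also have "\<dots> \<le> 1 / 5000 * real (n ^ 2 * fact (n - 2))"
    using fact_real_le[of 2 n] n_large by (intro mult_left_mono) auto
  finally have "real (card W) \<le> 1 / 5000 * (real n)\<^sup>2" by simp
  moreover have "(real n)\<^sup>2 \<le> 4 * card W" using W of_nat_mono[OF W, where ?'a = real] by (simp add: power2_eq_square)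
  moreover have "0 < (real n)\<^sup>2" using n_large by simp
  ultimately show False by linarith
qed

text \<open>By the mode condition at least \<open>n * card (Z i)\<close> pairs of entries differ,
  more than a 24th of all pairs. Excluding at most 130 columns in either component loses at most
  \<open>260 * n\<close> pairs, which is at most half of that since \<open>n\<close> is at least 260
  * 48 = 12480.\<close>

lemma row_pairs:
  assumes i: "i \<in> I" and k: "card (Z k) \<le> 128" and X: "finite X" "card X \<le> 2" and z: "n < 24 * card (Z i)"
  shows "n ^ 2 \<le> 48 * card {(p, q)\<in>(I - X) \<times> (I - X). r i p \<noteq> r i q \<and> r k p = 0 \<and> r k q = 0}"
proof -
  define W where "W = {(p, q)\<in>(I - X) \<times> (I - X). r i p \<noteq> r i q \<and> r k p = 0 \<and> r k q = 0}"
  let ?N = "SIGMA p:I. {q\<in>I. r i q = r i p}" and ?V = "Z k \<union> X"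
  have cV: "card ?V \<le> 130" using card_Un_le[of "Z k" X] k X by linarith
  have "card ?N = (\<Sum>p\<in>I. card {q\<in>I. r i q = r i p})" by simp
  also have "\<dots> \<le> (\<Sum>p\<in>I. n - card (Z i))" by (intro sum_mono row_mode_le i)
  finally have "card ?N \<le> n * (n - card (Z i))" by simp
  moreover have "n * (n - card (Z i)) + n * card (Z i) = n * n"
    using card_Z[of i] by (metis distrib_left le_add2 le_add_diff_inverse2)
  ultimately have N: "card ?N + n * card (Z i) \<le> n * n" by linarith
  have "I \<times> I \<subseteq> W \<union> ?N \<union> ?V \<times> I \<union> I \<times> ?V" by (auto simp: W_def Z_def)
  then have "card (I \<times> I) \<le> card (W \<union> ?N \<union> ?V \<times> I \<union> I \<times> ?V)"
    by (rule card_mono[rotated]) (use X in \<open>auto simp: W_def intro: finite_subset[of _ "I \<times> I"]\<close>)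
  also have "\<dots> \<le> card W + card ?N + card (?V \<times> I) + card (I \<times> ?V)"
    by (meson add_le_mono card_Un_le le_refl order_trans)
  finally have "n * n \<le> card W + card ?N + 2 * (n * card ?V)" by (simp add: card_cartesian_product mult.commute)
  moreover have "n * card ?V \<le> n * 130" using cV by simp
  moreover have "n * n \<le> 24 * (n * card (Z i))" using mult_le_mono2[of n "24 * card (Z i)" n] z by simp
  moreover have "12480 * n \<le> n * n" using n_large by simp
  ultimately show ?thesis using N unfolding W_def[symmetric] power2_eq_square by linarith
qed

end

section \<open>Heavy rows against heavy columns\<close>

context near_boolean begin

text \<open>A heavy row yields a swap of positions that changes the function by a nonzero
  \<open>D\<close>, a heavy column a swap of values that changes it by a nonzero \<open>E\<close>.
  The excluded sets in \<open>P\<close> and \<open>Q\<close> keep the swaps independent, so both can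
  be performed. The four resulting permutations are not all Boolean. This happens for a proportion
  of at least 1/48 * 1/48 = 1/2304, more than four times \<open>\<eta>\<close>.\<close>

lemma not_both_heavy:
  assumes i: "i \<in> I" and j: "j \<in> I"
  shows "24 * card (Z i) \<le> n \<or> 24 * card (Y j) \<le> n"
proof (rule ccontr)
  assume "\<not> ?thesis"
  then have heavy: "n < 24 * card (Z i)" "n < 24 * card (Y j)" by auto
  interpret T: near_boolean n m "\<lambda>i j. r j i" \<eta> by (rule transposed)
  have TZ: "T.Z = Y" by (simp add: T.Z_def[abs_def] Y_def[abs_def])
  obtain k where k: "k \<in> I" "k \<noteq> i" "card (Z k) \<le> 128" using light_row by blast
  obtain l where l: "l \<in> I" "l \<noteq> j" "card (Y l) \<le> 128" using T.light_row unfolding TZ by blast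
  define P where "P = {(p, q)\<in>(I - {j, l}) \<times> (I - {j, l}). r i p \<noteq> r i q \<and> r k p = 0 \<and> r k q = 0}"
  define Q where "Q = {(s, t)\<in>(I - {i, k}) \<times> (I - {i, k}). r s j \<noteq> r t j \<and> r s l = 0 \<and> r t l = 0}"
  have P: "n ^ 2 \<le> 48 * card P"
    unfolding P_def by (rule row_pairs) (use i k heavy in \<open>auto simp: card_insert_if\<close>)
  have Q: "n ^ 2 \<le> 48 * card Q"
    unfolding Q_def by (rule T.row_pairs) (use j l heavy in \<open>auto simp: card_insert_if TZ\<close>)
  have fin: "finite P" "finite Q"
    by (rule finite_subset[of _ "I \<times> I"]; auto simp: P_def Q_def)+
  define A where "A = (\<lambda>((p, q), (s, t)). {\<pi> \<in> Sym n. \<pi> i = p \<and> \<pi> k = q \<and> \<pi> s = j \<and> \<pi> t = l})"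
  define R where "R = (\<lambda>\<pi> :: nat \<Rightarrow> nat. \<pi> \<circ> swp i k)"
  define L where "L = (\<lambda>\<pi> :: nat \<Rightarrow> nat. swp j l \<circ> \<pi>)"
  have swp: "swp i k \<in> Sym n" "swp j l \<in> Sym n" using i j k l by (auto intro: transpose_in_Sym)
  have inj: "inj_on R X" "inj_on L X" for X
    unfolding R_def L_def using inj_on_compose_right[OF swp(1)] inj_on_compose_left[OF swp(2)] by auto
  have Sym: "\<pi> \<in> Sym n \<Longrightarrow> R \<pi> \<in> Sym n" "\<pi> \<in> Sym n \<Longrightarrow> L \<pi> \<in> Sym n" for \<pi>
    unfolding R_def L_def using swp by (auto intro: Sym_compose)
  have "card (\<Union>w\<in>P \<times> Q. A w) = (\<Sum>w\<in>P \<times> Q. card (A w))"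
  proof (rule card_UN_disjoint)
    show "\<forall>v\<in>P \<times> Q. \<forall>w\<in>P \<times> Q. v \<noteq> w \<longrightarrow> A v \<inter> A w = {}"
    proof (intro ballI impI, rule ccontr)
      fix v w assume "v \<noteq> w" "A v \<inter> A w \<noteq> {}"
      then show False by (auto simp: A_def split: prod.splits) (metis Sym_inj)+
    qed
  qed (use fin in \<open>auto simp: A_def split: prod.splits\<close>)
  also have "\<dots> = (\<Sum>w\<in>P \<times> Q. fact (n - 4))"
  proof (rule sum.cong[OF refl])
    fix w assume w: "w \<in> P \<times> Q"
    obtain p q s t where w': "w = ((p, q), (s, t))" by (metis prod.exhaust)
    have "card {\<pi> \<in> Sym n. \<pi> i = p \<and> \<pi> k = q \<and> \<pi> s = j \<and> \<pi> t = l} = fact (n - 4)"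
      by (rule card_Sym_4) (use w w' i j k l in \<open>auto simp: P_def Q_def\<close>)
    then show "card (A w) = fact (n - 4)" by (simp add: A_def w')
  qed
  finally have cA: "card (\<Union>w\<in>P \<times> Q. A w) = card P * card Q * fact (n - 4)" by (simp add: card_cartesian_product)
  have sub: "(\<Union>w\<in>P \<times> Q. A w) \<subseteq> {\<pi>\<in>Sym n. \<pi> \<in> bad} \<union> {\<pi>\<in>Sym n. R \<pi> \<in> bad} \<union> {\<pi>\<in>Sym n. L \<pi> \<in> bad} \<union> {\<pi>\<in>Sym n. R (L \<pi>) \<in> bad}"
  proof
    fix \<pi> assume "\<pi> \<in> (\<Union>w\<in>P \<times> Q. A w)"
    then obtain p q s t where pq: "(p, q) \<in> P" and st: "(s, t) \<in> Q" and S: "\<pi> \<in> Sym n"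
      and pi: "\<pi> i = p" "\<pi> k = q" "\<pi> s = j" "\<pi> t = l" by (auto simp: A_def)
    have st': "s \<in> I" "t \<in> I" "s \<noteq> t" "s \<noteq> i" "s \<noteq> k" "t \<noteq> i" "t \<noteq> k" using st by (auto simp: Q_def)
    \<comment> \<open>Exchanging the values \<open>j\<close> and \<open>l\<close> is exchanging the
      positions \<open>s\<close> and \<open>t\<close> that carry them, so \<open>lin_swap\<close>
      applies to both moves.\<close>
    have Leq: "L \<pi> = \<pi> \<circ> swp s t"
    proof
      fix x show "L \<pi> x = (\<pi> \<circ> swp s t) x"
        using pi Sym_inj[OF S, of x s] Sym_inj[OF S, of x t] by (auto simp: L_def Transposition.transpose_def)
    qed
    define h where "h \<pi> = m + lin n r \<pi>" for \<pi>
    define D E where "D = r i p - r i q" and "E = r s j - r t j"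
    have hL: "h (L \<pi>) = h \<pi> - E"
      unfolding Leq h_def using lin_swap[OF st'(1-3), of r \<pi>] st pi by (simp add: dd_def E_def Q_def)
    have hR: "h (R \<rho>) = h \<rho> - D" if "\<rho> i = p" "\<rho> k = q" for \<rho>
      unfolding R_def h_def using lin_swap[OF i k(1), of r \<rho>] k pq that by (simp add: dd_def D_def P_def)
    have "h (R \<pi>) = h \<pi> - D" "h (R (L \<pi>)) = h (L \<pi>) - D"
      using pi pq by (auto intro!: hR simp: L_def P_def Transposition.transpose_def)
    moreover have "D \<noteq> 0" "E \<noteq> 0" using pq st by (auto simp: P_def Q_def D_def E_def)
    \<comment> \<open>If \<open>h \<pi>\<close> and the values after one move are in
      \<open>{0, 1}\<close>, both moves go to the other value, so \<open>D = E\<close>; performing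
      both leads to - 1 or 2.\<close>
    ultimately have "h \<pi> \<notin> {0, 1} \<or> h (R \<pi>) \<notin> {0, 1} \<or> h (L \<pi>) \<notin> {0, 1} \<or> h (R (L \<pi>)) \<notin> {0, 1}"
      using hL by auto
    then show "\<pi> \<in> {\<pi>\<in>Sym n. \<pi> \<in> bad} \<union> {\<pi>\<in>Sym n. R \<pi> \<in> bad} \<union> {\<pi>\<in>Sym n. L \<pi> \<in> bad} \<union> {\<pi>\<in>Sym n. R (L \<pi>) \<in> bad}"
      using S Sym unfolding bad_def h_def by auto
  qed
  have "card (\<Union>w\<in>P \<times> Q. A w) \<le> card ({\<pi>\<in>Sym n. \<pi> \<in> bad} \<union> {\<pi>\<in>Sym n. R \<pi> \<in> bad} \<union> {\<pi>\<in>Sym n. L \<pi> \<in> bad} \<union> {\<pi>\<in>Sym n. R (L \<pi>) \<in> bad})"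
    by (rule card_mono[OF _ sub]) auto
  also have "\<dots> \<le> card {\<pi>\<in>Sym n. \<pi> \<in> bad} + card {\<pi>\<in>Sym n. R \<pi> \<in> bad} + card {\<pi>\<in>Sym n. L \<pi> \<in> bad} + card {\<pi>\<in>Sym n. R (L \<pi>) \<in> bad}"
    by (meson add_le_mono card_Un_le le_refl order_trans)
  also have "\<dots> \<le> card bad + card bad + card bad + card bad"
  proof (intro add_mono)
    show "card {\<pi>\<in>Sym n. \<pi> \<in> bad} \<le> card bad" by (intro card_mono) auto
    show "card {\<pi>\<in>Sym n. R \<pi> \<in> bad} \<le> card bad" "card {\<pi>\<in>Sym n. L \<pi> \<in> bad} \<le> card bad"
      by (rule card_le_of_inj_Sym[OF _ _ inj(1)] card_le_of_inj_Sym[OF _ _ inj(2)]; auto)+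
    have "inj_on (R \<circ> L) (Sym n)" by (intro comp_inj_on inj)
    then show "card {\<pi>\<in>Sym n. R (L \<pi>) \<in> bad} \<le> card bad"
      by (intro card_le_of_inj_Sym[of _ n bad "R \<circ> L"]) auto
  qed
  finally have "real (card P * card Q * fact (n - 4)) \<le> real (4 * card bad)"
    unfolding cA by (intro of_nat_mono) simp
  also have "\<dots> \<le> 4 * (\<eta> * fact n)" using card_bad_le by (simp add: bad_def)
  also have "\<dots> \<le> 1 / 2500 * fact n" using eta by simp
  also have "\<dots> \<le> 1 / 2500 * real (n ^ 4 * fact (n - 4))"
    using fact_real_le[of 4 n] n_large by (intro mult_left_mono) auto
  finally have "real (card P) * real (card Q) \<le> 1 / 2500 * real n ^ 4" by simp
  moreover have "real n ^ 2 * real n ^ 2 \<le> (48 * real (card P)) * (48 * real (card Q))"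
    using of_nat_mono[OF P, where ?'a = real] of_nat_mono[OF Q, where ?'a = real] by (intro mult_mono) auto
  moreover have "0 < real n ^ 4" using n_large by simp
  moreover have "real n ^ 2 * real n ^ 2 = real n ^ 4" by (simp flip: power_add)
  ultimately show False by linarith
qed

text \<open>One of the two lines has at most \<open>n / 24\<close> nonzero entries, the other at
  most \<open>5 * n / 6\<close>. The remaining eighth of the positions is the room for
  switching.\<close>

lemma cross_le:
  assumes "i \<in> I" "j \<in> I"
  shows "8 * card (Z i) + 8 * card (Y j) \<le> 7 * n"
proof -
  interpret T: near_boolean n m "\<lambda>i j. r j i" \<eta> by (rule transposed)
  have TZ: "T.Z = Y" by (simp add: T.Z_def[abs_def] Y_def[abs_def])
  show ?thesis
    using row_nonzero_le[OF assms(1)] T.row_nonzero_le[OF assms(2)] not_both_heavy[OF assms] unfolding TZ by (elim disjE) linarith+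
qed

section \<open>Permutations that avoid the support\<close>

definition "hits \<pi> = {i\<in>I. r i (\<pi> i) \<noteq> 0}"
definition "N t = {\<pi> \<in> Sym n. card (hits \<pi>) = t}"

lemma finite_hits [simp]: "finite (hits \<pi>)" unfolding hits_def by simp
lemma finite_N [simp]: "finite (N t)" unfolding N_def by simp

text \<open>Switching: a hit \<open>i\<close> of \<open>\<pi>\<close> is destroyed by \<open>\<pi> \<circ> swp i k\<close> for at least \<open>n / 16\<close> choices of \<open>k\<close>,
  while \<open>\<pi>\<close> is recovered from the result and the destroyed cell, of which there are at most \<open>64 * n\<close>.\<close>

lemma N_step:
  assumes t: "1 \<le> t" "t \<le> 128"
  shows "card (N t) \<le> 1024 * card (N (t - 1))"
proof -
  define ch where "ch \<pi> = (SOME i. i \<in> hits \<pi>)" for \<pi>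
  have ch: "ch \<pi> \<in> hits \<pi>" if "\<pi> \<in> N t" for \<pi>
  proof -
    have "hits \<pi> \<noteq> {}" using that t by (auto simp: N_def)
    then show ?thesis unfolding ch_def by (metis ex_in_conv someI_ex)
  qed
  \<comment> \<open>The two cells created by the swap lie outside the support and \<open>k\<close>
    was no hit, so exactly the hit \<open>ch \<pi>\<close> disappears.\<close>
  define G where "G \<pi> = {k\<in>I. k \<notin> hits \<pi> \<and> r (ch \<pi>) (\<pi> k) = 0 \<and> r k (\<pi> (ch \<pi>)) = 0}" for \<pi>
  have G: "n \<le> 16 * card (G \<pi>)" if p: "\<pi> \<in> N t" for \<pi>
  proof -
    have S: "\<pi> \<in> Sym n" and c: "card (hits \<pi>) = t" using p by (auto simp: N_def)
    let ?i = "ch \<pi>"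
    have i: "?i \<in> I" "\<pi> ?i \<in> I" using ch[OF p] Sym_in[OF S] by (auto simp: hits_def)
    let ?P = "{k\<in>I. r ?i (\<pi> k) \<noteq> 0}"
    have "\<pi> ` ?P \<subseteq> Z ?i" using Sym_in[OF S] by (auto simp: Z_def)
    then have "card ?P \<le> card (Z ?i)"
      by (intro card_inj_on_le[of \<pi>]) (auto intro: inj_onI simp: Sym_inj[OF S])
    have "I \<subseteq> G \<pi> \<union> hits \<pi> \<union> ?P \<union> Y (\<pi> ?i)" by (auto simp: G_def Y_def)
    then have "card I \<le> card (G \<pi> \<union> hits \<pi> \<union> ?P \<union> Y (\<pi> ?i))" by (rule card_mono[rotated]) (auto simp: G_def)
    also have "\<dots> \<le> card (G \<pi>) + card (hits \<pi>) + card ?P + card (Y (\<pi> ?i))"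
      by (meson add_le_mono card_Un_le le_refl order_trans)
    finally have "n \<le> card (G \<pi>) + 128 + (card (Z ?i) + card (Y (\<pi> ?i)))" using c t \<open>card ?P \<le> card (Z ?i)\<close> by simp
    then show ?thesis using cross_le[OF i] n_large by linarith
  qed
  define \<Phi> where "\<Phi> = (\<lambda>(\<pi>, k). (\<pi> \<circ> swp (ch \<pi>) k, (ch \<pi>, \<pi> (ch \<pi>))))"
  have "card (SIGMA \<pi>:N t. G \<pi>) \<le> card (N (t - 1) \<times> supp n r)"
  proof (rule card_inj_on_le[of \<Phi>])
    show "inj_on \<Phi> (SIGMA \<pi>:N t. G \<pi>)"
    proof (rule inj_onI, clarify)
      fix \<pi> k \<rho> l assume p: "\<pi> \<in> N t" "k \<in> G \<pi>" "\<rho> \<in> N t" "l \<in> G \<rho>" "\<Phi> (\<pi>, k) = \<Phi> (\<rho>, l)"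
      then have e: "\<pi> \<circ> swp (ch \<pi>) k = \<rho> \<circ> swp (ch \<pi>) l" "ch \<rho> = ch \<pi>" "\<pi> (ch \<pi>) = \<rho> (ch \<pi>)"
        by (auto simp: \<Phi>_def)
      have inj: "inj (\<pi> \<circ> swp (ch \<pi>) k)" using p by (intro inj_compose) (auto simp: N_def Sym_bij bij_is_inj)
      \<comment> \<open>The position \<open>k\<close> is recovered as the place to which the value
        of the destroyed cell has moved.\<close>
      have "(\<pi> \<circ> swp (ch \<pi>) k) k = \<pi> (ch \<pi>)" "(\<rho> \<circ> swp (ch \<pi>) l) l = \<rho> (ch \<pi>)" by simp_all
      then have "(\<pi> \<circ> swp (ch \<pi>) k) k = (\<rho> \<circ> swp (ch \<pi>) l) l" using e(3) by (simp only:)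
      then have "(\<pi> \<circ> swp (ch \<pi>) k) k = (\<pi> \<circ> swp (ch \<pi>) k) l" unfolding e(1) .
      then have kl: "k = l" by (rule injD[OF inj])
      have "\<pi> = (\<pi> \<circ> swp (ch \<pi>) k) \<circ> swp (ch \<pi>) k" by (simp add: fun_eq_iff)
      also have "\<dots> = \<rho>" unfolding e(1) unfolding kl by (simp add: fun_eq_iff)
      finally show "\<pi> = \<rho> \<and> k = l" using kl by simp
    qed
    show "\<Phi> ` (SIGMA \<pi>:N t. G \<pi>) \<subseteq> N (t - 1) \<times> supp n r"
    proof
      fix x assume "x \<in> \<Phi> ` (SIGMA \<pi>:N t. G \<pi>)"
      then obtain \<pi> k \<rho> i j where p: "\<pi> \<in> N t" "k \<in> G \<pi>" and x: "x = (\<rho>, i, j)"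
        and \<rho>: "\<rho> = \<pi> \<circ> swp i k" "i = ch \<pi>" "j = \<pi> i" by (auto simp: \<Phi>_def)
      have S: "\<pi> \<in> Sym n" using p by (simp add: N_def)
      have i: "i \<in> hits \<pi>" using ch[OF p(1)] \<rho> by simp
      then have iI: "i \<in> I" "r i (\<pi> i) \<noteq> 0" by (auto simp: hits_def)
      have k: "k \<in> I" "k \<noteq> i" "r k (\<pi> k) = 0" "r i (\<pi> k) = 0" "r k (\<pi> i) = 0"
        using p(2) i \<rho> by (auto simp: G_def hits_def)
      have "\<rho> \<in> Sym n" unfolding \<rho> by (intro Sym_compose S transpose_in_Sym) (use iI k \<rho> in auto)
      moreover have "hits \<rho> = hits \<pi> - {i}"
        unfolding hits_def \<rho>(1) using k iI by (auto simp: Transposition.transpose_def split: if_splits)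
      then have "card (hits \<rho>) = t - 1" using i p(1) by (simp add: N_def)
      ultimately show "x \<in> N (t - 1) \<times> supp n r"
        unfolding x using iI Sym_in[OF S, of i] \<rho>(3) by (auto simp: N_def supp_def)
    qed
  qed auto
  also have "\<dots> \<le> card (N (t - 1)) * (64 * n)"
    using card_supp_le by (simp add: card_cartesian_product)
  finally have le: "card (SIGMA \<pi>:N t. G \<pi>) \<le> card (N (t - 1)) * (64 * n)" .
  have "n * card (N t) = (\<Sum>\<pi>\<in>N t. n)" by simp
  also have "\<dots> \<le> (\<Sum>\<pi>\<in>N t. 16 * card (G \<pi>))" by (intro sum_mono G)
  also have "\<dots> = 16 * card (SIGMA \<pi>:N t. G \<pi>)"
    by (subst card_SigmaI) (auto simp: sum_distrib_left G_def)
  also have "\<dots> \<le> n * (1024 * card (N (t - 1)))" using le by (simp add: ac_simps)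
  finally show ?thesis using n_large by simp
qed

text \<open>Double counting of permutations with a marked hit; the mean number of hits is
  \<open>card (supp n r) / n\<close>, hence at most 64.\<close>

lemma sum_hits: "(\<Sum>\<pi>\<in>Sym n. card (hits \<pi>)) = card (supp n r) * fact (n - 1)"
proof -
  have "(\<Sum>\<pi>\<in>Sym n. card (hits \<pi>)) = card (SIGMA \<pi>:Sym n. hits \<pi>)" by simp
  also have "\<dots> = card (SIGMA (i, j):supp n r. {\<pi>\<in>Sym n. \<pi> i = j})"
    by (rule bij_betw_same_card[of "\<lambda>(\<pi>, i). ((i, \<pi> i), \<pi>)"],
        rule bij_betw_byWitness[where f' = "\<lambda>((i, j), \<pi>). (\<pi>, i)"])
      (auto simp: hits_def supp_def dest: Sym_in[THEN iffD2, of _ n, unfolded atLeastAtMost_iff])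
  also have "\<dots> = (\<Sum>(i, j)\<in>supp n r. card {\<pi>\<in>Sym n. \<pi> i = j})" by (subst card_SigmaI) (auto simp: case_prod_beta)
  also have "\<dots> = (\<Sum>(i, j)\<in>supp n r. fact (n - 1))"
    by (intro sum.cong refl) (auto simp: supp_def card_Sym_1[unfolded atLeastAtMost_iff])
  finally show ?thesis by simp
qed

end

text \<open>The proportion of permutations that avoid the support: half of them meet it at most \<open>128\<close>
  times, and each switching step costs a factor \<open>1024\<close>.\<close>

definition avoid_const :: real where "avoid_const = 1 / (258 * 1024 ^ 128)"

context near_boolean begin

text \<open>By Markov's inequality at most half of the permutations have 129 or more hits. The
  others are spread over 129 classes \<open>N t\<close>, each of size at most
  \<open>1024 ^ 128 * card (N 0)\<close>; this gives 258 = 2 * 129.\<close>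

lemma card_N0_ge: "avoid_const * fact n \<le> card (N 0)"
proof -
  have le: "card (N t) \<le> 1024 ^ 128 * card (N 0)" if "t \<le> 128" for t
  proof -
    have "t \<le> 128 \<Longrightarrow> card (N t) \<le> 1024 ^ t * card (N 0)"
    proof (induction t)
      case (Suc t)
      have "card (N (Suc t)) \<le> 1024 * card (N t)" using N_step[of "Suc t"] Suc.prems by simp
      also have "\<dots> \<le> 1024 * (1024 ^ t * card (N 0))" using Suc by (intro mult_left_mono) auto
      finally show ?case by simp
    qed simp
    also have "1024 ^ t * card (N 0) \<le> 1024 ^ 128 * card (N 0)"
      using that by (intro mult_right_mono power_increasing) auto
    finally show ?thesis using that by simp
  qed
  define Lg where "Lg = {\<pi>\<in>Sym n. 129 \<le> card (hits \<pi>)}"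
  have "129 * card Lg = (\<Sum>\<pi>\<in>Lg. 129)" by simp
  also have "\<dots> \<le> (\<Sum>\<pi>\<in>Lg. card (hits \<pi>))" by (intro sum_mono) (simp add: Lg_def)
  also have "\<dots> \<le> (\<Sum>\<pi>\<in>Sym n. card (hits \<pi>))" by (intro sum_mono2) (auto simp: Lg_def)
  also have "\<dots> \<le> 64 * n * fact (n - 1)" unfolding sum_hits by (intro mult_right_mono card_supp_le) simp
  also have "\<dots> = 64 * fact n" using n_large by (simp add: fact_reduce[of n])
  finally have Lg: "2 * card Lg \<le> fact n" by linarith
  have "Sym n \<subseteq> Lg \<union> (\<Union>t\<in>{..128}. N t)" by (auto simp: Lg_def N_def)
  then have "card (Sym n) \<le> card (Lg \<union> (\<Union>t\<in>{..128}. N t))" by (rule card_mono[rotated]) (auto simp: Lg_def)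
  also have "\<dots> \<le> card Lg + card (\<Union>t\<in>{..128}. N t)" by (rule card_Un_le)
  also have "card (\<Union>t\<in>{..128}. N t) \<le> (\<Sum>t\<in>{..128}. card (N t))" by (rule card_UN_le) simp
  also have "\<dots> \<le> (\<Sum>t\<in>{..128::nat}. 1024 ^ 128 * card (N 0))" by (intro sum_mono le) simp
  also have "\<dots> = 129 * (1024 ^ 128 * card (N 0))" by (simp only: sum_constant card_atMost of_nat_id) presburger
  finally have "fact n \<le> 258 * (1024 ^ 128 * card (N 0))" using Lg unfolding card_Sym by linarith
  then have "real (fact n) \<le> real (258 * (1024 ^ 128 * card (N 0)))" by (rule of_nat_mono)
  then have "fact n \<le> (258 * 1024 ^ 128) * real (card (N 0))" by (simp only: of_nat_fact of_nat_mult of_nat_power of_nat_numeral mult.assoc)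
  moreover have "(0 :: real) < 258 * 1024 ^ 128" by (intro mult_pos_pos zero_less_power) simp_all
  ultimately show ?thesis unfolding avoid_const_def by (simp only: mult_1_left times_divide_eq_left pos_divide_le_eq mult.commute[of "real (card _)"])
qed

end

lemma avoid_const_pos: "0 < avoid_const"
  unfolding avoid_const_def by (intro divide_pos_pos mult_pos_pos zero_less_power) simp_all

section \<open>Consequences for the constant and for the single coefficients\<close>

context near_boolean begin

lemma lin_hits: "lin n r \<pi> = (\<Sum>i\<in>hits \<pi>. r i (\<pi> i))"
  unfolding lin_def by (rule sum.mono_neutral_right) (auto simp: hits_def)

text \<open>The function equals the constant on \<open>N 0\<close>, which is too large to consist of
  bad permutations.\<close>

lemma m_cases:
  assumes "\<eta> < avoid_const"
  shows "m \<in> {0, 1}"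
proof (rule ccontr)
  assume m: "m \<notin> {0, 1}"
  have "N 0 \<subseteq> bad" using m by (auto simp: N_def bad_def lin_hits)
  then have "card (N 0) \<le> card bad" by (intro card_mono) auto
  then have "avoid_const * fact n \<le> \<eta> * fact n" using card_N0_ge card_bad_le unfolding bad_def by linarith
  then show False using assms by simp
qed

text \<open>The events \<open>plant i j\<close> are disjoint for distinct cells of the support, and \<open>lin n r\<close> equals
  \<open>r i j\<close> there. Hence a cell with a wrong coefficient costs its own share of the error.\<close>

definition "plant i j = {\<pi> \<in> Sym n. hits \<pi> = {i} \<and> \<pi> i = j}"

text \<open>In a permutation that avoids the support, exchange \<open>i\<close> with the position of
  the value \<open>j\<close>. This creates the cell \<open>(i, j)\<close> and one further cell;
  unless the latter lies in the support, the result is in \<open>plant i j\<close>. The original is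
  determined by the result and the second position, one of \<open>n\<close>.\<close>

lemma card_plant_ge:
  assumes ij: "(i, j) \<in> supp n r" and n: "128 / avoid_const + 1 \<le> n"
  shows "avoid_const / 2 * fact n \<le> real n * card (plant i j)"
proof -
  have i: "i \<in> I" and j: "j \<in> I" and rij: "r i j \<noteq> 0" using ij by (auto simp: supp_def)
  \<comment> \<open>The exceptions: the further cell lies in the support. Each such cell prescribes
    two values of \<pi>, so there are at most \<open>64 * n * fact (n - 2)\<close> of them; the
    bound on \<open>n\<close> makes this at most half of the lower bound for
    \<open>card (N 0)\<close>.\<close>
  define X where "X = {\<pi> \<in> N 0. r (inv \<pi> j) (\<pi> i) \<noteq> 0}"
  let ?S = "{(k, l)\<in>supp n r. k \<noteq> i \<and> l \<noteq> j}"
  have fS: "finite ?S" by (rule finite_subset[of _ "supp n r"]) auto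
  have N0: "\<pi> i \<noteq> j" "inv \<pi> j \<noteq> i" "\<pi> (inv \<pi> j) = j" "inv \<pi> j \<in> I" "\<pi> i \<in> I" "\<pi> \<in> Sym n" if "\<pi> \<in> N 0" for \<pi>
  proof -
    show S: "\<pi> \<in> Sym n" using that by (simp add: N_def)
    show "\<pi> i \<noteq> j" using that rij i by (auto simp: N_def hits_def)
    then show "inv \<pi> j \<noteq> i" using Sym_inv_eq[OF S] by auto
    show "\<pi> (inv \<pi> j) = j" using Sym_inv_eq[OF S] by blast
    show "inv \<pi> j \<in> I" using Sym_in[OF Sym_inv[OF S]] j by blast
    show "\<pi> i \<in> I" using Sym_in[OF S] i by blast
  qed
  have "X \<subseteq> (\<Union>(k, l)\<in>?S. {\<pi> \<in> Sym n. \<pi> k = j \<and> \<pi> i = l})"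
  proof
    fix \<pi> assume p: "\<pi> \<in> X"
    then have "\<pi> \<in> N 0" "r (inv \<pi> j) (\<pi> i) \<noteq> 0" by (auto simp: X_def)
    then have "(inv \<pi> j, \<pi> i) \<in> ?S" using N0[of \<pi>] by (auto simp: supp_def)
    then show "\<pi> \<in> (\<Union>(k, l)\<in>?S. {\<pi> \<in> Sym n. \<pi> k = j \<and> \<pi> i = l})"
      using N0[OF \<open>\<pi> \<in> N 0\<close>] by (intro UN_I[of "(inv \<pi> j, \<pi> i)"]) auto
  qed
  then have "card X \<le> card (\<Union>(k, l)\<in>?S. {\<pi> \<in> Sym n. \<pi> k = j \<and> \<pi> i = l})"
    by (rule card_mono[rotated]) (use fS in auto)
  also have "\<dots> \<le> (\<Sum>(k, l)\<in>?S. card {\<pi> \<in> Sym n. \<pi> k = j \<and> \<pi> i = l})"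
    using card_UN_le[OF fS, of "\<lambda>(k, l). {\<pi> \<in> Sym n. \<pi> k = j \<and> \<pi> i = l}"] by (simp add: case_prod_beta)
  also have "\<dots> = (\<Sum>(k, l)\<in>?S. fact (n - 2))"
  proof (intro sum.cong refl)
    fix x assume "x \<in> ?S"
    then obtain k l where "x = (k, l)" "k \<in> I" "l \<in> I" "k \<noteq> i" "l \<noteq> j" by (auto simp: supp_def)
    then show "(case x of (k, l) \<Rightarrow> card {\<pi> \<in> Sym n. \<pi> k = j \<and> \<pi> i = l}) = (case x of (k, l) \<Rightarrow> fact (n - 2))"
      using card_Sym_2[of k n i j l] i j by simp
  qed
  also have "\<dots> = card ?S * fact (n - 2)" by simp
  also have "\<dots> \<le> (64 * n) * fact (n - 2)"
  proof -
    have "card ?S \<le> card (supp n r)" by (intro card_mono) auto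
    then show ?thesis using card_supp_le by (intro mult_right_mono) auto
  qed
  finally have "real (card X) \<le> real ((64 * n) * fact (n - 2))" by (rule of_nat_mono)
  also have "\<dots> = 64 * real n * fact (n - 2)" by simp
  also have "\<dots> \<le> (avoid_const / 2 * (real n - 1)) * real n * fact (n - 2)"
    using n avoid_const_pos by (intro mult_right_mono) (auto simp: field_simps)
  also have "\<dots> = avoid_const / 2 * fact n" using fact_reduce_2[of n] n_large by simp
  finally have X: "real (card X) \<le> avoid_const / 2 * fact n" .
  define \<Phi> where "\<Phi> \<pi> = (\<pi> \<circ> swp i (inv \<pi> j), inv \<pi> j)" for \<pi>
  have "card (N 0 - X) \<le> card (plant i j \<times> I)"
  proof (rule card_inj_on_le[of \<Phi>])
    show "inj_on \<Phi> (N 0 - X)"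
    proof (rule inj_on_inverseI)
      fix \<pi> show "(\<lambda>(\<rho>, k). \<rho> \<circ> swp i k) (\<Phi> \<pi>) = \<pi>" by (simp add: \<Phi>_def fun_eq_iff)
    qed
    show "\<Phi> ` (N 0 - X) \<subseteq> plant i j \<times> I"
    proof
      fix x assume "x \<in> \<Phi> ` (N 0 - X)"
      then obtain \<pi> where p: "\<pi> \<in> N 0" "\<pi> \<notin> X" and x: "x = (\<pi> \<circ> swp i (inv \<pi> j), inv \<pi> j)" by (auto simp: \<Phi>_def)
      define k where "k = inv \<pi> j"
      note N = N0[OF p(1), folded k_def]
      have rk: "r k (\<pi> i) = 0" using p by (simp add: X_def k_def)
      have r0: "r x (\<pi> x) = 0" if "x \<in> I" for x using p(1) that by (auto simp: N_def hits_def)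
      have "hits (\<pi> \<circ> swp i k) = {i}"
        unfolding hits_def using N rk r0 rij i by (auto simp: Transposition.transpose_def split: if_splits)
      moreover have "\<pi> \<circ> swp i k \<in> Sym n" using N i by (intro Sym_compose transpose_in_Sym)
      moreover have "(\<pi> \<circ> swp i k) i = j" using N by simp
      ultimately show "x \<in> plant i j \<times> I" unfolding x k_def[symmetric] plant_def using N by simp
    qed
  qed (simp add: plant_def)
  also have "\<dots> = n * card (plant i j)" by (simp add: card_cartesian_product)
  finally have "card (N 0) - card X \<le> n * card (plant i j)"
    using diff_card_le_card_Diff[of X "N 0"] by (simp add: X_def)
  then have "card (N 0) \<le> card X + n * card (plant i j)" by linarith
  then have "real (card (N 0)) \<le> real (card X) + real n * card (plant i j)"
    using of_nat_mono[of "card (N 0)" "card X + n * card (plant i j)", where ?'a = real] by simp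
  then show ?thesis using X card_N0_ge by linarith
qed

lemma sum_supp_dist01_le:
  assumes n: "128 / avoid_const + 1 \<le> n" and \<delta>: "expect n (\<lambda>\<pi>. (dist01 (of_int (m + lin n r \<pi>)))\<^sup>2) \<le> \<delta>"
  shows "(\<Sum>(i, j)\<in>supp n r. (dist01 (of_int (m + r i j)))\<^sup>2) \<le> 2 / avoid_const * \<delta> * n"
proof -
  let ?d = "\<lambda>\<pi>. (dist01 (of_int (m + lin n r \<pi>)))\<^sup>2"
  have "avoid_const / 2 * fact n * (\<Sum>(i, j)\<in>supp n r. (dist01 (of_int (m + r i j)))\<^sup>2)
     = (\<Sum>(i, j)\<in>supp n r. avoid_const / 2 * fact n * (dist01 (of_int (m + r i j)))\<^sup>2)"
    by (simp add: sum_distrib_left case_prod_beta)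
  also have "\<dots> \<le> (\<Sum>(i, j)\<in>supp n r. real n * card (plant i j) * (dist01 (of_int (m + r i j)))\<^sup>2)"
  proof (rule sum_mono)
    fix x assume "x \<in> supp n r"
    then show "(case x of (i, j) \<Rightarrow> avoid_const / 2 * fact n * (dist01 (of_int (m + r i j)))\<^sup>2)
       \<le> (case x of (i, j) \<Rightarrow> real n * card (plant i j) * (dist01 (of_int (m + r i j)))\<^sup>2)"
    proof (cases x)
      case (Pair i j)
      then have "avoid_const / 2 * fact n \<le> real n * card (plant i j)" using \<open>x \<in> supp n r\<close> n by (intro card_plant_ge) auto
      then show ?thesis unfolding Pair prod.case by (rule mult_right_mono) simp
    qed
  qed
  also have "\<dots> = (\<Sum>(i, j)\<in>supp n r. real n * (\<Sum>\<pi>\<in>plant i j. ?d \<pi>))"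
  proof (rule sum.cong[OF refl])
    fix x assume "x \<in> supp n r"
    obtain i j where x: "x = (i, j)" by (cases x)
    have "(\<Sum>\<pi>\<in>plant i j. ?d \<pi>) = (\<Sum>\<pi>\<in>plant i j. (dist01 (of_int (m + r i j)))\<^sup>2)"
      by (rule sum.cong) (auto simp: plant_def lin_hits)
    then show "(case x of (i, j) \<Rightarrow> real n * card (plant i j) * (dist01 (of_int (m + r i j)))\<^sup>2)
      = (case x of (i, j) \<Rightarrow> real n * (\<Sum>\<pi>\<in>plant i j. ?d \<pi>))" unfolding x by simp
  qed
  also have "\<dots> = real n * (\<Sum>(i, j)\<in>supp n r. \<Sum>\<pi>\<in>plant i j. ?d \<pi>)"
    by (simp add: sum_distrib_left case_prod_beta)
  also have "(\<Sum>(i, j)\<in>supp n r. \<Sum>\<pi>\<in>plant i j. ?d \<pi>) = (\<Sum>\<pi>\<in>(\<Union>(i, j)\<in>supp n r. plant i j). ?d \<pi>)"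
    by (subst sum.UNION_disjoint) (auto simp: plant_def case_prod_beta)
  also have "\<dots> \<le> (\<Sum>\<pi>\<in>Sym n. ?d \<pi>)" by (rule sum_mono2) (auto simp: plant_def)
  also have "\<dots> \<le> \<delta> * fact n" using \<delta> by (simp add: expect_eq pos_divide_le_eq)
  finally have "avoid_const / 2 * fact n * (\<Sum>(i, j)\<in>supp n r. (dist01 (of_int (m + r i j)))\<^sup>2) \<le> real n * (\<delta> * fact n)"
    by (simp add: mult_left_mono)
  then have "avoid_const / 2 * (\<Sum>(i, j)\<in>supp n r. (dist01 (of_int (m + r i j)))\<^sup>2) * fact n \<le> real n * \<delta> * fact n"
    by (simp add: mult_ac)
  then have "avoid_const / 2 * (\<Sum>(i, j)\<in>supp n r. (dist01 (of_int (m + r i j)))\<^sup>2) \<le> real n * \<delta>"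
    by (rule mult_right_le_imp_le) simp
  then show ?thesis using avoid_const_pos by (simp add: field_simps)
qed

end

section \<open>From an arbitrary representation to one with minimal support\<close>

definition represents :: "nat \<Rightarrow> ((nat \<Rightarrow> nat) \<Rightarrow> int) \<Rightarrow> int \<times> (nat \<Rightarrow> nat \<Rightarrow> int) \<Rightarrow> bool" where
  "represents n h = (\<lambda>(m, r). \<forall>\<pi>\<in>Sym n. h \<pi> = m + lin n r \<pi>)"

text \<open>Shifting a row by a constant only moves that constant into \<open>m\<close>, so zero is a most frequent
  value of every row of a representation with minimal support.\<close>

lemma minimal_row_mode:
  assumes rep: "represents n h (m, r)" and min: "\<And>m' r'. represents n h (m', r') \<Longrightarrow> card (supp n r) \<le> card (supp n r')"
    and i: "i \<in> {1..n}"
  shows "card {j\<in>{1..n}. r i j = v} \<le> card {j\<in>{1..n}. r i j = 0}"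
proof (rule ccontr)
  assume no: "\<not> ?thesis"
  let ?I = "{1..n}"
  define r' where "r' = r(i := \<lambda>j. r i j - v)"
  have "lin n r' \<pi> = lin n r \<pi> - v" for \<pi>
  proof -
    have "lin n r' \<pi> = (\<Sum>x\<in>?I. r x (\<pi> x) - (if x = i then v else 0))"
      unfolding lin_def r'_def by (rule sum.cong) auto
    then show ?thesis using i by (simp add: lin_def sum_subtractf)
  qed
  then have "represents n h (m + v, r')" using rep by (simp add: represents_def)
  then have "card (supp n r) \<le> card (supp n r')" by (rule min)
  then have "card {j\<in>?I. r i j \<noteq> 0} + (\<Sum>x\<in>?I - {i}. card {j\<in>?I. r x j \<noteq> 0})
      \<le> card {j\<in>?I. r' i j \<noteq> 0} + (\<Sum>x\<in>?I - {i}. card {j\<in>?I. r' x j \<noteq> 0})"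
    unfolding card_supp sum.remove[OF finite_atLeastAtMost i] .
  moreover have "(\<Sum>x\<in>?I - {i}. card {j\<in>?I. r' x j \<noteq> 0}) = (\<Sum>x\<in>?I - {i}. card {j\<in>?I. r x j \<noteq> 0})"
    by (rule sum.cong) (auto simp: r'_def)
  moreover have "card {j\<in>?I. r' i j \<noteq> 0} = card {j\<in>?I. r i j \<noteq> v}" by (simp add: r'_def)
  moreover have "card {j\<in>?I. r i j = w} + card {j\<in>?I. r i j \<noteq> w} = n" for w
  proof -
    have "card ({j\<in>?I. r i j = w} \<union> {j\<in>?I. r i j \<noteq> w}) = card {j\<in>?I. r i j = w} + card {j\<in>?I. r i j \<noteq> w}"
      by (rule card_Un_disjoint) auto
    moreover have "{j\<in>?I. r i j = w} \<union> {j\<in>?I. r i j \<noteq> w} = ?I" by auto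
    ultimately show ?thesis by simp
  qed
  from this[of 0] this[of v] calculation no show False by linarith
qed

text \<open>Used to derive the mode condition for columns from the one for rows, since transposing
  also preserves the size of the support.\<close>

lemma represents_transpose:
  "represents n (\<lambda>\<pi>. h (inv \<pi>)) (m, \<lambda>i j. r j i) \<longleftrightarrow> represents n h (m, r)"
proof
  assume a: "represents n (\<lambda>\<pi>. h (inv \<pi>)) (m, \<lambda>i j. r j i)"
  show "represents n h (m, r)"
    unfolding represents_def
  proof clarify
    fix \<pi> assume p: "\<pi> \<in> Sym n"
    have "h (inv (inv \<pi>)) = m + lin n (\<lambda>i j. r j i) (inv \<pi>)" using a Sym_inv[OF p] by (simp add: represents_def)
    then show "h \<pi> = m + lin n r \<pi>" using lin_transpose[OF p] by (simp add: inv_inv_eq Sym_bij[OF p])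
  qed
next
  assume a: "represents n h (m, r)"
  show "represents n (\<lambda>\<pi>. h (inv \<pi>)) (m, \<lambda>i j. r j i)"
    unfolding represents_def
  proof clarify
    fix \<pi> assume p: "\<pi> \<in> Sym n"
    have "h (inv \<pi>) = m + lin n r (inv \<pi>)" using a Sym_inv[OF p] by (simp add: represents_def)
    then show "h (inv \<pi>) = m + lin n (\<lambda>i j. r j i) \<pi>" using lin_transpose[OF p, of "\<lambda>i j. r j i"] by simp
  qed
qed

lemma dist01_of_int_ge:
  assumes "z \<notin> {0, 1}"
  shows "(real_of_int z)\<^sup>2 \<le> 4 * (dist01 (of_int z))\<^sup>2" "1 \<le> (dist01 (of_int z))\<^sup>2"
proof -
  have "z \<le> - 1 \<or> 2 \<le> z" using assms by auto
  then have z: "real_of_int z \<le> - 1 \<or> 2 \<le> real_of_int z" by linarith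
  then have 1: "\<bar>real_of_int z\<bar> \<le> \<bar>2 * dist01 (of_int z)\<bar>" and 2: "1 \<le> dist01 (of_int z)" unfolding dist01_def by (auto simp: min_def)
  show "(real_of_int z)\<^sup>2 \<le> 4 * (dist01 (of_int z))\<^sup>2" using 1[unfolded abs_le_square_iff] by (simp add: power_mult_distrib)
  show "1 \<le> (dist01 (of_int z))\<^sup>2" using 2 by (rule one_le_power)
qed

lemma dist01_one_minus: "dist01 (1 - x) = dist01 x"
  by (simp add: dist01_def min.commute abs_minus_commute)

text \<open>In the minimal representation, \<open>r'\<close> is \<open>r1\<close> or
  \<open>- r1\<close> according to \<open>m1\<close>, so the cost of a planted cell is the squared
  distance of \<open>r' i j\<close> from \<open>{0, 1}\<close>. For integers other than 0 and 1 this
  distance is at least half the absolute value, hence 8 = 4 * 2. Squares are summed instead of cells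
  counted because nothing bounds the size of the coefficients.\<close>

lemma large_structure:
  assumes n: "n \<ge> 50000" "128 / avoid_const + 1 \<le> n" and supp: "card (supp n r) \<le> 64 * n"
    and \<delta>: "expect n (\<lambda>\<pi>. (dist01 (of_int (m + lin n r \<pi>)))\<^sup>2) \<le> \<delta>" "\<delta> \<le> 1 / 10000" "\<delta> < avoid_const"
  shows "\<exists>r'. card (supp n r') \<le> 64 * n \<and>
    ((\<forall>\<pi>\<in>Sym n. m + lin n r \<pi> = lin n r' \<pi>) \<or> (\<forall>\<pi>\<in>Sym n. m + lin n r \<pi> = 1 - lin n r' \<pi>)) \<and>
    (\<Sum>(i, j)\<in>{(i, j)\<in>supp n r'. r' i j \<noteq> 1}. (real_of_int (r' i j))\<^sup>2) \<le> 8 / avoid_const * \<delta> * n"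
proof -
  define h where "h \<pi> = m + lin n r \<pi>" for \<pi>
  have "represents n h (m, r)" by (simp add: represents_def h_def)
  then obtain x where x: "represents n h x" and minx: "\<And>y. represents n h y \<Longrightarrow> card (supp n (snd x)) \<le> card (supp n (snd y))"
    using ex_has_least_nat[of "represents n h" "(m, r)" "\<lambda>x. card (supp n (snd x))"] by blast
  obtain m1 r1 where x': "x = (m1, r1)" by (cases x)
  note rep = x[unfolded x']
  have min: "card (supp n r1) \<le> card (supp n r')" if "represents n h (m', r')" for m' r'
    using minx[OF that] by (simp add: x')
  have h: "h \<pi> = m1 + lin n r1 \<pi>" if "\<pi> \<in> Sym n" for \<pi> using rep that by (simp add: represents_def)
  have \<delta>': "expect n (\<lambda>\<pi>. (dist01 (of_int (m1 + lin n r1 \<pi>)))\<^sup>2) \<le> \<delta>"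
  proof -
    have "expect n (\<lambda>\<pi>. (dist01 (of_int (m1 + lin n r1 \<pi>)))\<^sup>2) = expect n (\<lambda>\<pi>. (dist01 (of_int (m + lin n r \<pi>)))\<^sup>2)"
      by (rule expect_cong) (simp add: h[unfolded h_def] del: of_int_add)
    then show ?thesis using \<delta>(1) by simp
  qed
  interpret near_boolean n m1 r1 \<delta>
  proof
    show "card (supp n r1) \<le> 64 * n" using min[of m r] supp by (simp add: represents_def h_def)
    let ?B = "{\<pi> \<in> Sym n. m1 + lin n r1 \<pi> \<notin> {0, 1}}"
    have "real (card ?B) = (\<Sum>\<pi>\<in>?B. 1)" by simp
    also have "\<dots> \<le> (\<Sum>\<pi>\<in>?B. (dist01 (of_int (m1 + lin n r1 \<pi>)))\<^sup>2)"
      by (intro sum_mono dist01_of_int_ge(2)) simp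
    also have "\<dots> \<le> (\<Sum>\<pi>\<in>Sym n. (dist01 (of_int (m1 + lin n r1 \<pi>)))\<^sup>2)" by (rule sum_mono2) auto
    also have "\<dots> \<le> \<delta> * fact n" using \<delta>' by (simp add: expect_eq pos_divide_le_eq)
    finally show "real (card ?B) \<le> \<delta> * fact n" .
    show "card {j\<in>{1..n}. r1 i j = v} \<le> card {j\<in>{1..n}. r1 i j = 0}" if "i \<in> {1..n}" for i v
      by (rule minimal_row_mode[OF rep min that])
    show "card {i\<in>{1..n}. r1 i j = v} \<le> card {i\<in>{1..n}. r1 i j = 0}" if "j \<in> {1..n}" for j v
    proof (rule minimal_row_mode[of n "\<lambda>\<pi>. h (inv \<pi>)" m1 "\<lambda>i j. r1 j i"])
      show "represents n (\<lambda>\<pi>. h (inv \<pi>)) (m1, \<lambda>i j. r1 j i)" using rep by (subst represents_transpose)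
      fix m' r' assume a: "represents n (\<lambda>\<pi>. h (inv \<pi>)) (m', r')"
      then have "represents n h (m', \<lambda>i j. r' j i)"
        using represents_transpose[of n h m' "\<lambda>i j. r' j i"] by simp
      from min[OF this] show "card (supp n (\<lambda>i j. r1 j i)) \<le> card (supp n r')"
        using card_supp_transpose[of n r1] card_supp_transpose[of n r'] by simp
    qed (rule that)
  qed (use n \<delta> in auto)
  have sum: "(\<Sum>(i, j)\<in>supp n r1. (dist01 (of_int (m1 + r1 i j)))\<^sup>2) \<le> 2 / avoid_const * \<delta> * n"
    by (rule sum_supp_dist01_le[OF n(2) \<delta>'])
  have main: "(\<Sum>(i, j)\<in>{(i, j)\<in>supp n r'. r' i j \<noteq> 1}. (real_of_int (r' i j))\<^sup>2) \<le> 8 / avoid_const * \<delta> * n"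
    if r': "supp n r' = supp n r1" "\<And>i j. dist01 (of_int (r' i j)) = dist01 (of_int (m1 + r1 i j))" for r'
  proof -
    have "(\<Sum>(i, j)\<in>{(i, j)\<in>supp n r'. r' i j \<noteq> 1}. (real_of_int (r' i j))\<^sup>2)
       \<le> (\<Sum>(i, j)\<in>{(i, j)\<in>supp n r'. r' i j \<noteq> 1}. 4 * (dist01 (of_int (r' i j)))\<^sup>2)"
      by (rule sum_mono) (auto simp: supp_def intro!: dist01_of_int_ge)
    also have "\<dots> \<le> (\<Sum>(i, j)\<in>supp n r'. 4 * (dist01 (of_int (r' i j)))\<^sup>2)" by (rule sum_mono2) auto
    also have "\<dots> = 4 * (\<Sum>(i, j)\<in>supp n r1. (dist01 (of_int (m1 + r1 i j)))\<^sup>2)"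
      by (simp add: r' sum_distrib_left case_prod_beta)
    also have "\<dots> \<le> 4 * (2 / avoid_const * \<delta> * n)" by (intro mult_left_mono sum) simp
    finally show ?thesis by simp
  qed
  have "m1 \<in> {0, 1}" by (rule m_cases) (rule \<delta>(3))
  then consider "m1 = 0" | "m1 = 1" by auto
  then show ?thesis
  proof cases
    case 1
    then show ?thesis using card_supp_le main[of r1] h by (intro exI[of _ r1]) (auto simp: h_def)
  next
    case 2
    have s: "supp n (\<lambda>i j. - r1 i j) = supp n r1" by (simp add: supp_def)
    have l: "lin n (\<lambda>i j. - r1 i j) \<pi> = - lin n r1 \<pi>" for \<pi> by (simp add: lin_def sum_negf)
    have "dist01 (of_int (- r1 i j)) = dist01 (of_int (m1 + r1 i j))" for i j
      using dist01_one_minus[of "of_int (- r1 i j)"] 2 by simp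
    from main[OF s this] show ?thesis using card_supp_le h 2 s l
      by (intro exI[of _ "\<lambda>i j. - r1 i j"]) (auto simp: h_def)
  qed
qed

subsection \<open>Exactly Boolean linear functions\<close>

lemma lin_moved:
  fixes w :: "nat \<Rightarrow> nat \<Rightarrow> int"
  assumes "\<And>i. i \<in> {1..n} \<Longrightarrow> w i i = 0" "A \<subseteq> {1..n}" "\<And>i. i \<notin> A \<Longrightarrow> \<sigma> i = i"
  shows "lin n w \<sigma> = (\<Sum>i\<in>A. w i (\<sigma> i))"
  unfolding lin_def using assms by (intro sum.mono_neutral_right) auto

text \<open>Weights of a complete digraph, seen from a base permutation moved to the identity:
  \<open>lin n w \<sigma>\<close> is the total weight of the cycles of \<sigma>, with loops free.
  Every cycle thus has weight 0 or 1, and weights without negative cycles should become nonnegative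
  after adding a potential.\<close>

locale boolean_weights =
  fixes n :: nat and w :: "nat \<Rightarrow> nat \<Rightarrow> int"
  assumes diag: "\<And>i. i \<in> {1..n} \<Longrightarrow> w i i = 0"
    and bool: "\<And>\<sigma>. \<sigma> \<in> Sym n \<Longrightarrow> lin n w \<sigma> \<in> {0, 1}"
begin

lemma cycle2:
  assumes "{a, b} \<subseteq> {1..n}" "distinct [a, b]"
  shows "w a b + w b a \<in> {0, 1}"
proof -
  let ?\<sigma> = "swp a b"
  have "?\<sigma> \<in> Sym n" using assms by (intro Sym_compose transpose_in_Sym) auto
  moreover have "lin n w ?\<sigma> = (\<Sum>i\<in>{a, b}. w i (?\<sigma> i))"
    using assms by (intro lin_moved diag) auto
  ultimately show ?thesis using bool[of ?\<sigma>] assms by (simp add: add_ac transpose_apply_other)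
qed

lemma cycle3:
  assumes "{a, b, c} \<subseteq> {1..n}" "distinct [a, b, c]"
  shows "w a b + w b c + w c a \<in> {0, 1}"
proof -
  let ?\<sigma> = "swp a b \<circ> swp b c"
  have "?\<sigma> \<in> Sym n" using assms by (intro Sym_compose transpose_in_Sym) auto
  moreover have "lin n w ?\<sigma> = (\<Sum>i\<in>{a, b, c}. w i (?\<sigma> i))"
    using assms by (intro lin_moved diag) auto
  moreover have "?\<sigma> a = b" "?\<sigma> b = c" "?\<sigma> c = a"
    using assms(2) by (auto simp: transpose_apply_other)
  ultimately show ?thesis using bool[of ?\<sigma>] assms by (simp add: add_ac del: comp_apply)
qed

lemma cycle4:
  assumes "{a, b, c, d} \<subseteq> {1..n}" "distinct [a, b, c, d]"
  shows "w a b + w b c + w c d + w d a \<in> {0, 1}"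
proof -
  let ?\<sigma> = "swp a b \<circ> swp b c \<circ> swp c d"
  have "?\<sigma> \<in> Sym n" using assms by (intro Sym_compose transpose_in_Sym) auto
  moreover have "lin n w ?\<sigma> = (\<Sum>i\<in>{a, b, c, d}. w i (?\<sigma> i))"
    using assms by (intro lin_moved diag) auto
  moreover have "?\<sigma> a = b" "?\<sigma> b = c" "?\<sigma> c = d" "?\<sigma> d = a"
    using assms(2) by (auto simp: transpose_apply_other)
  ultimately show ?thesis using bool[of ?\<sigma>] assms by (simp add: add_ac del: comp_apply)
qed

lemma cycle5:
  assumes "{a, b, c, d, e} \<subseteq> {1..n}" "distinct [a, b, c, d, e]"
  shows "w a b + w b c + w c d + w d e + w e a \<in> {0, 1}"
proof -
  let ?\<sigma> = "swp a b \<circ> swp b c \<circ> swp c d \<circ> swp d e"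
  have "?\<sigma> \<in> Sym n" using assms by (intro Sym_compose transpose_in_Sym) auto
  moreover have "lin n w ?\<sigma> = (\<Sum>i\<in>{a, b, c, d, e}. w i (?\<sigma> i))"
    using assms by (intro lin_moved diag) auto
  moreover have "?\<sigma> a = b" "?\<sigma> b = c" "?\<sigma> c = d" "?\<sigma> d = e" "?\<sigma> e = a"
    using assms(2) by (auto simp: transpose_apply_other)
  ultimately show ?thesis using bool[of ?\<sigma>] assms by (simp add: add_ac del: comp_apply)
qed

text \<open>Vertices \<open>k\<close> with \<open>w k 1 = 1\<close> are the only possible ends of a negative edge. If there is such
  an edge, the potential that is \<open>- 1\<close> exactly on them works; cycles through \<open>1\<close> and the
  negative edge exclude all violations.\<close>

lemma nonneg_potential_based:
  assumes base: "\<And>k. k \<in> {1..n} \<Longrightarrow> w 1 k = 0"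
  shows "\<exists>v. \<forall>i\<in>{1..n}. \<forall>k\<in>{1..n}. 0 \<le> w i k + v i - v k"
proof (cases "\<exists>j\<in>{1..n}. \<exists>l\<in>{1..n}. w j l < 0")
  case False
  then show ?thesis by (intro exI[of _ "\<lambda>_. 0"]) force
next
  case True
  then obtain j l where jl: "j \<in> {1..n}" "l \<in> {1..n}" "w j l < 0" by blast
  then have one: "1 \<in> {1..n}" by auto
  define Q where "Q = {k\<in>{1..n}. w k 1 = 1}"
  have Q: "w k 1 = (if k \<in> Q then 1 else 0)" if "k \<in> {1..n}" for k
    using cycle2[of 1 k] that base[of k] diag[OF one] one by (cases "k = 1") (auto simp: Q_def)
  have tri: "w i k + w k 1 \<in> {0, 1}" if "i \<in> {1..n}" "k \<in> {1..n}" "i \<noteq> 1" "k \<noteq> 1" "i \<noteq> k" for i k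
    using cycle3[of 1 i k] that one base[of i] by auto
  have oneQ: "1 \<notin> Q" using diag[OF one] by (simp add: Q_def)
  have inQ: "w i k \<in> {- 1, 0}" if "i \<in> {1..n}" "k \<in> Q" "i \<noteq> k" for i k
  proof (cases "i = 1")
    case True
    then show ?thesis using base that by (auto simp: Q_def)
  next
    case False
    moreover have "k \<noteq> 1" using that oneQ by auto
    ultimately show ?thesis using tri[of i k] that by (auto simp: Q_def)
  qed
  have notQ: "w i k \<in> {0, 1}" if "i \<in> {1..n}" "k \<in> {1..n}" "k \<notin> Q" for i k
  proof (cases "i = 1 \<or> k = 1 \<or> i = k")
    case True
    then show ?thesis using base[of k] Q[of i] diag[of i] that by auto
  next
    case False
    then show ?thesis using tri[of i k] Q[of k] that by auto
  qed
  have neg: "k \<in> Q" "i \<notin> Q" if "i \<in> {1..n}" "k \<in> {1..n}" "w i k < 0" for i k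
  proof -
    show k: "k \<in> Q" using notQ[of i k] that by auto
    have "i \<noteq> k" using diag that by auto
    then have "0 < w k i" using cycle2[of i k] that inQ[of i k] k by auto
    then show "i \<notin> Q" using inQ[of k i] \<open>i \<noteq> k\<close> that by auto
  qed
  have jl': "l \<in> Q" "j \<notin> Q" "w j l = - 1" "j \<noteq> l" using neg[OF jl] inQ[of j l] jl by auto
  have l1: "w l 1 = 1" "l \<noteq> 1" "j \<noteq> 1" using jl' oneQ jl base[of l] by (auto simp: Q_def)
  have up: "w i k = 1" if i: "i \<in> Q" and k: "k \<in> {1..n}" "k \<notin> Q" for i k
  proof (rule ccontr)
    assume "w i k \<noteq> 1"
    have iI: "i \<in> {1..n}" "i \<noteq> 1" "i \<noteq> j" "i \<noteq> k" "w i 1 = 1" using i jl' oneQ k by (auto simp: Q_def)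
    have 0: "w i k = 0" using notQ[OF iI(1) k] \<open>w i k \<noteq> 1\<close> by simp
    have k1: "k \<noteq> 1" "w k 1 = 0" "k \<noteq> l" using 0 iI Q[OF k(1)] k jl' by auto
    have wl: "i \<noteq> l \<Longrightarrow> w l i \<le> 0" using inQ[of l i] i jl by auto
    \<comment> \<open>In each case the edges from \<open>j\<close> to \<open>l\<close> and from
      \<open>i\<close> to \<open>k\<close> are completed to a cycle of negative weight, through 1
      unless \<open>k = j\<close>; the coincidences \<open>i = l\<close> and \<open>k = j\<close>
      shorten it.\<close>
    consider "i = l" "k = j" | "i = l" "k \<noteq> j" | "i \<noteq> l" "k = j" | "i \<noteq> l" "k \<noteq> j" by blast
    then show False
    proof cases
      case 1
      then show False using cycle2[of j l] jl jl' 0 by auto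
    next
      case 2
      then show False using cycle4[of 1 j l k] jl jl' 0 k k1 l1 one base[of j] by auto
    next
      case 3
      then show False using cycle3[of j l i] jl jl' 0 iI wl by auto
    next
      case 4
      then show False using cycle5[of 1 j l i k] jl jl' 0 iI k k1 l1 one base[of j] wl by auto
    qed
  qed
  show ?thesis
  proof (intro exI[of _ "\<lambda>k. if k \<in> Q then - 1 else 0"] ballI)
    fix i k assume ik: "i \<in> {1..n}" "k \<in> {1..n}"
    have "i \<in> Q \<Longrightarrow> 0 \<le> w i k" "k \<notin> Q \<Longrightarrow> 0 \<le> w i k" using neg[OF ik] by (meson not_less)+
    moreover have "i \<in> Q \<Longrightarrow> k \<notin> Q \<Longrightarrow> w i k = 1" using up ik by blast
    moreover have "- 1 \<le> w i k" if "k \<in> Q"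
    proof (cases "i = k")
      case False
      then show ?thesis using inQ[OF ik(1) that] by auto
    qed (use diag ik in simp)
    ultimately show "0 \<le> w i k + (if i \<in> Q then - 1 else 0) - (if k \<in> Q then - 1 else 0)"
      by (cases "i \<in> Q"; cases "k \<in> Q") simp_all
  qed
qed

end

lemma sum_potential:
  fixes v :: "nat \<Rightarrow> int"
  assumes "\<sigma> \<in> Sym n"
  shows "lin n (\<lambda>i k. w i k + v i - v k) \<sigma> = lin n w \<sigma>"
proof -
  have "(\<Sum>i\<in>{1..n}. v (\<sigma> i)) = (\<Sum>j\<in>{1..n}. v j)"
    by (rule sum.reindex_bij_betw[OF Sym_bij_betw[OF assms]])
  then show ?thesis unfolding lin_def by (simp add: sum.distrib sum_subtractf)
qed

text \<open>The potential \<open>u\<close> makes the weights of all edges leaving 1 vanish, which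
  reduces to the based case; potentials cancel in every permutation.\<close>

lemma (in boolean_weights) nonneg_potential: "\<exists>v. \<forall>i\<in>{1..n}. \<forall>k\<in>{1..n}. 0 \<le> w i k + v i - v k"
proof (cases "n = 0")
  case False
  define u where "u k = w 1 k" for k
  define w' where "w' i k = w i k + u i - u k" for i k
  interpret B: boolean_weights n w'
  proof
    show "w' i i = 0" if "i \<in> {1..n}" for i using diag[OF that] by (simp add: w'_def)
    show "lin n w' \<sigma> \<in> {0, 1}" if "\<sigma> \<in> Sym n" for \<sigma>
      using bool[OF that] sum_potential[OF that, of w u] by (simp add: w'_def[abs_def])
  qed
  obtain v where v: "\<forall>i\<in>{1..n}. \<forall>k\<in>{1..n}. 0 \<le> w' i k + v i - v k"
    using B.nonneg_potential_based diag[of 1] False by (force simp: w'_def u_def)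
  then show ?thesis by (intro exI[of _ "\<lambda>i. u i + v i"]) (force simp: w'_def algebra_simps)
qed simp

text \<open>A permutation where the function vanishes serves as base point, so that costs relative
  to it are the values of the function. The potential is translated back along
  \<open>\<pi>0\<close>.\<close>

lemma boolean_linear_nonneg:
  fixes c :: "nat \<Rightarrow> nat \<Rightarrow> int"
  assumes bool: "\<And>\<pi>. \<pi> \<in> Sym n \<Longrightarrow> lin n c \<pi> \<in> {0, 1}" and \<pi>0: "\<pi>0 \<in> Sym n" "lin n c \<pi>0 = 0"
  shows "\<exists>d. (\<forall>i\<in>{1..n}. \<forall>j\<in>{1..n}. 0 \<le> d i j) \<and> (\<forall>\<pi>\<in>Sym n. lin n c \<pi> = lin n d \<pi>)"
proof -
  define w where "w i k = c i (\<pi>0 k) - c i (\<pi>0 i)" for i k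
  have w: "lin n w \<sigma> = lin n c (\<pi>0 \<circ> \<sigma>)" for \<sigma>
    using \<pi>0(2) by (simp add: lin_def w_def sum_subtractf)
  interpret boolean_weights n w
    by standard (auto simp: w_def w bool Sym_compose \<pi>0 simp del: insert_iff comp_apply)
  obtain v where v: "\<forall>i\<in>{1..n}. \<forall>k\<in>{1..n}. 0 \<le> w i k + v i - v k" using nonneg_potential by blast
  define d where "d i j = w i (inv \<pi>0 j) + v i - v (inv \<pi>0 j)" for i j
  have "0 \<le> d i j" if "i \<in> {1..n}" "j \<in> {1..n}" for i j
  proof -
    have "inv \<pi>0 j \<in> {1..n}" using Sym_in[OF Sym_inv[OF \<pi>0(1)]] that(2) by blast
    then show ?thesis using v that(1) unfolding d_def by blast
  qed
  moreover have "lin n c \<pi> = lin n d \<pi>" if p: "\<pi> \<in> Sym n" for \<pi>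
  proof -
    have s: "inv \<pi>0 \<circ> \<pi> \<in> Sym n" using \<pi>0(1) p by (intro Sym_compose Sym_inv)
    have "\<pi>0 \<circ> (inv \<pi>0 \<circ> \<pi>) = \<pi>" using permutes_inv_o(1)[of \<pi>0 "{1..n}"] \<pi>0(1) by (simp add: comp_assoc[symmetric] Sym_def)
    then have "lin n c \<pi> = lin n w (inv \<pi>0 \<circ> \<pi>)" by (simp add: w)
    also have "\<dots> = lin n (\<lambda>i k. w i k + v i - v k) (inv \<pi>0 \<circ> \<pi>)" using sum_potential[OF s] by simp
    also have "\<dots> = lin n d \<pi>" by (simp add: lin_def d_def)
    finally show ?thesis .
  qed
  ultimately show ?thesis by blast
qed

subsection \<open>Sums of cosets\<close>

lemma linear_on_Sym_lin:
  assumes "linear_on_Sym n f"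
  shows "\<exists>c. \<forall>\<pi>\<in>Sym n. f \<pi> = lin n c \<pi>"
proof -
  obtain c where c: "\<And>\<pi>. \<pi> \<in> Sym n \<Longrightarrow> f \<pi> = (\<Sum>i\<in>{1..n}. \<Sum>j\<in>{1..n}. c i j * x_ind i j \<pi>)"
    using assms unfolding linear_on_Sym_def by blast
  have "f \<pi> = lin n c \<pi>" if p: "\<pi> \<in> Sym n" for \<pi>
    unfolding c[OF p] lin_def
  proof (rule sum.cong[OF refl])
    fix i assume "i \<in> {1..n}"
    then have "\<pi> i \<in> {1..n}" using Sym_in[OF p] by blast
    then show "(\<Sum>j\<in>{1..n}. c i j * x_ind i j \<pi>) = c i (\<pi> i)"
      by (simp add: x_ind_def if_distrib[of "(*) _"] cong: if_cong del: atLeastAtMost_iff)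
  qed
  then show ?thesis by blast
qed

lemma coset_sum_card: "finite C \<Longrightarrow> coset_sum C \<pi> = real (card {a\<in>C. \<pi> (fst a) = snd a})"
  by (simp add: coset_sum_def x_ind_def case_prod_beta sum.inter_filter[symmetric])

lemma coset_sum_lin:
  assumes "C \<subseteq> {1..n} \<times> {1..n}" "\<pi> \<in> Sym n"
  shows "coset_sum C \<pi> = lin n (\<lambda>i j. if (i, j) \<in> C then 1 else 0) \<pi>"
proof -
  have fC: "finite C" by (rule finite_subset[OF assms(1)]) simp
  have "{a\<in>C. \<pi> (fst a) = snd a} = (\<lambda>i. (i, \<pi> i)) ` {i\<in>{1..n}. (i, \<pi> i) \<in> C}"
    using assms(1) by (auto simp: image_iff)
  then have "card {a\<in>C. \<pi> (fst a) = snd a} = card {i\<in>{1..n}. (i, \<pi> i) \<in> C}"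
    by (simp add: card_image inj_on_def)
  then show ?thesis using coset_sum_card[OF fC, of \<pi>] by (simp add: lin_def sum.inter_filter[symmetric])
qed

text \<open>Ordered counterpart of \<open>nondisjoint_pairs\<close>, indexing the off-diagonal terms
  that survive in the square of \<open>coset_sum C\<close>.\<close>

definition crossing :: "(nat \<times> nat) set \<Rightarrow> ((nat \<times> nat) \<times> (nat \<times> nat)) set" where
  "crossing C = {(a, b)\<in>C \<times> C. fst a \<noteq> fst b \<and> snd a \<noteq> snd b}"

lemma card_crossing:
  assumes C: "C \<subseteq> {1..n} \<times> {1..n}"
  shows "card (crossing C) = 2 * card (nondisjoint_pairs n C)"
proof -
  let ?f = "\<lambda>(a, b). {a, b}"
  have fC: "finite C" by (rule finite_subset[OF C]) simp
  have fin: "finite (crossing C)" by (rule finite_subset[of _ "C \<times> C"]) (use fC in \<open>auto simp: crossing_def\<close>)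
  have iff: "a \<noteq> b \<and> coset n a \<inter> coset n b \<noteq> {} \<longleftrightarrow> (a, b) \<in> crossing C" if "a \<in> C" "b \<in> C" for a b
  proof (cases "a = b")
    case False
    obtain i j k l where ab: "a = (i, j)" "b = (k, l)" by (metis prod.exhaust)
    then have "i \<in> {1..n}" "j \<in> {1..n}" "k \<in> {1..n}" "l \<in> {1..n}" "(i, j) \<noteq> (k, l)" using that C False by auto
    from coset_nondisjoint_iff[OF this] show ?thesis using that ab False by (simp add: crossing_def)
  qed (simp add: crossing_def)
  have im: "nondisjoint_pairs n C = ?f ` crossing C"
  proof (intro equalityI subsetI)
    fix x assume "x \<in> nondisjoint_pairs n C"
    then obtain a b where "x = {a, b}" "a \<in> C" "b \<in> C" "a \<noteq> b" "coset n a \<inter> coset n b \<noteq> {}"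
      unfolding nondisjoint_pairs_def by blast
    then show "x \<in> ?f ` crossing C" using iff[of a b] by (intro image_eqI[of _ _ "(a, b)"]) auto
  next
    fix x assume "x \<in> ?f ` crossing C"
    then obtain a b where "x = {a, b}" "(a, b) \<in> crossing C" by auto
    moreover from this have "a \<in> C" "b \<in> C" by (auto simp: crossing_def)
    ultimately show "x \<in> nondisjoint_pairs n C" using iff[of a b] unfolding nondisjoint_pairs_def by blast
  qed
  have "card (crossing C) = (\<Sum>P\<in>?f ` crossing C. card {x\<in>crossing C. ?f x = P})"
    using sum.image_gen[OF fin, of "\<lambda>_. 1::nat" ?f] by simp
  also have "\<dots> = (\<Sum>P\<in>?f ` crossing C. 2)"
  proof (rule sum.cong[OF refl])
    fix P assume "P \<in> ?f ` crossing C"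
    then obtain a b where P: "P = {a, b}" "(a, b) \<in> crossing C" by auto
    then have "{x\<in>crossing C. ?f x = P} = {(a, b), (b, a)}"
      by (auto simp: doubleton_eq_iff) (auto simp: crossing_def)
    moreover have "a \<noteq> b" using P by (auto simp: crossing_def)
    ultimately show "card {x\<in>crossing C. ?f x = P} = 2" by simp
  qed
  finally show ?thesis unfolding im by simp
qed

text \<open>In the expanded square the diagonal gives back \<open>coset_sum C\<close>, pairs sharing
  a line contribute 0, and every crossing pair is satisfied with probability
  \<open>1 / (n * (n - 1))\<close>.\<close>

lemma expect_coset_sum_pairs:
  assumes C: "C \<subseteq> {1..n} \<times> {1..n}" and n: "n \<ge> 2"
  shows "expect n (\<lambda>\<pi>. (coset_sum C \<pi>)\<^sup>2 - coset_sum C \<pi>) = 2 * real (card (nondisjoint_pairs n C)) / (real n * (real n - 1))"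
proof -
  let ?\<chi> = "\<lambda>(a :: nat \<times> nat) \<pi>. (if \<pi> (fst a) = snd a then 1 else 0 :: real)"
  have fC: "finite C" by (rule finite_subset[OF C]) simp
  have cs: "coset_sum C \<pi> = (\<Sum>a\<in>C. ?\<chi> a \<pi>)" for \<pi> by (simp add: coset_sum_def x_ind_def case_prod_beta)
  have pt: "(coset_sum C \<pi>)\<^sup>2 - coset_sum C \<pi> = (\<Sum>(a, b)\<in>crossing C. ?\<chi> a \<pi> * ?\<chi> b \<pi>)" if p: "\<pi> \<in> Sym n" for \<pi>
  proof -
    have "(coset_sum C \<pi>)\<^sup>2 = (\<Sum>(a, b)\<in>C \<times> C. ?\<chi> a \<pi> * ?\<chi> b \<pi>)"
      by (simp add: cs power2_eq_square sum_product sum.cartesian_product)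
    also have "\<dots> = (\<Sum>(a, b)\<in>crossing C \<union> Id_on C. ?\<chi> a \<pi> * ?\<chi> b \<pi>)"
    proof (rule sum.mono_neutral_right)
      show "\<forall>x\<in>C \<times> C - (crossing C \<union> Id_on C). (case x of (a, b) \<Rightarrow> ?\<chi> a \<pi> * ?\<chi> b \<pi>) = 0"
        using Sym_inj[OF p] by (auto simp: crossing_def split: prod.splits)
    qed (use fC in \<open>auto simp: crossing_def\<close>)
    also have "\<dots> = (\<Sum>(a, b)\<in>crossing C. ?\<chi> a \<pi> * ?\<chi> b \<pi>) + (\<Sum>(a, b)\<in>Id_on C. ?\<chi> a \<pi> * ?\<chi> b \<pi>)"
      by (rule sum.union_disjoint) (use fC in \<open>auto simp: crossing_def intro: finite_subset[of _ "C \<times> C"]\<close>)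
    also have "(\<Sum>(a, b)\<in>Id_on C. ?\<chi> a \<pi> * ?\<chi> b \<pi>) = coset_sum C \<pi>"
    proof -
      have "Id_on C = (\<lambda>a. (a, a)) ` C" by auto
      then show ?thesis by (auto simp: sum.reindex inj_on_def cs intro!: sum.cong)
    qed
    finally show ?thesis by simp
  qed
  have "expect n (\<lambda>\<pi>. (coset_sum C \<pi>)\<^sup>2 - coset_sum C \<pi>) = expect n (\<lambda>\<pi>. \<Sum>x\<in>crossing C. ?\<chi> (fst x) \<pi> * ?\<chi> (snd x) \<pi>)"
    by (rule expect_cong) (simp add: pt case_prod_beta)
  also have "\<dots> = (\<Sum>x\<in>crossing C. expect n (\<lambda>\<pi>. ?\<chi> (fst x) \<pi> * ?\<chi> (snd x) \<pi>))" by (rule expect_sum)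
  also have "\<dots> = (\<Sum>x\<in>crossing C. 1 / (real n * (real n - 1)))"
  proof (rule sum.cong[OF refl])
    fix x assume "x \<in> crossing C"
    moreover obtain i j k l where x1: "x = ((i, j), (k, l))" by (metis prod.exhaust)
    ultimately have "(i, j) \<in> C" "(k, l) \<in> C" "i \<noteq> k" "j \<noteq> l" by (auto simp: crossing_def)
    with C x1 have x: "x = ((i, j), (k, l))" "i \<in> {1..n}" "j \<in> {1..n}" "k \<in> {1..n}" "l \<in> {1..n}" "i \<noteq> k" "j \<noteq> l"
      by auto
    have "(\<Sum>\<pi>\<in>Sym n. ?\<chi> (i, j) \<pi> * ?\<chi> (k, l) \<pi>) = (\<Sum>\<pi>\<in>{\<pi>\<in>Sym n. \<pi> i = j \<and> \<pi> k = l}. 1)"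
      by (subst sum.inter_filter) (auto intro!: sum.cong)
    also have "\<dots> = fact (n - 2)" using card_Sym_2[of i n k j l] x by simp
    finally show "expect n (\<lambda>\<pi>. ?\<chi> (fst x) \<pi> * ?\<chi> (snd x) \<pi>) = 1 / (real n * (real n - 1))"
      unfolding expect_eq x(1) fact_reduce_2[OF n] by simp
  qed
  also have "\<dots> = 2 * real (card (nondisjoint_pairs n C)) / (real n * (real n - 1))"
    by (simp add: card_crossing[OF C])
  finally show ?thesis .
qed

text \<open>For \<open>k \<ge> 2\<close> the distance is \<open>k - 1\<close>, and
  \<open>k * (k - 1)\<close> lies between one and two times its square. This links the distance from
  Boolean with the count of crossing pairs.\<close>

lemma dist01_nat: "(dist01 (real k))\<^sup>2 \<le> (real k)\<^sup>2 - real k" "(real k)\<^sup>2 - real k \<le> 2 * (dist01 (real k))\<^sup>2"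
proof -
  consider "k = 0" | "k = 1" | "k \<ge> 2" by linarith
  then have "(dist01 (real k))\<^sup>2 \<le> (real k)\<^sup>2 - real k \<and> (real k)\<^sup>2 - real k \<le> 2 * (dist01 (real k))\<^sup>2"
  proof cases
    case 3
    define x where "x = real k - 2"
    have x: "real k = x + 2" "0 \<le> x" using 3 by (auto simp: x_def)
    then have "dist01 (real k) = x + 1" by (simp add: dist01_def)
    then show ?thesis using x by (simp add: power2_eq_square algebra_simps)
  qed (auto simp: dist01_def)
  then show "(dist01 (real k))\<^sup>2 \<le> (real k)\<^sup>2 - real k" "(real k)\<^sup>2 - real k \<le> 2 * (dist01 (real k))\<^sup>2" by auto
qed

lemma nondisjoint_pairs_le:
  assumes C: "C \<subseteq> {1..n} \<times> {1..n}" and n: "n \<ge> 2"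
    and \<delta>: "expect n (\<lambda>\<pi>. (dist01 (coset_sum C \<pi>))\<^sup>2) \<le> \<delta>"
  shows "real (card (nondisjoint_pairs n C)) \<le> \<delta> * (real n)\<^sup>2"
proof -
  have fC: "finite C" by (rule finite_subset[OF C]) simp
  have \<delta>0: "0 \<le> \<delta>" using order_trans[OF expect_nonneg \<delta>] by simp
  have "expect n (\<lambda>\<pi>. (coset_sum C \<pi>)\<^sup>2 - coset_sum C \<pi>) \<le> expect n (\<lambda>\<pi>. 2 * (dist01 (coset_sum C \<pi>))\<^sup>2)"
    by (rule expect_mono) (simp add: coset_sum_card[OF fC] dist01_nat)
  also have "\<dots> \<le> 2 * \<delta>" unfolding expect_cmult using \<delta> by simp
  finally have "2 * real (card (nondisjoint_pairs n C)) \<le> 2 * \<delta> * (real n * (real n - 1))"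
    unfolding expect_coset_sum_pairs[OF C n] using n by (simp add: pos_divide_le_eq)
  also have "\<dots> \<le> 2 * \<delta> * (real n * real n)" using \<delta>0 by (intro mult_left_mono) auto
  finally show ?thesis by (simp add: power2_eq_square)
qed

lemma expect_dist01_coset_sum_le:
  assumes C: "C \<subseteq> {1..n} \<times> {1..n}" and n: "n \<ge> 1"
  shows "expect n (\<lambda>\<pi>. (dist01 (coset_sum C \<pi>))\<^sup>2) \<le> 4 * real (card (nondisjoint_pairs n C)) / (real n)\<^sup>2"
proof -
  have fC: "finite C" by (rule finite_subset[OF C]) simp
  show ?thesis
  proof (cases "n \<ge> 2")
    case True
    have "expect n (\<lambda>\<pi>. (dist01 (coset_sum C \<pi>))\<^sup>2) \<le> expect n (\<lambda>\<pi>. (coset_sum C \<pi>)\<^sup>2 - coset_sum C \<pi>)"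
      by (rule expect_mono) (simp add: coset_sum_card[OF fC] dist01_nat)
    also have "\<dots> = 4 * real (card (nondisjoint_pairs n C)) / (2 * (real n * (real n - 1)))"
      unfolding expect_coset_sum_pairs[OF C True] by simp
    also have "\<dots> \<le> 4 * real (card (nondisjoint_pairs n C)) / (real n)\<^sup>2"
      using True mult_left_mono[of 2 "real n" "real n"] by (intro divide_left_mono mult_pos_pos) (auto simp: power2_eq_square algebra_simps)
    finally show ?thesis .
  next
    \<comment> \<open>For \<open>n = 1\<close> the formula would divide by 0; there is at most one
      coset, so the sum is Boolean.\<close>
    case False
    then have "n = 1" using n by simp
    then have "C \<subseteq> {(1, 1)}" using C by auto
    then have "C = {} \<or> C = {(1, 1)}" by (rule subset_singletonD)
    then have "dist01 (coset_sum C \<pi>) = 0" for \<pi> by (auto simp: coset_sum_def x_ind_def dist01_def)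
    then show ?thesis by simp
  qed
qed

lemma expect_coset_sum_sq_le:
  assumes D: "D \<subseteq> {1..n} \<times> {1..n}" and n: "n \<ge> 2"
  shows "expect n (\<lambda>\<pi>. (coset_sum D \<pi>)\<^sup>2) \<le> 2 * (card D / n) + (card D / n)\<^sup>2"
    and "expect n (coset_sum D) = card D / n"
proof -
  let ?e = "\<lambda>i j. if (i, j) \<in> D then 1 else 0 :: real"
  have s: "(\<Sum>i\<in>{1..n}. \<Sum>j\<in>{1..n}. ?e i j) = card D"
  proof -
    have "(\<Sum>i\<in>{1..n}. \<Sum>j\<in>{1..n}. ?e i j) = (\<Sum>x\<in>{1..n} \<times> {1..n}. if x \<in> D then 1 else 0)"
      by (simp add: sum.cartesian_product case_prod_beta)
    also have "\<dots> = card D" using D by (simp add: sum.inter_restrict[symmetric] Int_absorb1)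
    finally show ?thesis .
  qed
  have s2: "(\<Sum>i\<in>{1..n}. \<Sum>j\<in>{1..n}. (?e i j)\<^sup>2) = card D" unfolding s[symmetric] by (intro sum.cong refl) auto
  have "expect n (\<lambda>\<pi>. (coset_sum D \<pi>)\<^sup>2) = expect n (\<lambda>\<pi>. (lin n ?e \<pi>)\<^sup>2)"
    by (rule expect_cong) (simp add: coset_sum_lin[OF D])
  also have "\<dots> \<le> 2 * (card D / n) + (card D / n)\<^sup>2" using expect_lin_sq_le[OF n, of ?e] unfolding s s2 by simp
  finally show "expect n (\<lambda>\<pi>. (coset_sum D \<pi>)\<^sup>2) \<le> 2 * (card D / n) + (card D / n)\<^sup>2" .
  have "expect n (coset_sum D) = expect n (lin n ?e)" by (rule expect_cong) (simp add: coset_sum_lin[OF D])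
  then show "expect n (coset_sum D) = card D / n" by (simp only: expect_lin s)
qed

text \<open>A cell of \<open>C\<close> that crosses few others sees almost all of \<open>C\<close> in its row and column, and
  the two parts cross each other completely, so one of them is small.\<close>

lemma concentrated_on_line:
  assumes C: "C \<subseteq> {1..n} \<times> {1..n}" and n: "n \<ge> 15" and big: "real n \<le> 3 * card C"
    and M: "real (card (nondisjoint_pairs n C)) \<le> \<delta> * (real n)\<^sup>2" and \<delta>: "\<delta> \<le> 1 / 90"
  shows "\<exists>L. ((\<exists>i\<in>{1..n}. L = {i} \<times> {1..n}) \<or> (\<exists>j\<in>{1..n}. L = {1..n} \<times> {j})) \<and> real (card (C - L)) \<le> 26 * \<delta> * n"
proof -
  let ?I = "{1..n}"
  have fC: "finite C" by (rule finite_subset[OF C]) simp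
  have n0: "0 < real n" using n by simp
  have fX: "finite (crossing C)" by (rule finite_subset[of _ "C \<times> C"]) (use fC in \<open>auto simp: crossing_def\<close>)
  define X where "X a = {b\<in>C. (a, b) \<in> crossing C}" for a
  \<comment> \<open>The at most \<open>2 * \<delta> * n\<^sup>2\<close> ordered crossing pairs are
    shared by at least \<open>n / 3\<close> cells.\<close>
  have "\<exists>a\<in>C. real (card (X a)) \<le> 6 * \<delta> * n"
  proof (rule ccontr)
    assume no: "\<not> ?thesis"
    have "C \<noteq> {}" using big n0 by auto
    then have "(\<Sum>a\<in>C. 6 * \<delta> * n) < (\<Sum>a\<in>C. real (card (X a)))" using no fC by (intro sum_strict_mono) (auto simp: not_le)
    also have "\<dots> = real (card (SIGMA a:C. X a))" using fC by (simp add: X_def)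
    also have "(SIGMA a:C. X a) = crossing C" by (auto simp: X_def crossing_def)
    also have "real (card (crossing C)) \<le> 2 * \<delta> * (real n)\<^sup>2" using M by (simp add: card_crossing[OF C])
    also have "\<dots> = (2 * \<delta> * n) * n" by (simp add: power2_eq_square)
    finally have "3 * card C * (2 * \<delta> * n) < n * (2 * \<delta> * n)" by (simp add: mult_ac)
    moreover have "n * (2 * \<delta> * n) \<le> 3 * card C * (2 * \<delta> * n)"
    proof (rule mult_right_mono[OF big])
      have "0 \<le> \<delta> * (real n)\<^sup>2" using M by (rule order_trans[rotated]) simp
      then have "0 \<le> \<delta>" using n0 by (simp add: zero_le_mult_iff)
      then show "0 \<le> 2 * \<delta> * n" by simp
    qed
    ultimately show False by linarith
  qed
  then obtain i j where ij: "(i, j) \<in> C" and Xs: "real (card (X (i, j))) \<le> 6 * \<delta> * n" by auto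
  define R where "R = {b\<in>C. fst b = i \<and> snd b \<noteq> j}"
  define S where "S = {b\<in>C. snd b = j \<and> fst b \<noteq> i}"
  have fRS: "finite R" "finite S" "finite (X (i, j))" using fC by (auto simp: R_def S_def X_def)
  have "C \<subseteq> insert (i, j) (R \<union> S \<union> X (i, j))" by (auto simp: R_def S_def X_def crossing_def ij)
  then have "card C \<le> card (insert (i, j) (R \<union> S \<union> X (i, j)))" by (rule card_mono[rotated]) (use fRS in auto)
  also have "\<dots> \<le> Suc (card R + card S + card (X (i, j)))"
  proof -
    have "card (R \<union> S \<union> X (i, j)) \<le> card R + card S + card (X (i, j))"
      by (meson add_le_mono card_Un_le le_refl order_trans)
    moreover have "card (insert (i, j) (R \<union> S \<union> X (i, j))) \<le> Suc (card (R \<union> S \<union> X (i, j)))"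
      using fRS by (simp add: card_insert_if)
    ultimately show ?thesis by linarith
  qed
  finally have cC: "real (card C) \<le> 1 + real (card R) + real (card S) + 6 * \<delta> * n" using Xs by linarith
  have "R \<times> S \<subseteq> crossing C" by (auto simp: R_def S_def crossing_def)
  then have "card (R \<times> S) \<le> card (crossing C)" by (rule card_mono[OF fX])
  then have "real (card R * card S) \<le> 2 * real (card (nondisjoint_pairs n C))"
    unfolding card_crossing[OF C] card_cartesian_product by (metis of_nat_le_iff of_nat_mult of_nat_numeral)
  then have RS: "real (card R) * real (card S) \<le> 2 * \<delta> * (real n)\<^sup>2" using M by simp
  have small: "y \<le> 20 * \<delta> * n" if "x * y \<le> 2 * \<delta> * (real n)\<^sup>2" "real n / 10 \<le> x" "0 \<le> y" for x y :: real
  proof -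
    have "real n / 10 * y \<le> 2 * \<delta> * (real n)\<^sup>2" using that mult_right_mono[of "real n / 10" x y] by linarith
    then have "real n * y \<le> real n * (20 * \<delta> * n)" by (simp add: power2_eq_square algebra_simps)
    then show ?thesis using n0 by simp
  qed
  \<comment> \<open>If both arms were shorter than \<open>n / 10\<close>, then
    \<open>n / 3 < 1 + n / 5 + n / 15\<close>, which is false from \<open>n = 15\<close> on. The
    other arm is then at most \<open>20 * \<delta> * n\<close>, and together with
    \<open>X (i, j)\<close> this makes 26.\<close>
  have "6 * \<delta> * n \<le> n / 15" using \<delta> n0 mult_right_mono[of "6 * \<delta>" "1 / 15" "real n"] by simp
  then have "real n / 10 \<le> card R \<or> real n / 10 \<le> card S" using cC big n by linarith
  then show ?thesis
  proof
    assume a: "real n / 10 \<le> card R"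
    have "C - {i} \<times> ?I \<subseteq> S \<union> X (i, j)" using C by (auto simp: S_def X_def crossing_def ij)
    then have "card (C - {i} \<times> ?I) \<le> card (S \<union> X (i, j))" by (rule card_mono[rotated]) (use fRS in auto)
    also have "\<dots> \<le> card S + card (X (i, j))" by (rule card_Un_le)
    finally have "real (card (C - {i} \<times> ?I)) \<le> 26 * \<delta> * n" using small[OF RS a] Xs by simp
    then show ?thesis using ij C by blast
  next
    assume a: "real n / 10 \<le> card S"
    have "C - ?I \<times> {j} \<subseteq> R \<union> X (i, j)" using C by (auto simp: R_def X_def crossing_def ij)
    then have "card (C - ?I \<times> {j}) \<le> card (R \<union> X (i, j))" by (rule card_mono[rotated]) (use fRS in auto)
    also have "\<dots> \<le> card R + card (X (i, j))" by (rule card_Un_le)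
    finally have "real (card (C - ?I \<times> {j})) \<le> 26 * \<delta> * n" using small[of "card S" "card R"] RS a Xs by (simp add: mult.commute)
    then show ?thesis using ij C by blast
  qed
qed

subsection \<open>Approximation by sums of cosets\<close>

lemma square_expect_le: "(expect n F)\<^sup>2 \<le> expect n (\<lambda>\<pi>. (F \<pi>)\<^sup>2)"
proof -
  let ?m = "expect n F"
  have "0 \<le> expect n (\<lambda>\<pi>. (F \<pi> - ?m)\<^sup>2)" by (rule expect_nonneg) simp
  also have "\<dots> = expect n (\<lambda>\<pi>. (F \<pi>)\<^sup>2 + (- 2 * ?m * F \<pi> + ?m\<^sup>2))"
    by (rule expect_cong) (simp add: power2_diff)
  also have "\<dots> = expect n (\<lambda>\<pi>. (F \<pi>)\<^sup>2) - ?m\<^sup>2"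
    unfolding expect_add expect_cmult by (simp add: power2_eq_square)
  finally show ?thesis by simp
qed

definition approximable :: "real \<Rightarrow> nat \<Rightarrow> real \<Rightarrow> ((nat \<Rightarrow> nat) \<Rightarrow> real) \<Rightarrow> bool" where
  "approximable K n \<epsilon> f \<longleftrightarrow> (\<exists>C \<subseteq> {1..n} \<times> {1..n}. real (card C) \<le> K * real n \<and>
     real (card (nondisjoint_pairs n C)) \<le> K * \<epsilon> * (real n)\<^sup>2 \<and>
     expect n (\<lambda>\<pi>. (f \<pi> - coset_sum C \<pi>)\<^sup>2) \<le> K * \<epsilon>)"

lemma approximable_mono:
  assumes "approximable K n \<epsilon> f" "K \<le> K'" "0 \<le> \<epsilon>"
  shows "approximable K' n \<epsilon> f"
proof -
  have "K * \<epsilon> \<le> K' * \<epsilon>" "K * real n \<le> K' * real n" using assms by (auto intro: mult_right_mono)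
  moreover from this(1) have "K * \<epsilon> * (real n)\<^sup>2 \<le> K' * \<epsilon> * (real n)\<^sup>2" by (rule mult_right_mono) simp
  ultimately show ?thesis using assms(1) unfolding approximable_def by (meson order_trans)
qed

lemma nondisjoint_pairs_eq_empty:
  assumes "C \<subseteq> {1..n} \<times> {1..n}" "crossing C = {}"
  shows "card (nondisjoint_pairs n C) = 0"
  using card_crossing[OF assms(1)] assms(2) by simp

lemma integer_approximation_dist:
  fixes c :: "nat \<Rightarrow> nat \<Rightarrow> real"
  assumes n: "n \<ge> 2" and \<epsilon>: "\<epsilon> \<le> 1 / 4" and f: "expect n (\<lambda>\<pi>. (dist01 (lin n c \<pi>))\<^sup>2) \<le> \<epsilon>"
  obtains m :: int and r :: "nat \<Rightarrow> nat \<Rightarrow> int" where "card (supp n r) \<le> 64 * n"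
    "expect n (\<lambda>\<pi>. (lin n c \<pi> - of_int (m + lin n r \<pi>))\<^sup>2) \<le> 25000 * \<epsilon>"
    "expect n (\<lambda>\<pi>. (dist01 (of_int (m + lin n r \<pi>)))\<^sup>2) \<le> 60000 * \<epsilon>"
proof -
  have \<epsilon>0: "0 \<le> \<epsilon>" using order_trans[OF expect_nonneg f] by simp
  obtain m r where mr: "card (supp n r) \<le> 64 * n"
    "expect n (\<lambda>\<pi>. (lin n c \<pi> - of_int (m + lin n r \<pi>))\<^sup>2) \<le> 25000 * \<epsilon>"
    using integer_approximation[OF assms] unfolding supp_def by blast
  have "expect n (\<lambda>\<pi>. (dist01 (of_int (m + lin n r \<pi>)))\<^sup>2) \<le> 2 * \<epsilon> + 2 * (25000 * \<epsilon>)"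
    by (rule expect_dist01_sq_le[OF f mr(2)])
  then show ?thesis using that[OF mr] \<epsilon>0 by simp
qed

text \<open>With \<open>n\<close> bounded, a single non-Boolean permutation would already exceed the
  total error, so the integer approximation is Boolean everywhere. The condition on the mean
  excludes the constant 1 and thereby provides a base point for
  \<open>boolean_linear_nonneg\<close>.\<close>

lemma approximable_small:
  fixes n1 :: nat
  shows "\<exists>K>0. \<exists>e>0. \<forall>n \<epsilon> c. 2 \<le> n \<and> n < n1 \<and> \<epsilon> \<le> e \<and> expect n (\<lambda>\<pi>. (dist01 (lin n c \<pi>))\<^sup>2) \<le> \<epsilon> \<and> expect n (lin n c) \<le> 1 / 2
    \<longrightarrow> approximable K n \<epsilon> (lin n c)"
proof -
  define e :: real where "e = 1 / (120000 * fact n1)"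
  have e: "0 < e" "e \<le> 1 / 120000" "60000 * e * fact n1 < 1" by (auto simp: e_def field_simps)
  have main: "approximable (real n1 + 25000) n \<epsilon> (lin n c)"
    if n: "2 \<le> n" "n < n1" and \<epsilon>: "\<epsilon> \<le> e" and f: "expect n (\<lambda>\<pi>. (dist01 (lin n c \<pi>))\<^sup>2) \<le> \<epsilon>" and mean: "expect n (lin n c) \<le> 1 / 2"
    for n \<epsilon> c
  proof -
    let ?I = "{1..n}"
    have \<epsilon>0: "0 \<le> \<epsilon>" using order_trans[OF expect_nonneg f] by simp
    obtain m r where mr: "expect n (\<lambda>\<pi>. (lin n c \<pi> - of_int (m + lin n r \<pi>))\<^sup>2) \<le> 25000 * \<epsilon>"
      "expect n (\<lambda>\<pi>. (dist01 (of_int (m + lin n r \<pi>)))\<^sup>2) \<le> 60000 * \<epsilon>"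
      by (rule integer_approximation_dist[OF n(1) _ f]) (use \<epsilon> e in linarith)
    \<comment> \<open>The constant \<open>m\<close> is spread over row 1, which every permutation
      meets once.\<close>
    define a where "a i j = r i j + (if i = 1 then m else 0)" for i j
    have a: "lin n a \<pi> = m + lin n r \<pi>" for \<pi>
      using n by (simp add: lin_def a_def sum.distrib)
    have bool: "lin n a \<pi> \<in> {0, 1}" if p: "\<pi> \<in> Sym n" for \<pi>
    proof (rule ccontr)
      assume no: "lin n a \<pi> \<notin> {0, 1}"
      have "1 \<le> (dist01 (of_int (lin n a \<pi>)))\<^sup>2" by (rule dist01_of_int_ge(2)[OF no])
      also have "\<dots> \<le> (\<Sum>\<pi>\<in>Sym n. (dist01 (of_int (m + lin n r \<pi>)))\<^sup>2)"
        unfolding a using p by (intro member_le_sum) auto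
      also have "\<dots> \<le> 60000 * \<epsilon> * fact n" using mr(2) by (simp add: expect_eq pos_divide_le_eq)
      also have "\<dots> \<le> 60000 * e * fact n1" using \<epsilon> \<epsilon>0 e n by (intro mult_mono fact_mono) auto
      finally show False using e by simp
    qed
    have "\<exists>\<pi>\<in>Sym n. lin n a \<pi> = 0"
    proof (rule ccontr)
      assume "\<not> ?thesis"
      then have one: "lin n a \<pi> = 1" if "\<pi> \<in> Sym n" for \<pi> using bool that by force
      have "expect n (\<lambda>\<pi>. lin n c \<pi> + - 1) \<le> - (1 / 2)" unfolding expect_add using mean by simp
      then have "(1 / 2)\<^sup>2 \<le> (expect n (\<lambda>\<pi>. lin n c \<pi> + - 1))\<^sup>2"
        using abs_le_square_iff[of "1 / 2" "expect n (\<lambda>\<pi>. lin n c \<pi> + - 1)"] by simp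
      also have "\<dots> \<le> expect n (\<lambda>\<pi>. (lin n c \<pi> + - 1)\<^sup>2)" by (rule square_expect_le)
      also have "\<dots> = expect n (\<lambda>\<pi>. (lin n c \<pi> - of_int (m + lin n r \<pi>))\<^sup>2)"
        by (rule expect_cong) (simp add: one a[symmetric] del: of_int_add)
      also have "\<dots> \<le> 25000 * \<epsilon>" by (rule mr)
      finally have "1 / 4 \<le> 25000 * \<epsilon>" by (simp add: power_divide)
      then show False using \<epsilon> e by linarith
    qed
    then obtain \<pi>0 where p0: "\<pi>0 \<in> Sym n" "lin n a \<pi>0 = 0" by blast
    have "\<exists>d. (\<forall>i\<in>?I. \<forall>j\<in>?I. 0 \<le> d i j) \<and> (\<forall>\<pi>\<in>Sym n. lin n a \<pi> = lin n d \<pi>)"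
      by (rule boolean_linear_nonneg[OF bool p0])
    then obtain d where d': "\<forall>i\<in>?I. \<forall>j\<in>?I. 0 \<le> d i j" "\<forall>\<pi>\<in>Sym n. lin n a \<pi> = lin n d \<pi>" by (elim exE conjE)
    have d0: "0 \<le> d i j" if "i \<in> ?I" "j \<in> ?I" for i j by (rule bspec[OF bspec[OF d'(1) that(1)] that(2)])
    have d: "lin n a \<pi> = lin n d \<pi>" if "\<pi> \<in> Sym n" for \<pi> using d'(2) that by (rule bspec)
    \<comment> \<open>With nonnegative coefficients every partial sum is at most 1. One cell gives
      coefficients in \<open>{0, 1}\<close>; two crossing cells with coefficient 1 are
      impossible.\<close>
    have part: "(\<Sum>i\<in>A. d i (\<pi> i)) \<le> 1" if p: "\<pi> \<in> Sym n" and "A \<subseteq> ?I" for \<pi> A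
    proof -
      have "(\<Sum>i\<in>A. d i (\<pi> i)) \<le> (\<Sum>i\<in>?I. d i (\<pi> i))"
        using that Sym_in[OF p] by (intro sum_mono2 d0) auto
      also have "\<dots> \<le> 1" using bool[OF p] d[OF p] by (auto simp: lin_def)
      finally show ?thesis .
    qed
    have d1: "d i j \<le> 1" if "i \<in> ?I" "j \<in> ?I" for i j
      using part[OF transpose_in_Sym[OF that], of "{i}"] that by simp
    define C where "C = {(i, j)\<in>?I \<times> ?I. d i j \<noteq> 0}"
    have C: "C \<subseteq> ?I \<times> ?I" by (auto simp: C_def)
    have dC: "real_of_int (d i j) = (if (i, j) \<in> C then 1 else 0)" if "i \<in> ?I" "j \<in> ?I" for i j
      using d0[OF that] d1[OF that] that by (auto simp: C_def)
    have "crossing C = {}"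
    proof (rule ccontr)
      assume "crossing C \<noteq> {}"
      then obtain i j k l where x: "(i, j) \<in> C" "(k, l) \<in> C" "i \<noteq> k" "j \<noteq> l" by (force simp: crossing_def)
      then have "card {\<pi> \<in> Sym n. \<pi> i = j \<and> \<pi> k = l} = fact (n - 2)" using C by (intro card_Sym_2) auto
      then have "card {\<pi> \<in> Sym n. \<pi> i = j \<and> \<pi> k = l} \<noteq> 0" by simp
      then obtain \<pi> where p: "\<pi> \<in> Sym n" "\<pi> i = j" "\<pi> k = l" by (metis (mono_tags, lifting) card.empty empty_Collect_eq)
      have "{i, k} \<subseteq> ?I" using x C by auto
      from part[OF p(1) this] have "d i j + d k l \<le> 1" using p x by simp
      moreover have "1 \<le> d i j" "1 \<le> d k l" using x d0[of i j] d0[of k l] by (auto simp: C_def)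
      ultimately show False by linarith
    qed
    then have nd: "card (nondisjoint_pairs n C) = 0" by (rule nondisjoint_pairs_eq_empty[OF C])
    have "card C \<le> card (?I \<times> ?I)" by (rule card_mono[OF _ C]) simp
    also have "\<dots> \<le> n1 * n" using n by (simp add: card_cartesian_product)
    finally have "real (card C) \<le> real (n1 * n)" by (rule of_nat_mono)
    then have cC: "real (card C) \<le> (real n1 + 25000) * real n" by (simp add: algebra_simps)
    have "coset_sum C \<pi> = of_int (m + lin n r \<pi>)" if p: "\<pi> \<in> Sym n" for \<pi>
      unfolding coset_sum_lin[OF C p] a[symmetric] d[OF p] of_int_lin unfolding lin_def
      using Sym_in[OF p] by (intro sum.cong refl dC[symmetric]) auto
    then have "expect n (\<lambda>\<pi>. (lin n c \<pi> - coset_sum C \<pi>)\<^sup>2) = expect n (\<lambda>\<pi>. (lin n c \<pi> - of_int (m + lin n r \<pi>))\<^sup>2)"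
      by (intro expect_cong) simp
    also have "\<dots> \<le> (real n1 + 25000) * \<epsilon>" using mr(1) \<epsilon>0 by (simp add: algebra_simps add_increasing)
    finally show ?thesis unfolding approximable_def using C cC nd \<epsilon>0 by (intro exI[of _ C]) simp
  qed
  show ?thesis by (rule exI[of _ "real n1 + 25000"], intro conjI exI[of _ e]) (use e main in auto)
qed

text \<open>The constant \<open>b\<close> is that of \<open>large_structure\<close> at error
  \<open>60000 * \<epsilon>\<close>; \<open>k * \<epsilon>\<close> bounds the distance of the coset
  sum from Boolean, as 2 * 60000 plus 2 * 3 times \<open>b\<close>. The choice of \<open>e\<close>
  meets the hypotheses of \<open>large_structure\<close> and makes \<open>k * \<epsilon>\<close> at
  most 1/100.\<close>

lemma approximable_large:
  shows "\<exists>K>0. \<exists>e>0. \<exists>n1. \<forall>n \<epsilon> c. n1 \<le> n \<and> \<epsilon> \<le> e \<and> expect n (\<lambda>\<pi>. (dist01 (lin n c \<pi>))\<^sup>2) \<le> \<epsilon> \<and> expect n (lin n c) \<le> 1 / 2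
    \<longrightarrow> approximable K n \<epsilon> (lin n c)"
proof -
  define b :: real where "b = 480000 / avoid_const"
  define k :: real where "k = 120000 + 6 * b"
  define K :: real where "K = 64 + 200 * k"
  define e :: real where "e = min (avoid_const / 120000) (1 / (1000000000 + 100 * k))"
  have b0: "0 < b" using avoid_const_pos by (simp add: b_def)
  then have k0: "120000 < k" "6 * b \<le> k" by (auto simp: k_def)
  have e0: "0 < e" "60000 * e < avoid_const" "e * (1000000000 + 100 * k) \<le> 1"
    using avoid_const_pos k0 by (auto simp: e_def min_def field_simps)
  have e1: "1000000000 * e \<le> 1" "k * e \<le> 1 / 100"
  proof -
    have "e * 1000000000 + 100 * (k * e) \<le> 1" "0 < k * e" using e0 k0 by (auto simp: algebra_simps)
    then show "1000000000 * e \<le> 1" "k * e \<le> 1 / 100" using e0 by linarith+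
  qed
  obtain n2 where n2: "128 / avoid_const + 1 \<le> real n2" using real_arch_simple by blast
  have main: "approximable K n \<epsilon> (lin n c)"
    if n: "max 50000 n2 \<le> n" and \<epsilon>: "\<epsilon> \<le> e" and f: "expect n (\<lambda>\<pi>. (dist01 (lin n c \<pi>))\<^sup>2) \<le> \<epsilon>" and mean: "expect n (lin n c) \<le> 1 / 2"
    for n \<epsilon> c
  proof -
    let ?I = "{1..n}"
    have n': "n \<ge> 50000" "128 / avoid_const + 1 \<le> real n" "n \<ge> 2" using n n2 by auto
    have \<epsilon>0: "0 \<le> \<epsilon>" using order_trans[OF expect_nonneg f] by simp
    have k\<epsilon>: "k * \<epsilon> \<le> 1 / 100" using e1(2) mult_left_mono[OF \<epsilon>, of k] k0 by linarith
    obtain m r where supp: "card (supp n r) \<le> 64 * n"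
      and fh: "expect n (\<lambda>\<pi>. (lin n c \<pi> - of_int (m + lin n r \<pi>))\<^sup>2) \<le> 25000 * \<epsilon>"
      and h: "expect n (\<lambda>\<pi>. (dist01 (of_int (m + lin n r \<pi>)))\<^sup>2) \<le> 60000 * \<epsilon>"
      by (rule integer_approximation_dist[OF n'(3) _ f]) (use \<epsilon> e1 in linarith)
    have "60000 * \<epsilon> \<le> 1 / 10000" "60000 * \<epsilon> < avoid_const" using \<epsilon> e0 e1 by linarith+
    from large_structure[OF n'(1,2) supp h this] obtain s where s: "card (supp n s) \<le> 64 * n"
      and hs: "(\<forall>\<pi>\<in>Sym n. m + lin n r \<pi> = lin n s \<pi>) \<or> (\<forall>\<pi>\<in>Sym n. m + lin n r \<pi> = 1 - lin n s \<pi>)"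
      and "(\<Sum>(i, j)\<in>{(i, j)\<in>supp n s. s i j \<noteq> 1}. (real_of_int (s i j))\<^sup>2) \<le> 8 / avoid_const * (60000 * \<epsilon>) * n" by blast
    then have tail: "(\<Sum>(i, j)\<in>{(i, j)\<in>supp n s. s i j \<noteq> 1}. (real_of_int (s i j))\<^sup>2) \<le> b * \<epsilon> * n" by (simp add: b_def)
    define C where "C = {(i, j)\<in>supp n s. s i j = 1}"
    have C: "C \<subseteq> ?I \<times> ?I" by (auto simp: C_def supp_def)
    have cC: "card C \<le> 64 * n" using s card_mono[of "supp n s" C] by (force simp: C_def)
    define E where "E i j = (if (i, j) \<in> {(i, j)\<in>supp n s. s i j \<noteq> 1} then real_of_int (s i j) else 0)" for i j
    have split: "real_of_int (lin n s \<pi>) = coset_sum C \<pi> + lin n E \<pi>" if p: "\<pi> \<in> Sym n" for \<pi>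
      unfolding coset_sum_lin[OF C p] of_int_lin unfolding lin_def sum.distrib[symmetric]
    proof (rule sum.cong[OF refl])
      fix i assume "i \<in> ?I"
      then have "\<pi> i \<in> ?I" using Sym_in[OF p] by blast
      with \<open>i \<in> ?I\<close> show "real_of_int (s i (\<pi> i)) = (if (i, \<pi> i) \<in> C then 1 else 0) + E i (\<pi> i)"
        by (auto simp: C_def E_def supp_def)
    qed
    have EE: "(\<Sum>i\<in>?I. \<Sum>j\<in>?I. (E i j)\<^sup>2) \<le> b * \<epsilon> * n"
    proof -
      have "(\<Sum>i\<in>?I. \<Sum>j\<in>?I. (E i j)\<^sup>2) = (\<Sum>(i, j)\<in>?I \<times> ?I. (E i j)\<^sup>2)" by (rule sum.cartesian_product)
      also have "\<dots> = (\<Sum>(i, j)\<in>{(i, j)\<in>supp n s. s i j \<noteq> 1}. (E i j)\<^sup>2)"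
        by (rule sum.mono_neutral_right) (auto simp: E_def supp_def)
      also have "\<dots> = (\<Sum>(i, j)\<in>{(i, j)\<in>supp n s. s i j \<noteq> 1}. (real_of_int (s i j))\<^sup>2)"
        by (rule sum.cong) (auto simp: E_def)
      finally show ?thesis using tail by simp
    qed
    have b\<epsilon>: "0 \<le> b * \<epsilon>" "b * \<epsilon> \<le> 1" using b0 \<epsilon>0 k\<epsilon> mult_right_mono[OF k0(2) \<epsilon>0] by auto
    have E: "expect n (\<lambda>\<pi>. (lin n E \<pi>)\<^sup>2) \<le> 3 * (b * \<epsilon>)"
    proof -
      have "\<bar>\<Sum>i\<in>?I. \<Sum>j\<in>?I. E i j\<bar> \<le> (\<Sum>i\<in>?I. \<bar>\<Sum>j\<in>?I. E i j\<bar>)" by (rule sum_abs)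
      also have "\<dots> \<le> (\<Sum>i\<in>?I. \<Sum>j\<in>?I. \<bar>E i j\<bar>)" by (intro sum_mono sum_abs)
      also have "\<dots> \<le> (\<Sum>i\<in>?I. \<Sum>j\<in>?I. (E i j)\<^sup>2)"
      \<comment> \<open>The discarded coefficients are integers, so their absolute values are at
        most their squares; the bound on the squares therefore controls the mean as well as the
        variance.\<close>
      proof (intro sum_mono)
        fix i j
        have "\<bar>z\<bar> \<le> z\<^sup>2" for z :: int
        proof (cases "z = 0")
          case False
          then have "\<bar>z\<bar> * 1 \<le> \<bar>z\<bar> * \<bar>z\<bar>" by (intro mult_left_mono) auto
          then show ?thesis by (simp add: power2_eq_square)
        qed simp
        then have "\<bar>real_of_int z\<bar> \<le> (real_of_int z)\<^sup>2" for z :: int by (metis of_int_abs of_int_le_iff of_int_power)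
        then show "\<bar>E i j\<bar> \<le> (E i j)\<^sup>2" by (simp add: E_def)
      qed
      also note EE
      finally have "\<bar>(\<Sum>i\<in>?I. \<Sum>j\<in>?I. E i j) / n\<bar> \<le> \<bar>b * \<epsilon>\<bar>" using n' b\<epsilon> by (simp add: divide_le_eq)
      then have "((\<Sum>i\<in>?I. \<Sum>j\<in>?I. E i j) / n)\<^sup>2 \<le> (b * \<epsilon>)\<^sup>2" by (subst (asm) abs_le_square_iff)
      also have "\<dots> \<le> b * \<epsilon>" using b\<epsilon> mult_left_mono[of "b * \<epsilon>" 1 "b * \<epsilon>"] by (simp add: power2_eq_square)
      finally have "((\<Sum>i\<in>?I. \<Sum>j\<in>?I. E i j) / n)\<^sup>2 \<le> b * \<epsilon>" .
      moreover have "2 * (\<Sum>i\<in>?I. \<Sum>j\<in>?I. (E i j)\<^sup>2) / n \<le> 2 * (b * \<epsilon>)" using EE n' by (simp add: divide_le_eq)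
      ultimately show ?thesis using expect_lin_sq_le[OF n'(3), of E] by linarith
    qed
    have "expect n (\<lambda>\<pi>. (dist01 (of_int (lin n s \<pi>)))\<^sup>2) = expect n (\<lambda>\<pi>. (dist01 (of_int (m + lin n r \<pi>)))\<^sup>2)"
      using hs by (elim disjE) (intro expect_cong, simp add: dist01_one_minus)+
    then have "expect n (\<lambda>\<pi>. (dist01 (of_int (lin n s \<pi>)))\<^sup>2) \<le> 60000 * \<epsilon>" using h by simp
    moreover have "expect n (\<lambda>\<pi>. (of_int (lin n s \<pi>) - coset_sum C \<pi>)\<^sup>2) \<le> 3 * (b * \<epsilon>)"
      using E expect_cong[of n "\<lambda>\<pi>. (of_int (lin n s \<pi>) - coset_sum C \<pi>)\<^sup>2" "\<lambda>\<pi>. (lin n E \<pi>)\<^sup>2"] split by simp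
    ultimately have "expect n (\<lambda>\<pi>. (dist01 (coset_sum C \<pi>))\<^sup>2) \<le> 2 * (60000 * \<epsilon>) + 2 * (3 * (b * \<epsilon>))"
      by (rule expect_dist01_sq_le)
    also have "\<dots> = k * \<epsilon>" by (simp add: k_def algebra_simps)
    finally have nd: "real (card (nondisjoint_pairs n C)) \<le> k * \<epsilon> * (real n)\<^sup>2"
      by (rule nondisjoint_pairs_le[OF C n'(3)])
    have kK: "k * \<epsilon> \<le> K * \<epsilon>" using k0 \<epsilon>0 by (intro mult_right_mono) (auto simp: K_def)
    have Kbig: "160 * (k * \<epsilon>) \<le> K * \<epsilon>" "1 \<le> K" "64 \<le> K"
    proof -
      show "160 * (k * \<epsilon>) \<le> K * \<epsilon>" using mult_right_mono[of "160 * k" K \<epsilon>] k0 \<epsilon>0 by (simp add: K_def mult.assoc)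
    qed (use k0 in \<open>auto simp: K_def\<close>)
    have bk: "2 * (25000 * \<epsilon>) + 2 * (3 * (b * \<epsilon>)) \<le> k * \<epsilon>" using \<epsilon>0 by (simp add: k_def algebra_simps)
    from hs show ?thesis
    proof
      assume hs: "\<forall>\<pi>\<in>Sym n. m + lin n r \<pi> = lin n s \<pi>"
      have "expect n (\<lambda>\<pi>. (lin n c \<pi> - coset_sum C \<pi>)\<^sup>2) = expect n (\<lambda>\<pi>. ((lin n c \<pi> - of_int (m + lin n r \<pi>)) + lin n E \<pi>)\<^sup>2)"
      proof (rule expect_cong)
        fix \<pi> assume p: "\<pi> \<in> Sym n"
        then have "of_int (m + lin n r \<pi>) = coset_sum C \<pi> + lin n E \<pi>" using hs split by simp
        then show "(lin n c \<pi> - coset_sum C \<pi>)\<^sup>2 = ((lin n c \<pi> - of_int (m + lin n r \<pi>)) + lin n E \<pi>)\<^sup>2" by simp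
      qed
      also have "\<dots> \<le> 2 * (25000 * \<epsilon>) + 2 * (3 * (b * \<epsilon>))" by (rule expect_sq_add_le[OF fh E])
      also have "\<dots> \<le> K * \<epsilon>" using bk kK by linarith
      finally have "expect n (\<lambda>\<pi>. (lin n c \<pi> - coset_sum C \<pi>)\<^sup>2) \<le> K * \<epsilon>" .
      moreover have "real (card C) \<le> K * real n"
        using of_nat_mono[OF cC, where ?'a = real] mult_right_mono[OF Kbig(3), of "real n"] by simp
      moreover have "real (card (nondisjoint_pairs n C)) \<le> K * \<epsilon> * (real n)\<^sup>2"
        by (rule order_trans[OF nd mult_right_mono[OF kK]]) simp
      ultimately show ?thesis unfolding approximable_def using C by blast
    next
      assume hs: "\<forall>\<pi>\<in>Sym n. m + lin n r \<pi> = 1 - lin n s \<pi>"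
      have "expect n (\<lambda>\<pi>. (lin n c \<pi> - (1 - coset_sum C \<pi>))\<^sup>2) = expect n (\<lambda>\<pi>. ((lin n c \<pi> - of_int (m + lin n r \<pi>)) + lin n (\<lambda>i j. - E i j) \<pi>)\<^sup>2)"
      proof (rule expect_cong)
        fix \<pi> assume p: "\<pi> \<in> Sym n"
        then have "real_of_int (m + lin n r \<pi>) = 1 - coset_sum C \<pi> - lin n E \<pi>" using hs split by simp
        moreover have "lin n (\<lambda>i j. - E i j) \<pi> = - lin n E \<pi>" by (simp add: lin_def sum_negf)
        ultimately have "lin n c \<pi> - (1 - coset_sum C \<pi>) = (lin n c \<pi> - of_int (m + lin n r \<pi>)) + lin n (\<lambda>i j. - E i j) \<pi>" by linarith
        then show "(lin n c \<pi> - (1 - coset_sum C \<pi>))\<^sup>2 = ((lin n c \<pi> - of_int (m + lin n r \<pi>)) + lin n (\<lambda>i j. - E i j) \<pi>)\<^sup>2" by (simp only:)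
      qed
      also have "\<dots> \<le> 2 * (25000 * \<epsilon>) + 2 * (3 * (b * \<epsilon>))"
        by (rule expect_sq_add_le[OF fh]) (use E in \<open>simp add: lin_def sum_negf\<close>)
      also note bk
      finally have fg: "expect n (\<lambda>\<pi>. (lin n c \<pi> - (1 - coset_sum C \<pi>))\<^sup>2) \<le> k * \<epsilon>" .
      \<comment> \<open>The means of \<open>f\<close> and of \<open>1 - coset_sum C\<close> differ
        by at most 1/10, the square root of 1/100. As the former is at most 1/2,
        \<open>card C / n\<close> is at least 2/5.\<close>
      have "(expect n (\<lambda>\<pi>. lin n c \<pi> - (1 - coset_sum C \<pi>)))\<^sup>2 \<le> (1 / 10)\<^sup>2"
        using square_expect_le[of n "\<lambda>\<pi>. lin n c \<pi> - (1 - coset_sum C \<pi>)"] fg k\<epsilon> by (simp add: power_divide)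
      then have "\<bar>expect n (\<lambda>\<pi>. lin n c \<pi> - (1 - coset_sum C \<pi>))\<bar> \<le> \<bar>1 / 10\<bar>" by (subst abs_le_square_iff)
      moreover have "expect n (\<lambda>\<pi>. lin n c \<pi> - (1 - coset_sum C \<pi>)) = expect n (\<lambda>\<pi>. lin n c \<pi> + (- 1 + coset_sum C \<pi>))"
        by (rule expect_cong) simp
      ultimately have "\<bar>expect n (lin n c) + (- 1 + card C / n)\<bar> \<le> 1 / 10"
        unfolding expect_add expect_const expect_coset_sum_sq_le(2)[OF C n'(3)] by (simp only: abs_of_pos zero_less_divide_1_iff zero_less_numeral)
      then have "1 / 3 \<le> card C / n" using mean by linarith
      then have big: "real n \<le> 3 * card C" using n' by (simp add: field_simps)
      obtain L where L: "(\<exists>i\<in>?I. L = {i} \<times> ?I) \<or> (\<exists>j\<in>?I. L = ?I \<times> {j})" and out: "real (card (C - L)) \<le> 26 * (k * \<epsilon>) * n"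
        using concentrated_on_line[OF C _ big nd] n' k\<epsilon> by auto
      have LI: "L \<subseteq> ?I \<times> ?I" using L by auto
      have cL: "card L = n" using L by (auto simp: card_cartesian_product)
      have oneL: "coset_sum L \<pi> = 1" if p: "\<pi> \<in> Sym n" for \<pi>
        using L
      proof
        assume "\<exists>i\<in>?I. L = {i} \<times> ?I"
        then obtain i where i: "i \<in> ?I" "L = {i} \<times> ?I" by blast
        then have "{a\<in>L. \<pi> (fst a) = snd a} = {(i, \<pi> i)}" using Sym_in[OF p, of i] by auto
        then show ?thesis using coset_sum_card[of L \<pi>] LI finite_subset by fastforce
      next
        assume "\<exists>j\<in>?I. L = ?I \<times> {j}"
        then obtain j where j: "j \<in> ?I" "L = ?I \<times> {j}" by blast
        have "inv \<pi> j \<in> ?I" using Sym_in[OF Sym_inv[OF p]] j by blast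
        moreover have "\<pi> (inv \<pi> j) = j" using Sym_inv_eq[OF p, of j "inv \<pi> j"] by (simp only: refl)
        ultimately have "{a\<in>L. \<pi> (fst a) = snd a} = {(inv \<pi> j, j)}"
        proof (intro equalityI subsetI)
          fix x assume "x \<in> {a\<in>L. \<pi> (fst a) = snd a}"
          then have "snd x = j" "\<pi> (fst x) = j" using j(2) by auto
          then have "fst x = inv \<pi> j" using Sym_inv_eq[OF p, of j "fst x"] by simp
          then show "x \<in> {(inv \<pi> j, j)}" using \<open>snd x = j\<close> by (simp add: prod_eq_iff)
        qed (simp add: j(2))
        then show ?thesis using coset_sum_card[of L \<pi>] LI finite_subset by fastforce
      qed
      \<comment> \<open>Every permutation meets \<open>L\<close> exactly once, so
        \<open>1 - coset_sum C\<close> differs from \<open>coset_sum G\<close> only by the few cells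
        of \<open>C\<close> off the line. All of \<open>G\<close> lies on one line, hence it has no
        crossing pairs.\<close>
      define G where "G = L - C"
      have G: "G \<subseteq> ?I \<times> ?I" using LI by (auto simp: G_def)
      have fin: "finite C" "finite L" using C LI finite_subset by blast+
      have "crossing G = {}" using L by (auto simp: crossing_def G_def)
      then have ndG: "card (nondisjoint_pairs n G) = 0" by (rule nondisjoint_pairs_eq_empty[OF G])
      have "card G \<le> n" using card_mono[of L G] fin cL by (auto simp: G_def)
      then have cG: "real (card G) \<le> K * real n" using mult_right_mono[OF Kbig(2), of "real n"] by simp
      have D: "C - L \<subseteq> ?I \<times> ?I" using C by auto
      have gg: "1 - coset_sum C \<pi> = coset_sum G \<pi> - coset_sum (C - L) \<pi>" if p: "\<pi> \<in> Sym n" for \<pi>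
      proof -
        have "coset_sum (L \<union> C) \<pi> = coset_sum C \<pi> + coset_sum G \<pi>"
          unfolding coset_sum_def G_def using fin by (subst sum.union_disjoint[symmetric]) (auto intro!: sum.cong)
        moreover have "coset_sum (L \<union> C) \<pi> = coset_sum L \<pi> + coset_sum (C - L) \<pi>"
          unfolding coset_sum_def using fin by (subst sum.union_disjoint[symmetric]) (auto intro!: sum.cong)
        ultimately show ?thesis using oneL[OF p] by simp
      qed
      \<comment> \<open>The bound 26 of \<open>concentrated_on_line\<close> leads to the total 158 =
        2 + 2 * 3 * 26, which the factor 200 in \<open>K\<close> covers.\<close>
      define q where "q = 26 * (k * \<epsilon>)"
      have q: "0 \<le> q" "q \<le> 1" using k\<epsilon> k0 \<epsilon>0 by (auto simp: q_def)
      have dq: "card (C - L) / n \<le> q" using out n' by (simp add: q_def divide_le_eq)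
      then have "(card (C - L) / n)\<^sup>2 \<le> q\<^sup>2" by (rule power_mono) simp
      also have "\<dots> \<le> q" using q mult_left_mono[of q 1 q] by (simp add: power2_eq_square)
      finally have DD: "expect n (\<lambda>\<pi>. (coset_sum (C - L) \<pi>)\<^sup>2) \<le> 3 * q"
        using expect_coset_sum_sq_le(1)[OF D n'(3)] dq by linarith
      have "expect n (\<lambda>\<pi>. (lin n c \<pi> - coset_sum G \<pi>)\<^sup>2) = expect n (\<lambda>\<pi>. ((lin n c \<pi> - (1 - coset_sum C \<pi>)) + (- coset_sum (C - L) \<pi>))\<^sup>2)"
        by (rule expect_cong) (simp add: gg)
      also have "\<dots> \<le> 2 * (k * \<epsilon>) + 2 * (3 * q)" by (rule expect_sq_add_le[OF fg]) (use DD in simp)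
      also have "\<dots> = 158 * (k * \<epsilon>)" by (simp add: q_def)
      also have "\<dots> \<le> K * \<epsilon>" using Kbig(1) mult_nonneg_nonneg[of k \<epsilon>] k0 \<epsilon>0 by linarith
      finally have "expect n (\<lambda>\<pi>. (lin n c \<pi> - coset_sum G \<pi>)\<^sup>2) \<le> K * \<epsilon>" .
      moreover have "real (card (nondisjoint_pairs n G)) \<le> K * \<epsilon> * (real n)\<^sup>2"
        using ndG Kbig \<epsilon>0 by simp
      ultimately show ?thesis unfolding approximable_def using G cG by blast
    qed
  qed
  show ?thesis
    by (rule exI[of _ K], intro conjI exI[of _ e] exI[of _ "max 50000 n2"]) (use e0 k0 main in \<open>auto simp: K_def\<close>)
qed

text \<open>When \<epsilon> is bounded below, the empty set of cosets suffices, because the second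
  moment of \<open>f\<close> is at most \<open>2 + 2 * \<epsilon>\<close>.\<close>

lemma approximable_large_error:
  assumes e: "0 < e" "e \<le> \<epsilon>" and f: "expect n (\<lambda>\<pi>. (dist01 (f \<pi>))\<^sup>2) \<le> \<epsilon>"
  shows "approximable (2 + 2 / e) n \<epsilon> f"
proof -
  have "expect n (\<lambda>\<pi>. (f \<pi> - coset_sum {} \<pi>)\<^sup>2) \<le> expect n (\<lambda>\<pi>. 2 + 2 * (dist01 (f \<pi>))\<^sup>2)"
  proof (rule expect_mono)
    fix \<pi>
    have "\<bar>f \<pi>\<bar> \<le> \<bar>1 + dist01 (f \<pi>)\<bar>" unfolding dist01_def by (auto simp: min_def)
    then have "(f \<pi>)\<^sup>2 \<le> (1 + dist01 (f \<pi>))\<^sup>2" by (subst (asm) abs_le_square_iff)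
    also have "\<dots> \<le> 2 + 2 * (dist01 (f \<pi>))\<^sup>2"
      using zero_le_power2[of "1 - dist01 (f \<pi>)"] by (simp add: power2_sum power2_diff)
    finally show "(f \<pi> - coset_sum {} \<pi>)\<^sup>2 \<le> 2 + 2 * (dist01 (f \<pi>))\<^sup>2" by (simp add: coset_sum_def)
  qed
  also have "\<dots> \<le> 2 + 2 * \<epsilon>" unfolding expect_add expect_cmult using f by simp
  also have "\<dots> \<le> (2 + 2 / e) * \<epsilon>" using e by (simp add: field_simps)
  finally show ?thesis unfolding approximable_def using e
    by (intro exI[of _ "{}"]) (simp add: nondisjoint_pairs_def)
qed

text \<open>For \<open>n = 1\<close> the function is constant and at most 1/2, so 0 is its nearest
  point of \<open>{0, 1}\<close>.\<close>

lemma approximable_one: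
  assumes "0 \<le> \<epsilon>" "expect 1 (\<lambda>\<pi>. (dist01 (lin 1 c \<pi>))\<^sup>2) \<le> \<epsilon>" "expect 1 (lin 1 c) \<le> 1 / 2"
  shows "approximable 1 1 \<epsilon> (lin 1 c)"
proof -
  have const: "lin 1 c \<pi> = c 1 1" if "\<pi> \<in> Sym 1" for \<pi>
    using Sym_in[OF that, of 1] by (simp add: lin_def)
  have "expect 1 (lin 1 c) = expect 1 (\<lambda>_. c 1 1)" by (rule expect_cong) (rule const)
  then have "c 1 1 \<le> 1 / 2" using assms(3) by simp
  then have "dist01 (c 1 1) = \<bar>c 1 1\<bar>" by (auto simp: dist01_def)
  then have "expect 1 (\<lambda>\<pi>. (lin 1 c \<pi> - coset_sum {} \<pi>)\<^sup>2) = expect 1 (\<lambda>\<pi>. (dist01 (lin 1 c \<pi>))\<^sup>2)"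
    by (intro expect_cong) (simp add: const coset_sum_def del: One_nat_def)
  then show ?thesis unfolding approximable_def using assms by (intro exI[of _ "{}"]) (simp add: nondisjoint_pairs_def)
qed

lemma approximable_all:
  "\<exists>K>0. \<forall>n \<epsilon> f. n \<ge> 1 \<longrightarrow> \<epsilon> \<ge> 0 \<longrightarrow> linear_on_Sym n f \<longrightarrow> expect n (\<lambda>\<pi>. (dist01 (f \<pi>))\<^sup>2) \<le> \<epsilon> \<longrightarrow> expect n f \<le> 1 / 2
     \<longrightarrow> approximable K n \<epsilon> f"
proof -
  obtain K1 e1 n1 where 1: "K1 > 0" "e1 > 0" and large: "\<And>n \<epsilon> c. n1 \<le> n \<Longrightarrow> \<epsilon> \<le> e1 \<Longrightarrow> expect n (\<lambda>\<pi>. (dist01 (lin n c \<pi>))\<^sup>2) \<le> \<epsilon> \<Longrightarrow> expect n (lin n c) \<le> 1 / 2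
    \<Longrightarrow> approximable K1 n \<epsilon> (lin n c)"
    using approximable_large by metis
  obtain K2 e2 where 2: "K2 > 0" "e2 > 0" and small: "\<And>n \<epsilon> c. 2 \<le> n \<Longrightarrow> n < n1 \<Longrightarrow> \<epsilon> \<le> e2 \<Longrightarrow> expect n (\<lambda>\<pi>. (dist01 (lin n c \<pi>))\<^sup>2) \<le> \<epsilon> \<Longrightarrow> expect n (lin n c) \<le> 1 / 2
    \<Longrightarrow> approximable K2 n \<epsilon> (lin n c)"
    using approximable_small[of n1] by metis
  define e where "e = min e1 e2"
  define K where "K = K1 + K2 + 1 + (2 + 2 / e)"
  have e: "0 < e" "e \<le> e1" "e \<le> e2" using 1 2 by (auto simp: e_def)
  have K: "K1 \<le> K" "K2 \<le> K" "1 \<le> K" "2 + 2 / e \<le> K" "0 < K" using 1 2 e by (auto simp: K_def add_pos_pos)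
  have "approximable K n \<epsilon> f" if n: "n \<ge> 1" and \<epsilon>: "\<epsilon> \<ge> 0" and lin: "linear_on_Sym n f"
    and f: "expect n (\<lambda>\<pi>. (dist01 (f \<pi>))\<^sup>2) \<le> \<epsilon>" "expect n f \<le> 1 / 2" for n \<epsilon> f
  proof -
    obtain c where c: "\<And>\<pi>. \<pi> \<in> Sym n \<Longrightarrow> f \<pi> = lin n c \<pi>" using linear_on_Sym_lin[OF lin] by blast
    have f': "expect n (\<lambda>\<pi>. (dist01 (lin n c \<pi>))\<^sup>2) \<le> \<epsilon>" "expect n (lin n c) \<le> 1 / 2"
      using f expect_cong[of n f "lin n c"] expect_cong[of n "\<lambda>\<pi>. (dist01 (f \<pi>))\<^sup>2" "\<lambda>\<pi>. (dist01 (lin n c \<pi>))\<^sup>2"] c by auto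
    have "approximable K n \<epsilon> (lin n c)"
    proof (cases "\<epsilon> \<le> e")
      case False
      then show ?thesis using approximable_mono[OF approximable_large_error[OF e(1) _ f'(1)] K(4) \<epsilon>] by simp
    next
      case True
      then have \<epsilon>': "\<epsilon> \<le> e1" "\<epsilon> \<le> e2" using e by auto
      consider "n = 1" | "2 \<le> n" "n < n1" | "n1 \<le> n" using n by linarith
      then show ?thesis
      proof cases
        case 1
        then show ?thesis using approximable_mono[OF approximable_one K(3) \<epsilon>] f' \<epsilon> by simp
      next
        case 2
        then show ?thesis using approximable_mono[OF small[OF 2 \<epsilon>'(2) f'] K(2) \<epsilon>] by simp
      next
        case 3
        then show ?thesis using approximable_mono[OF large[OF 3 \<epsilon>'(1) f'] K(1) \<epsilon>] by simp
      qed
    qed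
    moreover have "expect n (\<lambda>\<pi>. (f \<pi> - coset_sum C \<pi>)\<^sup>2) = expect n (\<lambda>\<pi>. (lin n c \<pi> - coset_sum C \<pi>)\<^sup>2)" for C
      by (rule expect_cong) (simp add: c)
    ultimately show ?thesis unfolding approximable_def by simp
  qed
  then show ?thesis using K(5) by blast
qed

theorem theorem1p2:
  shows "(\<exists>K::real. K > 0 \<and>
    (\<forall>(n::nat) (\<epsilon>::real) (f :: (nat \<Rightarrow> nat) \<Rightarrow> real).
       n \<ge> 1 \<longrightarrow> \<epsilon> \<ge> 0 \<longrightarrow> linear_on_Sym n f \<longrightarrow>
       expect n (\<lambda>\<pi>. (dist01 (f \<pi>))\<^sup>2) \<le> \<epsilon> \<longrightarrow> expect n f \<le> 1 / 2 \<longrightarrow>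
       (\<exists>C \<subseteq> {1..n} \<times> {1..n}.
          real (card C) \<le> K * real n \<and>
          real (card (nondisjoint_pairs n C)) \<le> K * \<epsilon> * (real n)\<^sup>2 \<and>
          expect n (\<lambda>\<pi>. (f \<pi> - coset_sum C \<pi>)\<^sup>2) \<le> K * \<epsilon>)))
  \<and>
   (\<forall>A::real. A > 0 \<longrightarrow> (\<exists>B::real. B > 0 \<and>
    (\<forall>(n::nat) (\<epsilon>::real) (C :: (nat \<times> nat) set).
       n \<ge> 1 \<longrightarrow> \<epsilon> \<ge> 0 \<longrightarrow> C \<subseteq> {1..n} \<times> {1..n} \<longrightarrow>
       real (card C) \<le> A * real n \<longrightarrow>
       real (card (nondisjoint_pairs n C)) \<le> A * \<epsilon> * (real n)\<^sup>2 \<longrightarrow>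
       expect n (\<lambda>\<pi>. (dist01 (coset_sum C \<pi>))\<^sup>2) \<le> B * \<epsilon>)))"
proof (intro conjI allI impI)
  show "\<exists>K>0. \<forall>n \<epsilon> f. n \<ge> 1 \<longrightarrow> \<epsilon> \<ge> 0 \<longrightarrow> linear_on_Sym n f \<longrightarrow>
       expect n (\<lambda>\<pi>. (dist01 (f \<pi>))\<^sup>2) \<le> \<epsilon> \<longrightarrow> expect n f \<le> 1 / 2 \<longrightarrow>
       (\<exists>C \<subseteq> {1..n} \<times> {1..n}.
          real (card C) \<le> K * real n \<and>
          real (card (nondisjoint_pairs n C)) \<le> K * \<epsilon> * (real n)\<^sup>2 \<and>
          expect n (\<lambda>\<pi>. (f \<pi> - coset_sum C \<pi>)\<^sup>2) \<le> K * \<epsilon>)"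
    using approximable_all unfolding approximable_def .
next
  fix A :: real assume A: "A > 0"
  have "expect n (\<lambda>\<pi>. (dist01 (coset_sum C \<pi>))\<^sup>2) \<le> 4 * A * \<epsilon>"
    if n: "n \<ge> 1" and C: "C \<subseteq> {1..n} \<times> {1..n}" and M: "real (card (nondisjoint_pairs n C)) \<le> A * \<epsilon> * (real n)\<^sup>2" for n \<epsilon> C
  proof -
    have "expect n (\<lambda>\<pi>. (dist01 (coset_sum C \<pi>))\<^sup>2) \<le> 4 * real (card (nondisjoint_pairs n C)) / (real n)\<^sup>2"
      by (rule expect_dist01_coset_sum_le[OF C n])
    also have "\<dots> \<le> 4 * A * \<epsilon>" using M n by (simp add: divide_le_eq)
    finally show ?thesis .
  qed
  then show "\<exists>B>0. \<forall>n \<epsilon> C. n \<ge> 1 \<longrightarrow> \<epsilon> \<ge> 0 \<longrightarrow> C \<subseteq> {1..n} \<times> {1..n} \<longrightarrow>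
       real (card C) \<le> A * real n \<longrightarrow>
       real (card (nondisjoint_pairs n C)) \<le> A * \<epsilon> * (real n)\<^sup>2 \<longrightarrow>
       expect n (\<lambda>\<pi>. (dist01 (coset_sum C \<pi>))\<^sup>2) \<le> B * \<epsilon>"
    using A by (intro exI[of _ "4 * A"]) auto
qed

end
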